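(* Let $\mu,\sigma>0$, $0<\gamma<1$, $\nu=\frac{2\mu}{(\gamma-2)\sigma^2}<0$, $a=\frac1{2-\gamma}\in(\tfrac12,1)$. For $\theta\in\mathbb R$ let $\mathcal L_{\gamma,\theta}$ be the self-adjoint realization in $L^2((0,\infty),w_\gamma)$, $w_\gamma(x)=x^\gamma e^{\nu x^{2-\gamma}}$, of the CEV Fokker--Planck operator $\mathcal L_\gamma[p]=-\mu(xp)'+(\frac{\sigma^2}{2}x^\gamma p)''$ with boundary parameter $\theta$. For every $\lambda>0$ there is a unique $\theta\in\mathbb R$ such that $\lambda\in\sigma(\mathcal L_{\gamma,\theta})$. Writing $\lambda=\mu(2-\gamma)(\Lambda-1)$ with $\Lambda>1$, this $\theta=\theta(\Lambda)$ is the unique solution of $$\frac{\Gamma(-a)}{\Gamma(\Lambda-a)}+\theta\,\frac{\Gamma(1+a)}{\Gamma(\Lambda)}=0 .$$ The associated eigenfunctions are, for $c\in\mathbb R\setminus\{0\}$, $$p^c_\lambda(x)=c\,|\nu|(2-\gamma)\,x^{1-\gamma}\,\Psi\Big(\Lambda,1+\tfrac1{2-\gamma},|\nu|x^{2-\gamma}\Big),$$ and for $c>0$ the function $p^c_\lambda$ is non-negative and integrable on $(0,\infty)$. Moreover, for $c>0$ there are constants $K_1,K_2>0$ with $p^c_\lambda(x)\sim K_1x^{-\gamma}$ as $x\to0^+$ and $p^c_\lambda(x)\sim K_2x^{(2-\gamma)(1-\Lambda)-1}$ as $x\to\infty$. In contrast, the self-adjoint realization with $\theta=\infty$ has no eigenfunction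 in $L^1((0,\infty),dx)$.
   Context: $\Gamma$ is the Gamma function with $1/\Gamma=0$ at the non-positive integers. $\Psi(A,B,y)$ is the confluent hypergeometric function of the second kind (Tricomi's function $U(A,B,y)$), i.e. the solution of $yu''+(B-y)u'-Au=0$ on $(0,\infty)$ with $\Psi(A,B,y)\sim y^{-A}$ as $y\to\infty$. In Sturm--Liouville form, $\mathcal L_\gamma[p]=\frac1{w_\gamma}\big[(Q_2p')'+Q_0p\big]$ with $Q_2=\frac{\sigma^2}{2}x^\gamma w_\gamma$ and $Q_0=w_\gamma\big[\frac{\sigma^2}{2}\gamma(\gamma-1)x^{\gamma-2}-\mu\big]$. The maximal domain $\mathcal D_{\max}$ is the set of $p\in L^2((0,\infty),w_\gamma)$ such that $p,\,Q_2p'$ are locally absolutely continuous on $(0,\infty)$ and $\mathcal L_\gamma[p]\in L^2((0,\infty),w_\gamma)$. For $\theta\in\mathbb R$, $\mathcal L_{\gamma,\theta}$ acts as $\mathcal L_\gamma$ on those $p\in\mathcal D_{\max}$ with $$\lim_{x\to0^+}\Big\{\frac{\gamma}{2-\gamma}x^{\gamma-1}p(x)+\frac{x^\gamma}{2-\gamma}p'(x)-\frac{\theta|\nu|^{1/(2-\gamma)}}{(2-\gamma)^2}\,x^\gamma\big[xp'(x)+(\gamma-1)p(x)\big]\Big\}=0 ,$$ and for $\theta=\infty$ the condition is $\lim_{x\to0^+}x^\gamma[xp'(x)+(\gamma-1)p(x)]=0$. *)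

theory Defs
  imports "HOL-Analysis.Analysis" "HOL-Library.Landau_Symbols"
begin

section \<open>Local absolute continuity\<close>

definition abs_cont_on :: "real \<Rightarrow> real \<Rightarrow> (real \<Rightarrow> real) \<Rightarrow> bool" where
  "abs_cont_on a b f \<longleftrightarrow>
     (\<forall>\<epsilon>>0. \<exists>\<delta>>0. \<forall>I :: (real \<times> real) set.
        finite I \<and>
        (\<forall>(s, t) \<in> I. a \<le> s \<and> s \<le> t \<and> t \<le> b) \<and>
        pairwise (\<lambda>(s, t) (s', t'). {s<..<t} \<inter> {s'<..<t'} = {}) I \<and>
        (\<Sum>(s, t)\<in>I. t - s) < \<delta>
        \<longrightarrow> (\<Sum>(s, t)\<in>I. \<bar>f t - f s\<bar>) < \<epsilon>)"

definition loc_abs_cont_pos :: "(real \<Rightarrow> real) \<Rightarrow> bool" where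
  "loc_abs_cont_pos f \<longleftrightarrow> (\<forall>a b. 0 < a \<and> a < b \<longrightarrow> abs_cont_on a b f)"


section \<open>Unbounded operators in a real \<open>L\<^sup>2\<close> space\<close>

text \<open>
  Elements of \<open>L\<^sup>2(M)\<close> are represented by functions, to be read modulo equality almost everywhere.
  An operator is given by its domain \<open>D\<close> (a set of representatives) and its action \<open>A\<close>.
\<close>

definition L2_set_of :: "'a measure \<Rightarrow> ('a \<Rightarrow> real) set" where
  "L2_set_of M = {f \<in> borel_measurable M. integrable M (\<lambda>x. (f x)\<^sup>2)}"

definition L2_norm_of :: "'a measure \<Rightarrow> ('a \<Rightarrow> real) \<Rightarrow> real" where
  "L2_norm_of M f = sqrt (integral\<^sup>L M (\<lambda>x. (f x)\<^sup>2))"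

definition op_eigenfunction ::
    "'a measure \<Rightarrow> ('a \<Rightarrow> real) set \<Rightarrow> (('a \<Rightarrow> real) \<Rightarrow> 'a \<Rightarrow> real) \<Rightarrow> real \<Rightarrow> ('a \<Rightarrow> real) \<Rightarrow> bool" where
  "op_eigenfunction M D A l p \<longleftrightarrow>
     p \<in> D \<and> \<not> (AE x in M. p x = 0) \<and> (AE x in M. A p x = l * p x)"

text \<open>\<open>l\<close> is in the resolvent set iff \<open>A - l\<close> is a bijection of \<open>D\<close> onto \<open>L\<^sup>2(M)\<close> with bounded inverse.\<close>

definition op_resolvent_set ::
    "'a measure \<Rightarrow> ('a \<Rightarrow> real) set \<Rightarrow> (('a \<Rightarrow> real) \<Rightarrow> 'a \<Rightarrow> real) \<Rightarrow> real set" where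
  "op_resolvent_set M D A = {l.
     (\<forall>f \<in> L2_set_of M. \<exists>p \<in> D. (AE x in M. A p x - l * p x = f x) \<and>
        (\<forall>q \<in> D. (AE x in M. A q x - l * q x = f x) \<longrightarrow> (AE x in M. q x = p x))) \<and>
     (\<exists>C. \<forall>p \<in> D. L2_norm_of M p \<le> C * L2_norm_of M (\<lambda>x. A p x - l * p x))}"

definition op_spectrum ::
    "'a measure \<Rightarrow> ('a \<Rightarrow> real) set \<Rightarrow> (('a \<Rightarrow> real) \<Rightarrow> 'a \<Rightarrow> real) \<Rightarrow> real set" where
  "op_spectrum M D A = - op_resolvent_set M D A"


section \<open>Tricomi's confluent hypergeometric function\<close>

definition is_tricomi :: "real \<Rightarrow> real \<Rightarrow> (real \<Rightarrow> real) \<Rightarrow> bool" where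
  "is_tricomi A B u \<longleftrightarrow>
     (\<exists>u' u''. \<forall>y>0. (u has_real_derivative u' y) (at y) \<and>
                     (u' has_real_derivative u'' y) (at y) \<and>
                     y * u'' y + (B - y) * u' y - A * u y = 0) \<and>
     u \<sim>[at_top] (\<lambda>y. y powr (- A))"

text \<open>
  The solution is unique only on the positive half-line; taking the definite description of its
  value at each point avoids having to normalise it elsewhere. Only \<open>y > 0\<close> is meaningful.
\<close>

definition tricomi :: "real \<Rightarrow> real \<Rightarrow> real \<Rightarrow> real" where
  "tricomi A B y = (THE v. \<exists>u. is_tricomi A B u \<and> v = u y)"


section \<open>The CEV Fokker--Planck operator and its realizations\<close>

definition cev_nu :: "real \<Rightarrow> real \<Rightarrow> real \<Rightarrow> real" where
  "cev_nu \<mu> \<sigma> \<gamma> = 2 * \<mu> / ((\<gamma> - 2) * \<sigma>\<^sup>2)"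

definition cev_weight :: "real \<Rightarrow> real \<Rightarrow> real \<Rightarrow> real \<Rightarrow> real" where
  "cev_weight \<mu> \<sigma> \<gamma> x = x powr \<gamma> * exp (cev_nu \<mu> \<sigma> \<gamma> * x powr (2 - \<gamma>))"

definition cev_measure :: "real \<Rightarrow> real \<Rightarrow> real \<Rightarrow> real measure" where
  "cev_measure \<mu> \<sigma> \<gamma> = density (lebesgue_on {0<..}) (\<lambda>x. ennreal (cev_weight \<mu> \<sigma> \<gamma> x))"

definition cev_op :: "real \<Rightarrow> real \<Rightarrow> real \<Rightarrow> (real \<Rightarrow> real) \<Rightarrow> real \<Rightarrow> real" where
  "cev_op \<mu> \<sigma> \<gamma> p x =
     - \<mu> * deriv (\<lambda>t. t * p t) x + deriv (deriv (\<lambda>t. \<sigma>\<^sup>2 / 2 * t powr \<gamma> * p t)) x"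

definition cev_Q2 :: "real \<Rightarrow> real \<Rightarrow> real \<Rightarrow> real \<Rightarrow> real" where
  "cev_Q2 \<mu> \<sigma> \<gamma> x = \<sigma>\<^sup>2 / 2 * x powr \<gamma> * cev_weight \<mu> \<sigma> \<gamma> x"

definition cev_Q0 :: "real \<Rightarrow> real \<Rightarrow> real \<Rightarrow> real \<Rightarrow> real" where
  "cev_Q0 \<mu> \<sigma> \<gamma> x =
     cev_weight \<mu> \<sigma> \<gamma> x * (\<sigma>\<^sup>2 / 2 * \<gamma> * (\<gamma> - 1) * x powr (\<gamma> - 2) - \<mu>)"

lemma cev_op_sturm_liouville:
  assumes "\<sigma> \<noteq> 0" "\<gamma> \<noteq> 2" "x > 0"
    and d1: "\<And>t. t > 0 \<Longrightarrow> (p has_real_derivative p' t) (at t)"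
    and d2: "(p' has_real_derivative p2) (at x)"
  shows "cev_op \<mu> \<sigma> \<gamma> p x =
    (deriv (\<lambda>t. cev_Q2 \<mu> \<sigma> \<gamma> t * deriv p t) x + cev_Q0 \<mu> \<sigma> \<gamma> x * p x) / cev_weight \<mu> \<sigma> \<gamma> x"
proof -
  define \<nu> where "\<nu> = cev_nu \<mu> \<sigma> \<gamma>"
  define k where "k = \<sigma>\<^sup>2 / 2"
  have nu: "\<nu> * (2 - \<gamma>) * k = - \<mu>"
    using assms(1,2) by (simp add: k_def \<nu>_def cev_nu_def field_simps)
  have ev: "eventually (\<lambda>t. t > 0) (nhds x)"
    using eventually_nhds_in_open[of "{0<..}" x] \<open>x > 0\<close> by simp
  have A: "deriv (\<lambda>t. t * p t) x = p x + x * p' x"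
    by (rule DERIV_imp_deriv) (auto intro!: derivative_eq_intros d1 \<open>x > 0\<close>)
  have B1: "deriv (\<lambda>t. k * t powr \<gamma> * p t) t =
      k * (\<gamma> * t powr (\<gamma> - 1) * p t + t powr \<gamma> * p' t)" if "t > 0" for t
    by (rule DERIV_imp_deriv) (use that in \<open>auto intro!: derivative_eq_intros d1 simp: algebra_simps\<close>)
  have "deriv (deriv (\<lambda>t. k * t powr \<gamma> * p t)) x =
      deriv (\<lambda>t. k * (\<gamma> * t powr (\<gamma> - 1) * p t + t powr \<gamma> * p' t)) x"
    by (rule deriv_cong_ev) (use ev B1 in \<open>auto elim!: eventually_mono\<close>)
  also have "\<dots> = k * (\<gamma> * (\<gamma> - 1) * x powr (\<gamma> - 2) * p x
      + 2 * \<gamma> * x powr (\<gamma> - 1) * p' x + x powr \<gamma> * p2)"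
    by (rule DERIV_imp_deriv)
      (use \<open>x > 0\<close> in \<open>auto intro!: derivative_eq_intros d1 d2 simp: algebra_simps\<close>)
  finally have B: "deriv (deriv (\<lambda>t. k * t powr \<gamma> * p t)) x = \<dots>" .
  have C: "deriv (\<lambda>t. cev_Q2 \<mu> \<sigma> \<gamma> t * deriv p t) x =
      deriv (\<lambda>t. k * (t powr \<gamma> * (t powr \<gamma> * exp (\<nu> * t powr (2 - \<gamma>)))) * p' t) x"
  proof (rule deriv_cong_ev[OF _ refl])
    show "\<forall>\<^sub>F t in nhds x. cev_Q2 \<mu> \<sigma> \<gamma> t * deriv p t =
        k * (t powr \<gamma> * (t powr \<gamma> * exp (\<nu> * t powr (2 - \<gamma>)))) * p' t"
      using ev
      by eventually_elim
        (simp add: cev_Q2_def cev_weight_def k_def \<nu>_def DERIV_imp_deriv[OF d1])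
  qed
  have e1: "x powr (1 - \<gamma>) * x powr \<gamma> = x"
    using \<open>x > 0\<close> by (simp flip: powr_add)
  have "deriv (\<lambda>t. k * (t powr \<gamma> * (t powr \<gamma> * exp (\<nu> * t powr (2 - \<gamma>)))) * p' t) x =
      x powr \<gamma> * exp (\<nu> * x powr (2 - \<gamma>)) *
      (k * (2 * \<gamma> * x powr (\<gamma> - 1) * p' x
        + \<nu> * (2 - \<gamma>) * (x powr (1 - \<gamma>) * x powr \<gamma>) * p' x + x powr \<gamma> * p2))"
    by (rule DERIV_imp_deriv)
      (use \<open>x > 0\<close> in \<open>auto intro!: derivative_eq_intros d2 simp: algebra_simps\<close>)
  also have "\<dots> = cev_weight \<mu> \<sigma> \<gamma> x *
      (k * (2 * \<gamma> * x powr (\<gamma> - 1) * p' x + x powr \<gamma> * p2)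
        + (\<nu> * (2 - \<gamma>) * k) * x * p' x)"
    unfolding e1 by (simp add: cev_weight_def \<nu>_def algebra_simps)
  finally have C': "deriv (\<lambda>t. cev_Q2 \<mu> \<sigma> \<gamma> t * deriv p t) x = \<dots>"
    unfolding C .
  have "cev_weight \<mu> \<sigma> \<gamma> x \<noteq> 0"
    using \<open>x > 0\<close> by (simp add: cev_weight_def)
  then show ?thesis
    unfolding cev_op_def cev_Q0_def k_def[symmetric] A B C' nu by (simp add: field_simps)
qed

text \<open>
  The elements of the maximal domain are the locally absolutely continuous representatives; values
  outside \<open>(0, \<infinity>)\<close> play no role. The almost-everywhere condition, that the derivatives in \<open>\<L>\<^sub>\<gamma>[p]\<close>
  exist almost everywhere, follows from local absolute continuity (Lebesgue) and is listed only
  because \<^const>\<open>deriv\<close> is a total function.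
\<close>

definition cev_Dmax :: "real \<Rightarrow> real \<Rightarrow> real \<Rightarrow> (real \<Rightarrow> real) set" where
  "cev_Dmax \<mu> \<sigma> \<gamma> = {p \<in> L2_set_of (cev_measure \<mu> \<sigma> \<gamma>).
     loc_abs_cont_pos p \<and>
     loc_abs_cont_pos (\<lambda>x. cev_Q2 \<mu> \<sigma> \<gamma> x * deriv p x) \<and>
     (AE x in cev_measure \<mu> \<sigma> \<gamma>. p differentiable (at x) \<and>
        (\<lambda>t. cev_Q2 \<mu> \<sigma> \<gamma> t * deriv p t) differentiable (at x)) \<and>
     cev_op \<mu> \<sigma> \<gamma> p \<in> L2_set_of (cev_measure \<mu> \<sigma> \<gamma>)}"

definition cev_bdry_fin :: "real \<Rightarrow> (real \<Rightarrow> real) \<Rightarrow> real \<Rightarrow> real" where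
  "cev_bdry_fin \<gamma> p x =
     \<gamma> / (2 - \<gamma>) * x powr (\<gamma> - 1) * p x + x powr \<gamma> / (2 - \<gamma>) * deriv p x"

definition cev_bdry_inf :: "real \<Rightarrow> (real \<Rightarrow> real) \<Rightarrow> real \<Rightarrow> real" where
  "cev_bdry_inf \<gamma> p x = x powr \<gamma> * (x * deriv p x + (\<gamma> - 1) * p x)"

definition cev_domain :: "real \<Rightarrow> real \<Rightarrow> real \<Rightarrow> real \<Rightarrow> (real \<Rightarrow> real) set" where
  "cev_domain \<mu> \<sigma> \<gamma> \<theta> = {p \<in> cev_Dmax \<mu> \<sigma> \<gamma>.
     ((\<lambda>x. cev_bdry_fin \<gamma> p x
         - \<theta> * \<bar>cev_nu \<mu> \<sigma> \<gamma>\<bar> powr (1 / (2 - \<gamma>)) / (2 - \<gamma>)\<^sup>2 * cev_bdry_inf \<gamma> p x)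
       \<longlongrightarrow> 0) (at_right 0)}"

definition cev_domain_infinity :: "real \<Rightarrow> real \<Rightarrow> real \<Rightarrow> (real \<Rightarrow> real) set" where
  "cev_domain_infinity \<mu> \<sigma> \<gamma> =
     {p \<in> cev_Dmax \<mu> \<sigma> \<gamma>. (cev_bdry_inf \<gamma> p \<longlongrightarrow> 0) (at_right 0)}"

definition cev_spectrum :: "real \<Rightarrow> real \<Rightarrow> real \<Rightarrow> real \<Rightarrow> real set" where
  "cev_spectrum \<mu> \<sigma> \<gamma> \<theta> =
     op_spectrum (cev_measure \<mu> \<sigma> \<gamma>) (cev_domain \<mu> \<sigma> \<gamma> \<theta>) (cev_op \<mu> \<sigma> \<gamma>)"

definition cev_eigenfunction :: "real \<Rightarrow> real \<Rightarrow> real \<Rightarrow> real \<Rightarrow> real \<Rightarrow> (real \<Rightarrow> real) \<Rightarrow> bool" where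
  "cev_eigenfunction \<mu> \<sigma> \<gamma> \<theta> l p \<longleftrightarrow>
     op_eigenfunction (cev_measure \<mu> \<sigma> \<gamma>) (cev_domain \<mu> \<sigma> \<gamma> \<theta>) (cev_op \<mu> \<sigma> \<gamma>) l p"

definition cev_eigenfunction_infinity :: "real \<Rightarrow> real \<Rightarrow> real \<Rightarrow> real \<Rightarrow> (real \<Rightarrow> real) \<Rightarrow> bool" where
  "cev_eigenfunction_infinity \<mu> \<sigma> \<gamma> l p \<longleftrightarrow>
     op_eigenfunction (cev_measure \<mu> \<sigma> \<gamma>) (cev_domain_infinity \<mu> \<sigma> \<gamma>) (cev_op \<mu> \<sigma> \<gamma>) l p"

definition cev_p :: "real \<Rightarrow> real \<Rightarrow> real \<Rightarrow> real \<Rightarrow> real \<Rightarrow> real \<Rightarrow> real" where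
  "cev_p \<mu> \<sigma> \<gamma> \<Lambda> c x =
     c * \<bar>cev_nu \<mu> \<sigma> \<gamma>\<bar> * (2 - \<gamma>) * x powr (1 - \<gamma>) *
     tricomi \<Lambda> (1 + 1 / (2 - \<gamma>)) (\<bar>cev_nu \<mu> \<sigma> \<gamma>\<bar> * x powr (2 - \<gamma>))"

end

theory Submission
  imports Defs "HOL-Real_Asymp.Real_Asymp"
begin

text \<open>
  In the variable \<open>y = |\<nu>| x powr (2 - \<gamma>)\<close> the eigenvalue equation becomes Kummer's equation, and for \<open>\<Lambda> > 1\<close>
  the solution \<open>u\<close> built from Tricomi's function is positive, being a Laplace integral. Kummer's
  transformation provides a second Laplace integral, from which the coefficients of \<open>x powr - \<gamma>\<close> and
  \<open>x powr (1 - \<gamma>)\<close> at \<open>0\<close> can be read off; so \<open>u\<close> satisfies the boundary condition for exactly one \<open>\<theta>\<close>.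
  Because \<open>u > 0\<close>, every solution of the inhomogeneous equation can be written \<open>u R\<close> with \<open>R'\<close> given by
  the Wronskian. For the homogeneous equation this shows that infinity is a limit point, so that
  eigenfunctions are multiples of \<open>u\<close>; for the inhomogeneous one it gives the resolvent for all other \<open>\<theta>\<close>,
  bounded by an energy estimate. For \<open>\<theta> = \<infinity>\<close> and \<open>l \<le> 0\<close>, an integrable solution is excluded by the
  monotonicity of an energy built from the solution and its probability flux.
\<close>

subsection \<open>Absolutely continuous functions\<close>

text \<open>At \<open>0\<close> solutions combine \<open>x powr (- \<gamma>)\<close> and
  \<open>x powr (1 - \<gamma>)\<close>, and each boundary form sees only one of them:
  \<open>x p' + (\<gamma> - 1) p\<close> annihilates \<open>x powr (1 - \<gamma>)\<close>, whereas
  \<open>cev_bdry_fin\<close> is, up to a constant factor, \<open>(x powr \<gamma> * p)'\<close> and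
  annihilates \<open>x powr (- \<gamma>)\<close>. The two coefficients come from two Laplace
  integrals because each integral is controlled only through its leading singularity. Both carry a
  factor \<open>(1 + t) powr q\<close> with \<open>q \<le> 0\<close>, as
  \<open>\<Lambda> > 1 > a\<close>, and the estimates rest on this sign; it is not at hand for all
  \<open>l \<le> 0\<close>, hence the separate energy argument there. The domain asks for
  derivatives almost everywhere only. For eigenfunctions the right-hand side is continuous, so the
  equation is upgraded to every point; for the resolvent the right-hand side is merely square
  integrable, which calls for differentiating an integral almost everywhere. Division by the
  positive \<open>u\<close> replaces a second solution, so neither a Green function nor spectral
  theory of self-adjoint operators enters.\<close>

lemma sum_integral_disjoint_intervals_le:
  fixes h :: "real \<Rightarrow> real" and s t :: "'i \<Rightarrow> real"
  assumes "finite I" and h: "h integrable_on S" "\<And>x. x \<in> S \<Longrightarrow> 0 \<le> h x"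
    and sub: "\<And>i. i \<in> I \<Longrightarrow> {s i<..<t i} \<subseteq> S"
    and int: "\<And>i. i \<in> I \<Longrightarrow> h integrable_on {s i..t i}"
    and disj: "pairwise (\<lambda>i j. {s i<..<t i} \<inter> {s j<..<t j} = {}) I"
  shows "(\<Sum>i\<in>I. integral {s i..t i} h) \<le> integral S h"
proof -
  have "(h has_integral (\<Sum>i\<in>I. integral {s i..t i} h)) (\<Union>i\<in>I. {s i<..<t i})"
  proof (rule has_integral_UN[OF \<open>finite I\<close>])
    fix i assume "i \<in> I"
    then show "(h has_integral integral {s i..t i} h) {s i<..<t i}"
      using int has_integral_Icc_iff_Ioo integrable_integral by blast
  next
    show "pairwise (\<lambda>i i'. negligible ({s i<..<t i} \<inter> {s i'<..<t i'})) I"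
      using disj by (auto simp: pairwise_def)
  qed
  then show ?thesis
    using sub h by (intro has_integral_subset_le[OF _ _ integrable_integral[OF h(1)]]) auto
qed

lemma abs_cont_onI:
  assumes "\<And>\<epsilon>. \<epsilon> > 0 \<Longrightarrow> \<exists>\<delta>>0. \<forall>I. finite I \<longrightarrow> (\<forall>(s, t) \<in> I. a \<le> s \<and> s \<le> t \<and> t \<le> b) \<longrightarrow>
    pairwise (\<lambda>(s, t) (s', t'). {s<..<t} \<inter> {s'<..<t'} = {}) I \<longrightarrow>
    (\<Sum>(s, t)\<in>I. t - s) < \<delta> \<longrightarrow> (\<Sum>(s, t)\<in>I. \<bar>f t - f s\<bar>) < \<epsilon>"
  shows "abs_cont_on a b f"
  using assms unfolding abs_cont_on_def by (simp add: imp_conjL)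

lemma abs_cont_onD:
  assumes "abs_cont_on a b f" "\<epsilon> > 0"
  obtains \<delta> where "\<delta> > 0" "\<And>I. finite I \<Longrightarrow> (\<And>s t. (s, t) \<in> I \<Longrightarrow> a \<le> s \<and> s \<le> t \<and> t \<le> b) \<Longrightarrow>
    pairwise (\<lambda>(s, t) (s', t'). {s<..<t} \<inter> {s'<..<t'} = {}) I \<Longrightarrow>
    (\<Sum>(s, t)\<in>I. t - s) < \<delta> \<Longrightarrow> (\<Sum>(s, t)\<in>I. \<bar>f t - f s\<bar>) < \<epsilon>"
proof -
  obtain \<delta> where \<delta>: "\<delta> > 0" "\<And>I. finite I \<and> (\<forall>(s, t) \<in> I. a \<le> s \<and> s \<le> t \<and> t \<le> b) \<and>
    pairwise (\<lambda>(s, t) (s', t'). {s<..<t} \<inter> {s'<..<t'} = {}) I \<and>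
    (\<Sum>(s, t)\<in>I. t - s) < \<delta> \<longrightarrow> (\<Sum>(s, t)\<in>I. \<bar>f t - f s\<bar>) < \<epsilon>"
    using assms unfolding abs_cont_on_def by blast
  show ?thesis
    by (rule that[OF \<delta>(1)], rule \<delta>(2)[rule_format]) auto
qed

lemma abs_cont_onD_tagged:
  assumes "abs_cont_on a b f" "\<epsilon> > 0"
  obtains \<delta> where "\<delta> > 0" "\<And>p. \<lbrakk>p tagged_partial_division_of {a..b};
      (\<Sum>(x,K)\<in>p. measure lborel K) < \<delta>\<rbrakk> \<Longrightarrow> (\<Sum>(x,K)\<in>p. \<bar>f (Sup K) - f (Inf K)\<bar>) < \<epsilon>"
proof -
  obtain \<delta> where \<delta>: "\<delta> > 0" "\<And>I. finite I \<Longrightarrow> (\<And>s t. (s, t) \<in> I \<Longrightarrow> a \<le> s \<and> s \<le> t \<and> t \<le> b) \<Longrightarrow>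
    pairwise (\<lambda>(s, t) (s', t'). {s<..<t} \<inter> {s'<..<t'} = {}) I \<Longrightarrow>
    (\<Sum>(s, t)\<in>I. t - s) < \<delta> \<Longrightarrow> (\<Sum>(s, t)\<in>I. \<bar>f t - f s\<bar>) < \<epsilon>"
    using abs_cont_onD[OF assms] by blast
  show ?thesis
  proof (rule that[OF \<delta>(1)])
    fix p assume p: "p tagged_partial_division_of {a..b}" and small: "(\<Sum>(x,K)\<in>p. measure lborel K) < \<delta>"
    note pD = tagged_partial_division_ofD[OF p]
    define h where "h = (\<lambda>(x::real,K::real set). (Inf K, Sup K))"
    have K: "\<exists>s t. K = {s..t} \<and> s \<le> t \<and> a \<le> s \<and> t \<le> b \<and> Inf K = s \<and> Sup K = t \<and> measure lborel K = t - s"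
      if xK: "(x,K) \<in> p" for x K
    proof -
      obtain s t where st: "K = cbox s t" using pD(4)[OF xK] by blast
      have "s \<le> t" using pD(2)[OF xK] st by auto
      moreover have "a \<le> s" "t \<le> b" using pD(3)[OF xK] st \<open>s \<le> t\<close> by auto
      ultimately show ?thesis using st by auto
    qed
    \<comment> \<open>\<open>h\<close> need not be injective. Two distinct tagged pieces with the
      same end points have disjoint interiors, so their common interval is a point, on which
      \<open>g\<close> vanishes.\<close>
    have re: "(\<Sum>i\<in>h ` p. g i) = (\<Sum>i\<in>p. g (h i))" if "\<And>s. g (s,s) = 0" for g :: "real \<times> real \<Rightarrow> real"
    proof (rule sum.reindex_nontrivial[OF pD(1), unfolded o_def])
      fix i j assume ij: "i \<in> p" "j \<in> p" "i \<noteq> j" "h i = h j"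
      obtain x K y L where xy: "i = (x,K)" "j = (y,L)" by (cases i, cases j)
      from K[of x K] K[of y L] ij xy obtain s t where "K = {s..t}" "L = {s..t}" "s \<le> t"
        by (auto simp: h_def)
      then have "K = L" "interior K = {s<..<t}" by (auto simp: interior_atLeastAtMost_real)
      then have "{s<..<t} = {}" using pD(5)[of x K y L] ij xy by auto
      then show "g (h i) = 0" using \<open>K = {s..t}\<close> \<open>s \<le> t\<close> that xy by (auto simp: h_def)
    qed
    have "(\<Sum>(s, t)\<in>h ` p. \<bar>f t - f s\<bar>) < \<epsilon>"
    proof (rule \<delta>(2))
      show "finite (h ` p)" using pD(1) by simp
      show "a \<le> s \<and> s \<le> t \<and> t \<le> b" if "(s, t) \<in> h ` p" for s t
      proof -
        obtain x L where xL: "(x,L) \<in> p" "s = Inf L" "t = Sup L" using \<open>(s, t) \<in> h ` p\<close> by (auto simp: h_def)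
        then show ?thesis using K[OF xL(1)] by auto
      qed
      show "pairwise (\<lambda>(s, t) (s', t'). {s<..<t} \<inter> {s'<..<t'} = {}) (h ` p)"
      proof (rule pairwise_imageI)
        fix i j assume ij: "i \<in> p" "j \<in> p" "i \<noteq> j"
        obtain x L y M where xy: "i = (x,L)" "j = (y,M)" by (cases i, cases j)
        obtain s t s' t' where st: "L = {s..t}" "M = {s'..t'}" "h i = (s,t)" "h j = (s',t')"
          using K[of x L] K[of y M] ij xy unfolding h_def by (metis (no_types, lifting) case_prod_conv)
        have "interior L \<inter> interior M = {}" using pD(5)[of x L y M] ij xy by auto
        then show "(case h i of (s, t) \<Rightarrow> \<lambda>(s', t'). {s<..<t} \<inter> {s'<..<t'} = {}) (h j)"
          using st by (auto simp: interior_atLeastAtMost_real)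
      qed
      have "(\<Sum>(s, t)\<in>h ` p. t - s) = (\<Sum>(x,K)\<in>p. measure lborel K)"
      proof (subst re)
        show "(\<Sum>i\<in>p. case h i of (s, t) \<Rightarrow> t - s) = (\<Sum>(x,K)\<in>p. measure lborel K)"
        proof (rule sum.cong[OF refl])
          fix i assume "i \<in> p"
          obtain x L where "i = (x,L)" by (cases i)
          then show "(case h i of (s, t) \<Rightarrow> t - s) = (case i of (x, K) \<Rightarrow> measure lborel K)"
            using K[of x L] \<open>i \<in> p\<close> by (auto simp: h_def)
        qed
      qed auto
      then show "(\<Sum>(s, t)\<in>h ` p. t - s) < \<delta>" using small by simp
    qed
    also have "(\<Sum>(s, t)\<in>h ` p. \<bar>f t - f s\<bar>) = (\<Sum>(x,K)\<in>p. \<bar>f (Sup K) - f (Inf K)\<bar>)"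
      by (subst re) (auto intro!: sum.cong simp: h_def)
    finally show "(\<Sum>(x,K)\<in>p. \<bar>f (Sup K) - f (Inf K)\<bar>) < \<epsilon>" .
  qed
qed

text \<open>A Cousin partition whose gauge is small around the exceptional null set and around every other
  point forces \<open>|f'| \<le> \<epsilon>\<close>; the intervals tagged in the null set are handled by absolute continuity.\<close>

lemma abs_cont_on_zero_derivative:
  assumes ac: "abs_cont_on a b f" and "a \<le> b" and N: "negligible N"
    and der: "\<And>x. x \<in> {a..b} - N \<Longrightarrow> (f has_real_derivative 0) (at x within {a..b})"
  shows "f b = f a"
proof -
  have le: "\<bar>f b - f a\<bar> \<le> \<epsilon>" if eps: "\<epsilon> > 0" for \<epsilon>
  proof -
    \<comment> \<open>The summand \<open>1\<close> keeps the quotient meaningful when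
      \<open>a = b\<close>; in any case \<open>e * (b - a)\<close> is at most half of
      \<open>\<epsilon>\<close>.\<close>
    define e where "e = \<epsilon> / (2 * (b - a + 1))"
    have "e > 0" using that \<open>a \<le> b\<close> by (simp add: e_def)
    obtain \<delta> where \<delta>: "\<delta> > 0" "\<And>p. \<lbrakk>p tagged_partial_division_of {a..b};
      (\<Sum>(x,K)\<in>p. measure lborel K) < \<delta>\<rbrakk> \<Longrightarrow> (\<Sum>(x,K)\<in>p. \<bar>f (Sup K) - f (Inf K)\<bar>) < \<epsilon> / 2"
      using abs_cont_onD_tagged[OF ac half_gt_zero[OF eps]] by blast
    obtain U where U: "open U" "N \<subseteq> U" "U - N \<in> lmeasurable" "emeasure lebesgue (U - N) < ennreal \<delta>"
      using sets_lebesgue_outer_open[OF negligible_imp_sets[OF N] \<delta>(1)] by blast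
    have "U = (U - N) \<union> N" using U by auto
    then have Um: "U \<in> lmeasurable" using U(3) N
      by (metis fmeasurable.Un negligible_imp_measurable)
    have "measure lebesgue U = measure lebesgue (U - N)"
      using N by (intro measure_negligible_symdiff[OF U(3)]) (auto intro: negligible_subset)
    moreover have "measure lebesgue (U - N) < \<delta>"
      using U(3,4) \<delta>(1) by (simp add: emeasure_eq_measure2 ennreal_less_iff)
    ultimately have Ud: "measure lebesgue U < \<delta>" by simp
    have "\<forall>x. \<exists>d>0. x \<in> {a..b} - N \<longrightarrow> (\<forall>y\<in>{a..b}. \<bar>y - x\<bar> < d \<longrightarrow> \<bar>f y - f x\<bar> \<le> e * \<bar>y - x\<bar>)"
    proof
      fix x
      show "\<exists>d>0. x \<in> {a..b} - N \<longrightarrow> (\<forall>y\<in>{a..b}. \<bar>y - x\<bar> < d \<longrightarrow> \<bar>f y - f x\<bar> \<le> e * \<bar>y - x\<bar>)"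
      proof (cases "x \<in> {a..b} - N")
        case True
        then have "(f has_derivative (\<lambda>h. 0)) (at x within {a..b})"
          using der[OF True] unfolding has_field_derivative_def lambda_zero[symmetric] by simp
        then show ?thesis
          using \<open>e > 0\<close> unfolding has_derivative_within_alt by (auto simp: abs_minus_commute)
      qed (auto intro: exI[of _ 1])
    qed
    then obtain d where d: "\<And>x. d x > 0"
      "\<And>x y. \<lbrakk>x \<in> {a..b} - N; y \<in> {a..b}; \<bar>y - x\<bar> < d x\<rbrakk> \<Longrightarrow> \<bar>f y - f x\<bar> \<le> e * \<bar>y - x\<bar>"
      by metis
    define \<gamma> where "\<gamma> x = (if x \<in> N then U else ball x (d x))" for x
    have "gauge \<gamma>" using U d(1) by (auto simp: gauge_def \<gamma>_def)
    then obtain p where p: "p tagged_division_of {a..b}" "\<gamma> fine p"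
      using fine_division_exists_real by blast
    note pD = tagged_division_ofD[OF p(1)]
    define p1 where "p1 = {(x,K)\<in>p. x \<in> N}"
    have p1: "p1 \<subseteq> p" "finite p1" using pD(1) by (auto simp: p1_def intro: finite_subset)
    have p1t: "p1 tagged_partial_division_of {a..b}"
      using p(1) p1(1) tagged_partial_division_subset tagged_division_of_def by blast
    have K: "\<exists>s t. K = {s..t} \<and> s \<le> t \<and> a \<le> s \<and> t \<le> b \<and> Inf K = s \<and> Sup K = t \<and> measure lborel K = t - s \<and> s \<le> x \<and> x \<le> t"
      if xK: "(x,K) \<in> p" for x K
    proof -
      obtain s t where st: "K = cbox s t" using pD(4)[OF xK] by blast
      have "s \<le> t" using pD(2)[OF xK] st by auto
      moreover have "a \<le> s" "t \<le> b" using pD(3)[OF xK] st \<open>s \<le> t\<close> by auto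
      ultimately show ?thesis using st pD(2)[OF xK] by auto
    qed
    have eq: "(\<Sum>i\<in>p1. integral {Inf (snd i)..Sup (snd i)} (\<lambda>_. 1)) = (\<Sum>(x,K)\<in>p1. measure lborel K)"
    proof (rule sum.cong, goal_cases)
      case (2 i)
      obtain x L where i: "i = (x,L)" by (cases i)
      then obtain s t where "L = {s..t}" "s \<le> t" using K[of x L] 2 p1 by auto
      then show ?case using i by simp
    qed simp
    have "(\<Sum>i\<in>p1. integral {Inf (snd i)..Sup (snd i)} (\<lambda>_. 1)) \<le> integral U (\<lambda>_. 1::real)"
    proof (rule sum_integral_disjoint_intervals_le[OF p1(2)])
      show "(\<lambda>_. 1::real) integrable_on U" using Um by (simp add: integrable_on_const)
      fix i assume "i \<in> p1"
      obtain x L where i: "i = (x,L)" by (cases i)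
      then obtain s t where st: "L = {s..t}" "s \<le> t" using K[of x L] \<open>i \<in> p1\<close> p1 by auto
      have "L \<subseteq> \<gamma> x" "x \<in> N" using p(2) \<open>i \<in> p1\<close> i unfolding fine_def p1_def by auto
      then have "L \<subseteq> U" by (simp add: \<gamma>_def)
      with st i show "{Inf (snd i)<..<Sup (snd i)} \<subseteq> U" by auto
    next
      show "pairwise (\<lambda>i j. {Inf (snd i)<..<Sup (snd i)} \<inter> {Inf (snd j)<..<Sup (snd j)} = {}) p1"
      proof (rule pairwiseI)
        fix i j assume ij: "i \<in> p1" "j \<in> p1" "i \<noteq> j"
        obtain x L y M where xy: "i = (x,L)" "j = (y,M)" by (cases i, cases j)
        obtain s t s' t' where st: "L = {s..t}" "M = {s'..t'}" "s \<le> t" "s' \<le> t'"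
          using K[of x L] K[of y M] ij xy p1 by blast
        have "interior L \<inter> interior M = {}" using pD(5)[of x L y M] ij xy p1 by auto
        then show "{Inf (snd i)<..<Sup (snd i)} \<inter> {Inf (snd j)<..<Sup (snd j)} = {}"
          using st xy by (simp add: interior_atLeastAtMost_real)
      qed
    qed auto
    also have "\<dots> = measure lebesgue U" using Um by (simp add: lmeasure_integral)
    finally have "(\<Sum>(x,K)\<in>p1. measure lborel K) < \<delta>" using Ud eq by simp
    then have b1: "(\<Sum>(x,K)\<in>p1. \<bar>f (Sup K) - f (Inf K)\<bar>) < \<epsilon> / 2"
      by (rule \<delta>(2)[OF p1t])
    have "(\<Sum>(x,K)\<in>p-p1. \<bar>f (Sup K) - f (Inf K)\<bar>) \<le> (\<Sum>(x,K)\<in>p-p1. e * measure lborel K)"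
    proof (rule sum_mono)
      fix i assume i: "i \<in> p - p1"
      obtain x L where x: "i = (x,L)" by (cases i)
      obtain s t where st: "L = {s..t}" "s \<le> t" "a \<le> s" "t \<le> b" "Inf L = s" "Sup L = t" "measure lborel L = t - s" "s \<le> x" "x \<le> t"
        using K[of x L] i x by blast
      have xN: "x \<in> {a..b} - N" using i x st by (auto simp: p1_def)
      have "L \<subseteq> \<gamma> x" using p(2) i x unfolding fine_def by auto
      then have "L \<subseteq> ball x (d x)" using xN by (simp add: \<gamma>_def)
      moreover have "s \<in> L" "t \<in> L" using st(1,2) by auto
      ultimately have "s \<in> ball x (d x)" "t \<in> ball x (d x)" by blast+
      then have "\<bar>s - x\<bar> < d x" "\<bar>t - x\<bar> < d x" by (auto simp: dist_real_def abs_minus_commute)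
      then have "\<bar>f s - f x\<bar> \<le> e * \<bar>s - x\<bar>" "\<bar>f t - f x\<bar> \<le> e * \<bar>t - x\<bar>"
        using st by (intro d(2) xN; simp)+
      \<comment> \<open>Straddle estimate: the tag lies between the end points, so the errors
        \<open>e * (x - s)\<close> and \<open>e * (t - x)\<close> add up to
        \<open>e * (t - s)\<close>.\<close>
      then have "\<bar>f t - f s\<bar> \<le> e * (t - s)"
        using st by (auto simp: algebra_simps)
      then show "(case i of (x,K) \<Rightarrow> \<bar>f (Sup K) - f (Inf K)\<bar>) \<le> (case i of (x,K) \<Rightarrow> e * measure lborel K)"
        using x st by simp
    qed
    also have "\<dots> \<le> (\<Sum>(x,K)\<in>p. e * measure lborel K)"
      using pD(1) \<open>e > 0\<close> by (intro sum_mono2) auto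
    also have "\<dots> = e * (b - a)"
      using additive_content_tagged_division[of p a b] p(1) \<open>a \<le> b\<close>
      by (simp add: case_prod_unfold flip: sum_distrib_left)
    also have "\<dots> \<le> \<epsilon> / 2"
      using \<open>a \<le> b\<close> that by (simp add: e_def field_simps)
    finally have b2: "(\<Sum>(x,K)\<in>p-p1. \<bar>f (Sup K) - f (Inf K)\<bar>) \<le> \<epsilon> / 2" .
    have "\<bar>f b - f a\<bar> = \<bar>\<Sum>(x,K)\<in>p. f (Sup K) - f (Inf K)\<bar>"
      using additive_tagged_division_1[OF \<open>a \<le> b\<close> p(1), of f] by simp
    also have "\<dots> \<le> (\<Sum>(x,K)\<in>p. \<bar>f (Sup K) - f (Inf K)\<bar>)"
      by (rule order_trans[OF sum_abs]) (simp add: case_prod_unfold)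
    also have "\<dots> = (\<Sum>(x,K)\<in>p1. \<bar>f (Sup K) - f (Inf K)\<bar>) + (\<Sum>(x,K)\<in>p-p1. \<bar>f (Sup K) - f (Inf K)\<bar>)"
      using sum.subset_diff[OF p1(1) pD(1)] by (simp add: add.commute)
    finally show ?thesis using b1 b2 by simp
  qed
  have "\<bar>f b - f a\<bar> \<le> 0"
    by (rule field_le_epsilon) (simp add: le del: abs_le_zero_iff)
  then show ?thesis by simp
qed

section \<open>Sources and closure properties of absolute continuity\<close>

lemma abs_cont_on_subinterval:
  assumes "abs_cont_on a b f" "a \<le> c" "d \<le> b"
  shows "abs_cont_on c d f"
proof (rule abs_cont_onI)
  fix \<epsilon> :: real assume "\<epsilon> > 0"
  obtain \<delta> where \<delta>: "\<delta> > 0" "\<And>I. finite I \<Longrightarrow> (\<And>s t. (s, t) \<in> I \<Longrightarrow> a \<le> s \<and> s \<le> t \<and> t \<le> b) \<Longrightarrow>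
    pairwise (\<lambda>(s, t) (s', t'). {s<..<t} \<inter> {s'<..<t'} = {}) I \<Longrightarrow>
    (\<Sum>(s, t)\<in>I. t - s) < \<delta> \<Longrightarrow> (\<Sum>(s, t)\<in>I. \<bar>f t - f s\<bar>) < \<epsilon>"
    using abs_cont_onD[OF assms(1) \<open>\<epsilon> > 0\<close>] by blast
  show "\<exists>\<delta>>0. \<forall>I. finite I \<longrightarrow> (\<forall>(s, t) \<in> I. c \<le> s \<and> s \<le> t \<and> t \<le> d) \<longrightarrow>
    pairwise (\<lambda>(s, t) (s', t'). {s<..<t} \<inter> {s'<..<t'} = {}) I \<longrightarrow>
    (\<Sum>(s, t)\<in>I. t - s) < \<delta> \<longrightarrow> (\<Sum>(s, t)\<in>I. \<bar>f t - f s\<bar>) < \<epsilon>"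
    by (rule exI[of _ \<delta>], intro conjI allI impI \<delta>) (use assms in force)+
qed

lemma abs_cont_on_lipschitz:
  assumes "\<And>x y. x \<in> {a..b} \<Longrightarrow> y \<in> {a..b} \<Longrightarrow> \<bar>f x - f y\<bar> \<le> L * \<bar>x - y\<bar>"
  shows "abs_cont_on a b f"
proof (rule abs_cont_onI)
  fix \<epsilon> :: real assume "\<epsilon> > 0"
  define \<delta> where "\<delta> = \<epsilon> / (\<bar>L\<bar> + 1)"
  have \<delta>: "\<delta> > 0" using \<open>\<epsilon> > 0\<close> by (simp add: \<delta>_def)
  show "\<exists>\<delta>>0. \<forall>I. finite I \<longrightarrow> (\<forall>(s, t) \<in> I. a \<le> s \<and> s \<le> t \<and> t \<le> b) \<longrightarrow>
    pairwise (\<lambda>(s, t) (s', t'). {s<..<t} \<inter> {s'<..<t'} = {}) I \<longrightarrow>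
    (\<Sum>(s, t)\<in>I. t - s) < \<delta> \<longrightarrow> (\<Sum>(s, t)\<in>I. \<bar>f t - f s\<bar>) < \<epsilon>"
  proof (rule exI[of _ \<delta>], intro conjI allI impI \<delta>)
    fix I :: "(real \<times> real) set"
    assume I: "finite I" "\<forall>(s, t) \<in> I. a \<le> s \<and> s \<le> t \<and> t \<le> b" "(\<Sum>(s, t)\<in>I. t - s) < \<delta>"
    have "(\<Sum>(s, t)\<in>I. \<bar>f t - f s\<bar>) \<le> (\<Sum>(s, t)\<in>I. (\<bar>L\<bar> + 1) * (t - s))"
    proof (rule sum_mono, clarify)
      fix s t assume "(s, t) \<in> I"
      then have st: "a \<le> s" "s \<le> t" "t \<le> b" using I(2) by auto
      have "\<bar>f t - f s\<bar> \<le> L * \<bar>t - s\<bar>" using st by (intro assms) auto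
      also have "\<dots> \<le> (\<bar>L\<bar> + 1) * (t - s)" using st by (auto intro!: mult_right_mono)
      finally show "\<bar>f t - f s\<bar> \<le> (\<bar>L\<bar> + 1) * (t - s)" .
    qed
    also have "\<dots> = (\<bar>L\<bar> + 1) * (\<Sum>(s, t)\<in>I. t - s)" by (simp add: sum_distrib_left case_prod_unfold)
    also have "\<dots> < (\<bar>L\<bar> + 1) * \<delta>" using I(3) by (intro mult_strict_left_mono) auto
    also have "\<dots> = \<epsilon>" by (simp add: \<delta>_def)
    finally show "(\<Sum>(s, t)\<in>I. \<bar>f t - f s\<bar>) < \<epsilon>" .
  qed
qed

lemma abs_cont_on_C1:
  assumes der: "\<And>x. x \<in> {a..b} \<Longrightarrow> (f has_real_derivative f' x) (at x within {a..b})"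
    and cont: "continuous_on {a..b} f'"
  shows "abs_cont_on a b f"
proof -
  obtain L where L: "\<And>x. x \<in> {a..b} \<Longrightarrow> \<bar>f' x\<bar> \<le> L"
    using compact_imp_bounded[OF compact_continuous_image[OF cont compact_Icc]]
    unfolding bounded_iff by (metis imageI real_norm_def)
  show ?thesis
  proof (rule abs_cont_on_lipschitz)
    fix x y assume xy: "x \<in> {a..b}" "y \<in> {a..b}"
    have "norm (f x - f y) \<le> L * norm (x - y)"
      by (rule field_differentiable_bound[of "{a..b}" f f']) (use der L xy in auto)
    then show "\<bar>f x - f y\<bar> \<le> L * \<bar>x - y\<bar>" by simp
  qed
qed

lemma abs_cont_on_imp_continuous_on:
  assumes "abs_cont_on a b f"
  shows "continuous_on {a..b} f"
  unfolding continuous_on_iff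
proof (intro ballI allI impI)
  fix x \<epsilon> :: real assume x: "x \<in> {a..b}" and "\<epsilon> > 0"
  obtain \<delta> where \<delta>: "\<delta> > 0" "\<And>I. finite I \<Longrightarrow> (\<And>s t. (s, t) \<in> I \<Longrightarrow> a \<le> s \<and> s \<le> t \<and> t \<le> b) \<Longrightarrow>
    pairwise (\<lambda>(s, t) (s', t'). {s<..<t} \<inter> {s'<..<t'} = {}) I \<Longrightarrow>
    (\<Sum>(s, t)\<in>I. t - s) < \<delta> \<Longrightarrow> (\<Sum>(s, t)\<in>I. \<bar>f t - f s\<bar>) < \<epsilon>"
    using abs_cont_onD[OF assms \<open>\<epsilon> > 0\<close>] by blast
  have "dist (f y) (f x) < \<epsilon>" if y: "y \<in> {a..b}" "dist y x < \<delta>" for y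
  proof (cases "x \<le> y")
    case True
    then show ?thesis using \<delta>(2)[of "{(x, y)}"] x y by (simp add: dist_real_def)
  next
    case False
    then show ?thesis using \<delta>(2)[of "{(y, x)}"] x y by (simp add: dist_real_def)
  qed
  then show "\<exists>d>0. \<forall>x'\<in>{a..b}. dist x' x < d \<longrightarrow> dist (f x') (f x) < \<epsilon>"
    using \<delta>(1) by blast
qed

text \<open>Sums, differences, products and changes outside the interval all satisfy such a bound on
  increments, so the epsilon-delta argument is carried out once.\<close>

lemma abs_cont_on_dominated:
  assumes f: "abs_cont_on a b f" and g: "abs_cont_on a b g" and "A \<ge> 0" "B \<ge> 0"
    and le: "\<And>s t. a \<le> s \<Longrightarrow> s \<le> t \<Longrightarrow> t \<le> b \<Longrightarrow> \<bar>h t - h s\<bar> \<le> A * \<bar>f t - f s\<bar> + B * \<bar>g t - g s\<bar>"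
  shows "abs_cont_on a b h"
proof (rule abs_cont_onI)
  fix \<epsilon> :: real assume "\<epsilon> > 0"
  then have A: "\<epsilon> / (2 * (A + 1)) > 0" and B: "\<epsilon> / (2 * (B + 1)) > 0"
    using assms(3,4) by auto
  obtain \<delta>1 where \<delta>1: "\<delta>1 > 0" "\<And>I. finite I \<Longrightarrow> (\<And>s t. (s, t) \<in> I \<Longrightarrow> a \<le> s \<and> s \<le> t \<and> t \<le> b) \<Longrightarrow>
    pairwise (\<lambda>(s, t) (s', t'). {s<..<t} \<inter> {s'<..<t'} = {}) I \<Longrightarrow>
    (\<Sum>(s, t)\<in>I. t - s) < \<delta>1 \<Longrightarrow> (\<Sum>(s, t)\<in>I. \<bar>f t - f s\<bar>) < \<epsilon> / (2 * (A + 1))"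
    using abs_cont_onD[OF f A] by blast
  obtain \<delta>2 where \<delta>2: "\<delta>2 > 0" "\<And>I. finite I \<Longrightarrow> (\<And>s t. (s, t) \<in> I \<Longrightarrow> a \<le> s \<and> s \<le> t \<and> t \<le> b) \<Longrightarrow>
    pairwise (\<lambda>(s, t) (s', t'). {s<..<t} \<inter> {s'<..<t'} = {}) I \<Longrightarrow>
    (\<Sum>(s, t)\<in>I. t - s) < \<delta>2 \<Longrightarrow> (\<Sum>(s, t)\<in>I. \<bar>g t - g s\<bar>) < \<epsilon> / (2 * (B + 1))"
    using abs_cont_onD[OF g B] by blast
  show "\<exists>\<delta>>0. \<forall>I. finite I \<longrightarrow> (\<forall>(s, t) \<in> I. a \<le> s \<and> s \<le> t \<and> t \<le> b) \<longrightarrow>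
    pairwise (\<lambda>(s, t) (s', t'). {s<..<t} \<inter> {s'<..<t'} = {}) I \<longrightarrow>
    (\<Sum>(s, t)\<in>I. t - s) < \<delta> \<longrightarrow> (\<Sum>(s, t)\<in>I. \<bar>h t - h s\<bar>) < \<epsilon>"
  proof (rule exI[of _ "min \<delta>1 \<delta>2"], intro conjI allI impI)
    fix I :: "(real \<times> real) set"
    assume I: "finite I" "\<forall>(s, t) \<in> I. a \<le> s \<and> s \<le> t \<and> t \<le> b"
      "pairwise (\<lambda>(s, t) (s', t'). {s<..<t} \<inter> {s'<..<t'} = {}) I" "(\<Sum>(s, t)\<in>I. t - s) < min \<delta>1 \<delta>2"
    define F where "F = (\<Sum>(s, t)\<in>I. \<bar>f t - f s\<bar>)"
    define G where "G = (\<Sum>(s, t)\<in>I. \<bar>g t - g s\<bar>)"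
    have F: "F < \<epsilon> / (2 * (A + 1))" unfolding F_def using I by (intro \<delta>1(2)) auto
    have G: "G < \<epsilon> / (2 * (B + 1))" unfolding G_def using I by (intro \<delta>2(2)) auto
    have pos: "F \<ge> 0" "G \<ge> 0" by (auto simp: F_def G_def intro!: sum_nonneg)
    have "(\<Sum>(s, t)\<in>I. \<bar>h t - h s\<bar>) \<le> (\<Sum>(s, t)\<in>I. A * \<bar>f t - f s\<bar> + B * \<bar>g t - g s\<bar>)"
      using I(2) by (intro sum_mono) (auto intro!: le)
    also have "\<dots> = A * F + B * G"
      by (simp add: F_def G_def case_prod_unfold sum.distrib sum_distrib_left)
    also have "\<dots> \<le> (A + 1) * F + (B + 1) * G" using pos by (simp add: algebra_simps)
    also have "\<dots> < \<epsilon> / 2 + \<epsilon> / 2"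
      using F G assms(3,4) by (intro add_strict_mono) (auto simp: field_simps)
    finally show "(\<Sum>(s, t)\<in>I. \<bar>h t - h s\<bar>) < \<epsilon>" by simp
  qed (use \<delta>1 \<delta>2 in auto)
qed

lemma abs_cont_on_cong:
  assumes "\<And>x. a \<le> x \<Longrightarrow> x \<le> b \<Longrightarrow> f x = g x" "abs_cont_on a b f"
  shows "abs_cont_on a b g"
  by (rule abs_cont_on_dominated[OF assms(2,2), of 1 0]) (auto simp: assms(1)[symmetric])

lemma abs_cont_on_add:
  assumes "abs_cont_on a b f" "abs_cont_on a b g"
  shows "abs_cont_on a b (\<lambda>x. f x + g x)"
  by (rule abs_cont_on_dominated[OF assms, of 1 1]) auto

lemma abs_cont_on_diff:
  assumes "abs_cont_on a b f" "abs_cont_on a b g"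
  shows "abs_cont_on a b (\<lambda>x. f x - g x)"
  by (rule abs_cont_on_dominated[OF assms, of 1 1]) auto

lemma abs_cont_on_mult:
  assumes f: "abs_cont_on a b f" and g: "abs_cont_on a b g"
  shows "abs_cont_on a b (\<lambda>x. f x * g x)"
proof -
  obtain A where A: "\<And>x. x \<in> {a..b} \<Longrightarrow> \<bar>g x\<bar> \<le> A" "A > 0"
    using compact_imp_bounded[OF compact_continuous_image[OF abs_cont_on_imp_continuous_on[OF g] compact_Icc]]
    unfolding bounded_pos by (metis imageI real_norm_def)
  obtain B where B: "\<And>x. x \<in> {a..b} \<Longrightarrow> \<bar>f x\<bar> \<le> B" "B > 0"
    using compact_imp_bounded[OF compact_continuous_image[OF abs_cont_on_imp_continuous_on[OF f] compact_Icc]]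
    unfolding bounded_pos by (metis imageI real_norm_def)
  show ?thesis
  proof (rule abs_cont_on_dominated[OF assms, of A B])
    fix s t assume st: "a \<le> s" "s \<le> t" "t \<le> b"
    have "\<bar>f t * g t - f s * g s\<bar> = \<bar>g t * (f t - f s) + f s * (g t - g s)\<bar>"
      by (simp add: algebra_simps)
    also have "\<dots> \<le> \<bar>g t\<bar> * \<bar>f t - f s\<bar> + \<bar>f s\<bar> * \<bar>g t - g s\<bar>"
      by (metis abs_mult abs_triangle_ineq)
    also have "\<dots> \<le> A * \<bar>f t - f s\<bar> + B * \<bar>g t - g s\<bar>"
      using st by (intro add_mono mult_right_mono A B) auto
    finally show "\<bar>f t * g t - f s * g s\<bar> \<le> A * \<bar>f t - f s\<bar> + B * \<bar>g t - g s\<bar>" .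
  qed (use A B in auto)
qed

text \<open>Completeness of Lebesgue measure makes the exceptional set itself null instead of merely
  contained in a null set.\<close>

lemma AE_lebesgue_on_iff_negligible:
  assumes "S \<in> sets lebesgue"
  shows "(AE x in lebesgue_on S. P x) \<longleftrightarrow> negligible {x\<in>S. \<not> P x}"
proof -
  have "{x \<in> space lebesgue. \<not> (x \<in> S \<longrightarrow> P x)} = {x\<in>S. \<not> P x}" by auto
  moreover have "(AE x in lebesgue_on S. P x) \<longleftrightarrow> (AE x in lebesgue. x \<in> S \<longrightarrow> P x)"
    using assms by (intro AE_restrict_space_iff) auto
  moreover have "(AE x in lebesgue. x \<in> S \<longrightarrow> P x) \<longleftrightarrow> {x \<in> space lebesgue. \<not> (x \<in> S \<longrightarrow> P x)} \<in> null_sets lebesgue"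
  proof
    assume "AE x in lebesgue. x \<in> S \<longrightarrow> P x"
    then obtain N where N: "{x \<in> space lebesgue. \<not> (x \<in> S \<longrightarrow> P x)} \<subseteq> N" "N \<in> null_sets lebesgue"
      unfolding eventually_ae_filter by blast
    then show "{x \<in> space lebesgue. \<not> (x \<in> S \<longrightarrow> P x)} \<in> null_sets lebesgue"
      using negligible_subset negligible_iff_null_sets by blast
  qed (auto intro: AE_I')
  ultimately show ?thesis
    by (simp add: negligible_iff_null_sets)
qed

text \<open>Off the exceptional set \<open>f\<close> has the same derivative as a primitive of \<open>g\<close>, so it is that primitive
  up to a constant.\<close>

lemma loc_abs_cont_pos_imp_C1:
  assumes ac: "loc_abs_cont_pos f" and g: "continuous_on {0<..} g"
    and ae: "AE x in lebesgue_on {0<..}. (f has_real_derivative g x) (at x)" and "x > 0"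
  shows "(f has_real_derivative g x) (at x)"
proof -
  define a where "a = x / 2"
  define b where "b = 2 * x"
  have ab: "0 < a" "a < x" "x < b" using \<open>x > 0\<close> by (auto simp: a_def b_def)
  have gc: "continuous_on {a..b} g" using g ab by (auto intro: continuous_on_subset)
  define G where "G = (\<lambda>t. integral {a..t} g)"
  have G: "(G has_real_derivative g t) (at t within {a..b})" if "t \<in> {a..b}" for t
    unfolding G_def by (rule integral_has_real_derivative[OF gc that])
  have acab: "abs_cont_on a b (\<lambda>t. f t - G t)"
    using ac ab G gc unfolding loc_abs_cont_pos_def
    by (intro abs_cont_on_diff abs_cont_on_C1[of _ _ G g]) auto
  define N where "N = {t\<in>{0<..}. \<not> (f has_real_derivative g t) (at t)}"
  have N: "negligible N" using ae unfolding N_def by (subst (asm) AE_lebesgue_on_iff_negligible) auto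
  have eq: "f t = f a + G t" if t: "t \<in> {a..b}" for t
  proof -
    have "f t - G t = f a - G a"
    proof (rule abs_cont_on_zero_derivative[of a t, OF abs_cont_on_subinterval[OF acab] _ N])
      fix y assume y: "y \<in> {a..t} - N"
      then have "(f has_real_derivative g y) (at y)" using ab by (auto simp: N_def)
      then have "((\<lambda>t. f t - G t) has_real_derivative g y - g y) (at y within {a..t})"
        using y t G[of y]
        by (intro derivative_intros) (auto intro: has_field_derivative_at_within DERIV_subset)
      then show "((\<lambda>t. f t - G t) has_real_derivative 0) (at y within {a..t})" by simp
    qed (use t in auto)
    then show ?thesis by (simp add: G_def)
  qed
  have "(G has_real_derivative g x) (at x)"
    using G[of x] ab by (simp add: at_within_Icc_at)
  then have "((\<lambda>t. f a + G t) has_real_derivative g x) (at x)"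
    by (auto intro!: derivative_eq_intros)
  then show ?thesis
  proof (rule has_field_derivative_transform_within_open)
    show "open {a<..<b}" "x \<in> {a<..<b}" using ab by auto
    show "f a + G t = f t" if "t \<in> {a<..<b}" for t using eq[of t] that by simp
  qed
qed

subsection \<open>The fundamental theorem of calculus almost everywhere\<close>

text \<open>Intervals on which the mean of \<open>f\<close> differs from the value at a tag by more than \<open>c\<close> form a Vitali
  cover of the bad set; by Henstock's lemma disjoint ones have small total length.\<close>

lemma integral_has_real_derivative_AE:
  fixes f :: "real \<Rightarrow> real"
  assumes f: "f integrable_on {a..b}"
  shows "\<exists>N. negligible N \<and>
    (\<forall>x\<in>{a<..<b} - N. ((\<lambda>t. integral {a..t} f) has_real_derivative f x) (at x))"
proof -
  \<comment> \<open>The intervals only have to contain \<open>x\<close>. Taking \<open>x\<close> as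
    the left or the right end point then gives both one-sided difference quotients.\<close>
  define bad where "bad c = {x\<in>{a<..<b}. \<forall>d>0. \<exists>u v. u \<le> x \<and> x \<le> v \<and> v - u < d \<and>
      c * (v - u) < \<bar>(v - u) * f x - integral {u..v} f\<bar>}" for c
  have neg: "negligible (bad c)" if c: "c > 0" for c
    unfolding negligible_outer_le
  proof (intro allI impI)
    fix \<epsilon> :: real assume "\<epsilon> > 0"
    have fi: "f integrable_on cbox a b" using f by simp
    obtain \<gamma> where \<gamma>: "gauge \<gamma>" "\<And>p. \<lbrakk>p tagged_partial_division_of (cbox a b); \<gamma> fine p\<rbrakk> \<Longrightarrow>
             sum (\<lambda>(x,k). norm (measure lborel k *\<^sub>R f x - integral k f)) p < c * \<epsilon>"
      using Henstock_lemma[OF fi mult_pos_pos[OF c \<open>\<epsilon> > 0\<close>]] by blast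
    define K where "K = {(x,u,v). u \<le> x \<and> x \<le> v \<and> u < v \<and> a \<le> u \<and> v \<le> b \<and> {u..v} \<subseteq> \<gamma> x \<and>
       c * (v - u) < \<bar>(v - u) * f x - integral {u..v} f\<bar>}"
    \<comment> \<open>The covering theorem is about balls, so an interval is encoded by its midpoint
      and half its length.\<close>
    define ctr where "ctr = (\<lambda>(x::real,u::real,v::real). (u + v) / 2)"
    define rad where "rad = (\<lambda>(x::real,u::real,v::real). (v - u) / 2)"
    have cb: "cball (ctr i) (rad i) = {fst (snd i)..snd (snd i)}" for i
      by (cases i) (auto simp: ctr_def rad_def cball_eq_atLeastAtMost field_simps)
    have "\<exists>i. i \<in> K \<and> x \<in> cball (ctr i) (rad i) \<and> rad i < d" if xb: "x \<in> bad c" and "0 < d" for x d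
    proof -
      have x: "x \<in> {a<..<b}" using that by (simp add: bad_def)
      obtain e where e: "e > 0" "ball x e \<subseteq> \<gamma> x"
        using \<gamma>(1) unfolding gauge_def by (meson openE)
      define m where "m = min (min d e) (min (x - a) (b - x))"
      have "m > 0" using e x that by (auto simp: m_def)
      then obtain u v where uv: "u \<le> x" "x \<le> v" "v - u < m"
        "c * (v - u) < \<bar>(v - u) * f x - integral {u..v} f\<bar>"
        using xb unfolding bad_def by blast
      have "u < v" using uv by (cases "u = v") auto
      have "(x,u,v) \<in> K"
        using uv \<open>u < v\<close> e(2) x by (auto simp: K_def m_def subset_eq dist_real_def)
      then show ?thesis
        using uv \<open>u < v\<close> cb[of "(x,u,v)"] by (intro exI[of _ "(x,u,v)"]) (simp add: rad_def m_def del: mem_cball)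
    qed
    moreover have "0 < rad i" if "i \<in> K" for i using that by (auto simp: K_def rad_def)
    ultimately obtain C where C: "countable C" "C \<subseteq> K"
     "pairwise (\<lambda>i j. disjnt (cball (ctr i) (rad i)) (cball (ctr j) (rad j))) C"
     "negligible (bad c - (\<Union>i \<in> C. cball (ctr i) (rad i)))"
      using Vitali_covering_theorem_cballs[of K rad "bad c" ctr] by blast
    \<comment> \<open>Henstock's lemma concerns finite partial divisions, so finite subfamilies are
      bounded and the bound then passes to the countable union.\<close>
    have fin: "measure lebesgue (\<Union>i\<in>F. cball (ctr i) (rad i)) \<le> \<epsilon>" if F: "F \<subseteq> C" "finite F" for F
    proof -
      define h where "h = (\<lambda>(x::real,u::real,v::real). (x,{u..v}))"
      have h: "h i = (fst i, cball (ctr i) (rad i))" for i by (cases i) (simp add: h_def cb)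
      have inj: "inj_on h F"
      proof (rule inj_onI)
        fix i j assume ij: "i \<in> F" "j \<in> F" "h i = h j"
        have ne: "cball (ctr i) (rad i) \<noteq> {}" using ij F C(2) by (auto simp: cb K_def)
        have "\<not> disjnt (cball (ctr i) (rad i)) (cball (ctr j) (rad j))"
          using ij(3) ne unfolding h disjnt_def by simp
        then show "i = j" using ij C(3) F(1) unfolding pairwise_def by blast
      qed
      have FK: "i \<in> K" if "i \<in> F" for i using that F C by auto
      have p: "h ` F tagged_partial_division_of cbox a b"
        unfolding tagged_partial_division_of_def
      proof (intro conjI allI impI)
        fix x L assume "(x, L) \<in> h ` F"
        then obtain u v where xuv: "(x,u,v) \<in> K" "L = {u..v}" using FK by (force simp: h_def)
        then show "x \<in> L" "L \<subseteq> cbox a b" "\<exists>a b. L = cbox a b" by (auto simp: K_def)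
      next
        fix x1 K1 x2 K2
        assume *: "(x1, K1) \<in> h ` F \<and> (x2, K2) \<in> h ` F \<and> (x1, K1) \<noteq> (x2, K2)"
        then obtain i j where "i \<in> F" "j \<in> F" "h i = (x1,K1)" "h j = (x2,K2)" by (metis imageE)
        moreover have "i \<noteq> j" using * \<open>h i = (x1,K1)\<close> \<open>h j = (x2,K2)\<close> by metis
        ultimately have "disjnt K1 K2" using C(3) F(1) unfolding pairwise_def h by blast
        then show "interior K1 \<inter> interior K2 = {}"
          using interior_subset unfolding disjnt_def by blast
      qed (use F in auto)
      have fine: "\<gamma> fine h ` F" unfolding fine_def using FK by (force simp: h_def K_def)
      have len: "measure lebesgue (cball (ctr i) (rad i)) = snd (snd i) - fst (snd i)" if "i \<in> F" for i
        using FK[OF that] unfolding cb by (auto simp: K_def)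
      have "c * (\<Sum>i\<in>F. measure lebesgue (cball (ctr i) (rad i))) = (\<Sum>i\<in>F. c * (snd (snd i) - fst (snd i)))"
        unfolding sum_distrib_left by (intro sum.cong refl) (simp only: len)
      also have "\<dots> \<le> (\<Sum>i\<in>F. case h i of (x,k) \<Rightarrow> norm (measure lborel k *\<^sub>R f x - integral k f))"
      proof (rule sum_mono)
        fix i assume "i \<in> F"
        then show "c * (snd (snd i) - fst (snd i)) \<le> (case h i of (x,k) \<Rightarrow> norm (measure lborel k *\<^sub>R f x - integral k f))"
          using FK[of i] by (cases i) (auto simp: K_def h_def)
      qed
      also have "\<dots> < c * \<epsilon>"
        using \<gamma>(2)[OF p fine] by (simp add: sum.reindex[OF inj])
      finally have "(\<Sum>i\<in>F. measure lebesgue (cball (ctr i) (rad i))) < \<epsilon>" using c by simp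
      moreover have "measure lebesgue (\<Union>i\<in>F. cball (ctr i) (rad i)) \<le> (\<Sum>i\<in>F. measure lebesgue (cball (ctr i) (rad i)))"
        using F by (intro measure_UNION_le) auto
      ultimately show ?thesis by simp
    qed
    define T where "T = (\<Union>i \<in> C. cball (ctr i) (rad i))"
    have T: "T \<in> lmeasurable" "measure lebesgue T \<le> \<epsilon>"
      unfolding T_def by (rule fmeasurable_UN_bound[OF C(1) _ fin] measure_UN_bound[OF C(1) _ fin]; simp)+
    show "\<exists>T. bad c \<subseteq> T \<and> T \<in> lmeasurable \<and> measure lebesgue T \<le> \<epsilon>"
    proof (intro exI conjI)
      show "bad c \<subseteq> T \<union> (bad c - T)" by blast
      show "T \<union> (bad c - T) \<in> lmeasurable"
        by (rule fmeasurable.Un[OF T(1) negligible_imp_measurable[OF C(4)[folded T_def]]])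
      have "measure lebesgue (T \<union> (bad c - T)) = measure lebesgue T"
        using C(4) by (intro measure_negligible_symdiff[OF T(1)]) (auto simp: T_def intro: negligible_subset)
      then show "measure lebesgue (T \<union> (bad c - T)) \<le> \<epsilon>" using T(2) by simp
    qed
  qed
  define N where "N = (\<Union>n::nat. bad (1 / real (Suc n)))"
  have "negligible N" unfolding N_def by (intro negligible_countable_Union) (auto intro!: neg)
  moreover have "((\<lambda>t. integral {a..t} f) has_real_derivative f x) (at x)" if x: "x \<in> {a<..<b} - N" for x
    unfolding has_field_derivative_def has_derivative_at_alt
  proof (intro conjI allI impI)
    fix e :: real assume "e > 0"
    then obtain n where n: "1 / real (Suc n) < e" using nat_approx_posE by blast
    define c where "c = 1 / real (Suc n)"
    have "x \<notin> bad c" using x by (auto simp: N_def c_def)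
    then obtain d where d: "d > 0" "\<And>u v. u \<le> x \<Longrightarrow> x \<le> v \<Longrightarrow> v - u < d \<Longrightarrow>
       \<bar>(v - u) * f x - integral {u..v} f\<bar> \<le> c * (v - u)"
      using x unfolding bad_def by (fastforce simp: not_less)
    have int: "integral {a..t} f - integral {a..s} f = integral {s..t} f" if "a \<le> s" "s \<le> t" "t \<le> b" for s t
      using Henstock_Kurzweil_Integration.integral_combine[of a s t f] that integrable_on_subinterval[OF f, of a t] by auto
    show "\<exists>d>0. \<forall>y. norm (y - x) < d \<longrightarrow>
       norm (integral {a..y} f - integral {a..x} f - f x * (y - x)) \<le> e * norm (y - x)"
    proof (rule exI[of _ "min d (min (x - a) (b - x))"], intro conjI allI impI)
      fix y assume y: "norm (y - x) < min d (min (x - a) (b - x))"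
      have "norm (integral {a..y} f - integral {a..x} f - f x * (y - x)) \<le> c * norm (y - x)"
      proof (cases "x \<le> y")
        case True
        then show ?thesis using d(2)[of x y] int[of x y] x y by (auto simp: algebra_simps)
      next
        case False
        then show ?thesis using d(2)[of y x] int[of y x] x y by (auto simp: algebra_simps)
      qed
      also have "\<dots> \<le> e * norm (y - x)" using n by (intro mult_right_mono) (auto simp: c_def)
      finally show "norm (integral {a..y} f - integral {a..x} f - f x * (y - x)) \<le> e * norm (y - x)" .
    qed (use d x in auto)
  qed (rule bounded_linear_mult_right)
  ultimately show ?thesis by blast
qed

text \<open>\<open>\<bar>f\<bar>\<close> is cut at a height \<open>N\<close>. The lower part
  contributes at most \<open>N\<close> times the total length; the excess \<open>h\<close> has
  integral below \<open>\<epsilon> / 2\<close> by dominated convergence, and disjointness keeps its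
  share over all intervals below that.\<close>

lemma abs_cont_on_integral:
  fixes f :: "real \<Rightarrow> real"
  assumes f: "f absolutely_integrable_on {a..b}"
  shows "abs_cont_on a b (\<lambda>t. integral {a..t} f)"
proof (rule abs_cont_onI)
  fix \<epsilon> :: real assume "\<epsilon> > 0"
  have absf: "(\<lambda>x. \<bar>f x\<bar>) absolutely_integrable_on {a..b}"
    using absolutely_integrable_norm[OF f] by (simp add: o_def)
  define g where "g N x = min \<bar>f x\<bar> (real N)" for N x
  have g: "g N absolutely_integrable_on {a..b}" for N
    unfolding g_def by (intro absolutely_integrable_min_1 absf) auto
  have "(\<lambda>N. integral {a..b} (g N)) \<longlonglongrightarrow> integral {a..b} (\<lambda>x. \<bar>f x\<bar>)"
  proof (rule dominated_convergence[where h = "\<lambda>x. \<bar>f x\<bar>"])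
    fix x
    show "(\<lambda>N. g N x) \<longlonglongrightarrow> \<bar>f x\<bar>"
    proof (rule tendsto_eventually, rule eventually_sequentiallyI[of "nat \<lceil>\<bar>f x\<bar>\<rceil>"])
      fix N assume "nat \<lceil>\<bar>f x\<bar>\<rceil> \<le> N"
      then have "\<bar>f x\<bar> \<le> real N" by linarith
      then show "g N x = \<bar>f x\<bar>" by (simp add: g_def)
    qed
  qed (use g absf in \<open>auto simp: g_def dest: set_lebesgue_integral_eq_integral\<close>)
  then have "\<forall>\<^sub>F N in sequentially. \<bar>integral {a..b} (g N) - integral {a..b} (\<lambda>x. \<bar>f x\<bar>)\<bar> < \<epsilon> / 2"
    using \<open>\<epsilon> > 0\<close> unfolding tendsto_iff dist_real_def by (metis half_gt_zero)
  then obtain N where N: "\<bar>integral {a..b} (g N) - integral {a..b} (\<lambda>x. \<bar>f x\<bar>)\<bar> < \<epsilon> / 2"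
    using eventually_happens trivial_limit_sequentially by blast
  have gi: "g N integrable_on {a..b}" and fi: "f integrable_on {a..b}" and afi: "(\<lambda>x. \<bar>f x\<bar>) integrable_on {a..b}"
    using g f absf by (auto simp: set_lebesgue_integral_eq_integral)
  define h where "h x = \<bar>f x\<bar> - g N x" for x
  have hi: "h integrable_on {a..b}" unfolding h_def by (intro integrable_diff gi afi)
  have hsmall: "integral {a..b} h < \<epsilon> / 2"
    using N unfolding h_def by (subst integral_diff[OF afi gi]) linarith
  define \<delta> where "\<delta> = \<epsilon> / (2 * (real N + 1))"
  have \<delta>: "\<delta> > 0" using \<open>\<epsilon> > 0\<close> by (simp add: \<delta>_def)
  show "\<exists>\<delta>>0. \<forall>I. finite I \<longrightarrow> (\<forall>(s, t) \<in> I. a \<le> s \<and> s \<le> t \<and> t \<le> b) \<longrightarrow>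
    pairwise (\<lambda>(s, t) (s', t'). {s<..<t} \<inter> {s'<..<t'} = {}) I \<longrightarrow>
    (\<Sum>(s, t)\<in>I. t - s) < \<delta> \<longrightarrow> (\<Sum>(s, t)\<in>I. \<bar>integral {a..t} f - integral {a..s} f\<bar>) < \<epsilon>"
  proof (rule exI[of _ \<delta>], intro conjI allI impI \<delta>)
    fix I :: "(real \<times> real) set"
    assume I: "finite I" "\<forall>(s, t) \<in> I. a \<le> s \<and> s \<le> t \<and> t \<le> b"
      "pairwise (\<lambda>(s, t) (s', t'). {s<..<t} \<inter> {s'<..<t'} = {}) I" "(\<Sum>(s, t)\<in>I. t - s) < \<delta>"
    have "(\<Sum>(s, t)\<in>I. \<bar>integral {a..t} f - integral {a..s} f\<bar>) \<le>
        (\<Sum>i\<in>I. integral {fst i..snd i} h + real N * (snd i - fst i))"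
    proof (rule sum_mono, clarify)
      fix s t assume "(s, t) \<in> I"
      then have st: "a \<le> s" "s \<le> t" "t \<le> b" using I(2) by auto
      have sub: "u integrable_on {s..t}" if "u integrable_on {a..b}" for u :: "real \<Rightarrow> real"
        using integrable_on_subinterval[OF that, of s t] st by auto
      have "integral {a..t} f - integral {a..s} f = integral {s..t} f"
        using Henstock_Kurzweil_Integration.integral_combine[of a s t f] st integrable_on_subinterval[OF fi, of a t] by auto
      also have "\<bar>\<dots>\<bar> \<le> integral {s..t} (\<lambda>x. h x + real N)"
      proof -
        have "norm (integral {s..t} f) \<le> integral {s..t} (\<lambda>x. h x + real N)"
        proof (rule integral_norm_bound_integral[OF sub[OF fi]])
          show "(\<lambda>x. h x + real N) integrable_on {s..t}" by (intro integrable_add sub[OF hi]) auto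
        qed (auto simp: h_def g_def)
        then show ?thesis by simp
      qed
      also have "\<dots> = integral {s..t} h + real N * (t - s)"
        using sub[OF hi] st by (subst integral_add) auto
      finally show "\<bar>integral {a..t} f - integral {a..s} f\<bar> \<le> integral {fst (s, t)..snd (s, t)} h + real N * (snd (s, t) - fst (s, t))"
        by simp
    qed
    also have "\<dots> = (\<Sum>i\<in>I. integral {fst i..snd i} h) + real N * (\<Sum>(s, t)\<in>I. t - s)"
      by (simp add: sum.distrib sum_distrib_left case_prod_unfold)
    also have "(\<Sum>i\<in>I. integral {fst i..snd i} h) \<le> integral {a..b} h"
    proof (rule sum_integral_disjoint_intervals_le[OF I(1) hi])
      show "pairwise (\<lambda>i j. {fst i<..<snd i} \<inter> {fst j<..<snd j} = {}) I"
        using I(3) by (simp add: case_prod_unfold)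
      fix i assume i: "i \<in> I"
      then have st: "a \<le> fst i" "fst i \<le> snd i" "snd i \<le> b" using I(2) by (cases i; auto)+
      then show "{fst i<..<snd i} \<subseteq> {a..b}" by auto
      show "h integrable_on {fst i..snd i}"
        using integrable_on_subinterval[OF hi, of "fst i" "snd i"] st by auto
    qed (auto simp: h_def g_def)
    also have "real N * (\<Sum>(s, t)\<in>I. t - s) \<le> real N * \<delta>"
      using I(4) by (intro mult_left_mono) auto
    also have "real N * \<delta> \<le> \<epsilon> / 2"
      using \<open>\<epsilon> > 0\<close> by (simp add: \<delta>_def field_simps)
    finally show "(\<Sum>(s, t)\<in>I. \<bar>integral {a..t} f - integral {a..s} f\<bar>) < \<epsilon>" using hsmall by simp
  qed
qed

subsection \<open>Integral representation of Tricomi's function\<close>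

text \<open>Euler's integral for \<open>Gamma p\<close> after replacing \<open>t\<close> by
  \<open>y * t\<close>.\<close>

lemma absolutely_integrable_scaled_Gamma:
  fixes p y :: real
  assumes "p > 0" "y > 0"
  shows "(\<lambda>t. t powr (p - 1) * exp (- y * t)) absolutely_integrable_on {0<..}"
    and "integral {0<..} (\<lambda>t. t powr (p - 1) * exp (- y * t)) = Gamma p * y powr (- p)"
proof -
  let ?f = "\<lambda>t::real. t powr (p - 1) / exp t"
  have f: "(?f has_integral Gamma p) {0<..}"
    by (rule has_integral_spike_set_eq[THEN iffD1, OF _ _ Gamma_integral_real[OF assms(1)]])
       (auto intro: negligible_subset[of "{0}"])
  then have "?f absolutely_integrable_on {0<..}" "integral {0<..} ?f = Gamma p"
    by (auto intro!: nonnegative_absolutely_integrable_1 simp: has_integral_iff)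
  moreover have "((*) y) ` {0<..} = {0<..}"
  proof -
    have "x \<in> (*) y ` {0<..}" if "x > 0" for x
      using that assms by (intro image_eqI[of _ _ "x / y"]) auto
    then show ?thesis using assms by auto
  qed
  ultimately have *: "(\<lambda>t. \<bar>y\<bar> * ?f (y * t)) absolutely_integrable_on {0<..} \<and>
      integral {0<..} (\<lambda>t. \<bar>y\<bar> * ?f (y * t)) = Gamma p"
    using assms
    by (subst has_absolute_integral_change_of_variables_1')
       (auto intro!: derivative_eq_intros inj_onI)
  have eq: "y powr (- p) * (\<bar>y\<bar> * ?f (y * t)) = t powr (p - 1) * exp (- y * t)" if "t \<in> {0<..}" for t
    using that assms by (simp add: powr_mult powr_diff powr_minus exp_minus field_simps)
  show "(\<lambda>t. t powr (p - 1) * exp (- y * t)) absolutely_integrable_on {0<..}"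
    by (rule absolutely_integrable_spike[OF _ negligible_empty, where f = "\<lambda>t. y powr (- p) * (\<bar>y\<bar> * ?f (y * t))"])
       (metis * set_integrable_mult_right, metis Diff_empty eq)
  have "integral {0<..} (\<lambda>t. t powr (p - 1) * exp (- y * t)) = integral {0<..} (\<lambda>t. y powr (- p) * (\<bar>y\<bar> * ?f (y * t)))"
    by (rule integral_cong) (use eq in auto)
  also have "\<dots> = y powr (- p) * Gamma p" by (subst integral_mult_right, subst *[THEN conjunct2], rule refl)
  finally show "integral {0<..} (\<lambda>t. t powr (p - 1) * exp (- y * t)) = Gamma p * y powr (- p)" by simp
qed

text \<open>Integrand of the Laplace integral of Tricomi's function with \<open>p = A\<close> and
  \<open>q = B - A - 1\<close>. In these parameters a derivative in \<open>y\<close> raises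
  \<open>p\<close> by one and leaves \<open>q\<close> alone.\<close>

definition tricomi_kernel :: "real \<Rightarrow> real \<Rightarrow> real \<Rightarrow> real \<Rightarrow> real" where
  "tricomi_kernel p q y t = t powr (p - 1) * (1 + t) powr q * exp (- y * t)"

definition tricomi_integral :: "real \<Rightarrow> real \<Rightarrow> real \<Rightarrow> real" where
  "tricomi_integral p q y = integral {0<..} (tricomi_kernel p q y)"

lemma tricomi_kernel_pos: "t > 0 \<Longrightarrow> tricomi_kernel p q y t > 0"
  by (simp add: tricomi_kernel_def)

lemma tricomi_kernel_Suc: "t > 0 \<Longrightarrow> tricomi_kernel (p + 1) q y t = t * tricomi_kernel p q y t"
  by (simp add: tricomi_kernel_def powr_diff)

lemma tricomi_kernel_le:
  assumes "q \<le> 0" "t > 0"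
  shows "tricomi_kernel p q y t \<le> t powr (p - 1) * exp (- y * t)"
proof -
  have "(1 + t) powr q \<le> (1 + t) powr 0" using assms by (intro powr_mono) auto
  then show ?thesis using assms by (simp add: tricomi_kernel_def mult_left_le)
qed

lemma continuous_on_tricomi_kernel: "continuous_on {0<..} (tricomi_kernel p q y)"
  unfolding tricomi_kernel_def by (intro continuous_intros) auto

lemma absolutely_integrable_tricomi_kernel:
  assumes "p > 0" "q \<le> 0" "y > 0"
  shows "tricomi_kernel p q y absolutely_integrable_on {0<..}"
proof (rule measurable_bounded_by_integrable_imp_absolutely_integrable)
  show "tricomi_kernel p q y \<in> borel_measurable (lebesgue_on {0<..})"
    by (intro continuous_imp_measurable_on_sets_lebesgue continuous_on_tricomi_kernel) auto
  show "(\<lambda>t. t powr (p - 1) * exp (- y * t)) integrable_on {0<..}"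
    using absolutely_integrable_scaled_Gamma(1)[OF assms(1,3)] by (simp add: set_lebesgue_integral_eq_integral)
qed (use assms tricomi_kernel_le tricomi_kernel_pos in \<open>auto simp: less_imp_le\<close>)

lemma has_integral_tricomi_kernel:
  assumes "p > 0" "q \<le> 0" "y > 0"
  shows "(tricomi_kernel p q y has_integral tricomi_integral p q y) {0<..}"
  using absolutely_integrable_tricomi_kernel[OF assms]
  by (simp add: tricomi_integral_def set_lebesgue_integral_eq_integral integrable_integral)

lemma has_integral_scaled_Gamma:
  fixes p y :: real
  assumes "p > 0" "y > 0"
  shows "((\<lambda>t. t powr (p - 1) * exp (- y * t)) has_integral Gamma p * y powr (- p)) {0<..}"
  using absolutely_integrable_scaled_Gamma[OF assms]
  by (metis integrable_integral set_lebesgue_integral_eq_integral(1))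

lemma tricomi_integral_upper:
  assumes "p > 0" "q \<le> 0" "y > 0"
  shows "tricomi_integral p q y \<le> Gamma p * y powr (- p)"
  by (rule has_integral_le[OF has_integral_tricomi_kernel[OF assms] has_integral_scaled_Gamma])
     (use assms tricomi_kernel_le in auto)

text \<open>From \<open>ln (1 + t) \<le> t\<close> and \<open>q \<le> 0\<close> follows
  \<open>exp (q * t) \<le> (1 + t) powr q\<close>, and that exponential merely shifts
  \<open>y\<close>. With the upper bound this pins down the decay at infinity.\<close>

lemma tricomi_integral_lower:
  assumes "p > 0" "q \<le> 0" "y > 0"
  shows "Gamma p * (y - q) powr (- p) \<le> tricomi_integral p q y"
proof (rule has_integral_le[OF has_integral_scaled_Gamma has_integral_tricomi_kernel[OF assms]])
  fix t :: real assume t: "t \<in> {0<..}"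
  have "q * t \<le> q * ln (1 + t)"
    using assms t by (intro mult_left_mono_neg ln_add_one_self_le_self) auto
  then have "exp (q * t) \<le> (1 + t) powr q" using t by (simp add: powr_def)
  then have "t powr (p - 1) * exp (- y * t) * exp (q * t) \<le> t powr (p - 1) * exp (- y * t) * (1 + t) powr q"
    by (intro mult_left_mono) auto
  then show "t powr (p - 1) * exp (- (y - q) * t) \<le> tricomi_kernel p q y t"
    by (simp add: tricomi_kernel_def algebra_simps exp_diff exp_minus divide_simps split: if_splits)
qed (use assms in auto)

lemma tricomi_integral_pos:
  assumes "p > 0" "q \<le> 0" "y > 0"
  shows "tricomi_integral p q y > 0"
  using assms by (intro less_le_trans[OF _ tricomi_integral_lower[OF assms]]) (auto intro!: mult_pos_pos Gamma_real_pos)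

lemma tricomi_integral_asymp_equiv_at_top:
  assumes "p > 0" "q \<le> 0"
  shows "((\<lambda>y. tricomi_integral p q y * y powr p) \<longlongrightarrow> Gamma p) at_top"
proof (rule tendsto_sandwich)
  have "((\<lambda>y. Gamma p * (y / (y - q)) powr p) \<longlongrightarrow> Gamma p * 1 powr p) at_top"
    by (intro tendsto_intros) (real_asymp, auto)
  then show "((\<lambda>y. Gamma p * (y / (y - q)) powr p) \<longlongrightarrow> Gamma p) at_top" by simp
  show "\<forall>\<^sub>F y in at_top. Gamma p * (y / (y - q)) powr p \<le> tricomi_integral p q y * y powr p"
    using eventually_gt_at_top[of 0]
  proof eventually_elim
    case (elim y)
    have "Gamma p * (y / (y - q)) powr p = Gamma p * (y - q) powr (- p) * y powr p"
      using elim assms by (simp add: powr_divide powr_minus field_simps)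
    also have "\<dots> \<le> tricomi_integral p q y * y powr p"
      using elim assms by (intro mult_right_mono tricomi_integral_lower) auto
    finally show ?case .
  qed
  show "\<forall>\<^sub>F y in at_top. tricomi_integral p q y * y powr p \<le> Gamma p"
    using eventually_gt_at_top[of 0]
  proof eventually_elim
    case (elim y)
    have "tricomi_integral p q y * y powr p \<le> Gamma p * y powr (- p) * y powr p"
      using elim assms by (intro mult_right_mono tricomi_integral_upper) auto
    then show ?case using elim by (simp add: powr_minus_divide)
  qed
qed auto

text \<open>Near \<open>t = \<infinity>\<close> the kernel is \<open>t powr (p + q - 1)\<close> up to a relative error \<open>O(t powr - \<epsilon>)\<close>, which
  gives the singular behaviour at \<open>0\<close>.\<close>

lemma tricomi_integral_tendsto_at_right_0:
  assumes "p > 0" "q \<le> 0" "p + q > 0"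
  shows "((\<lambda>y. tricomi_integral p q y * y powr (p + q)) \<longlongrightarrow> Gamma (p + q)) (at_right 0)"
proof -
  define c where "c = p + q"
  \<comment> \<open>\<open>e < c\<close> keeps the argument of \<open>Gamma (c - e)\<close>
    positive, and \<open>e < 1\<close> is used in \<open>1 - s powr e \<le> exp (- s)\<close> for
    small \<open>s\<close>.\<close>
  define e where "e = min (c / 2) (1 / 2)"
  have "c > 0" using assms by (simp add: c_def)
  then have e: "0 < e" "e < 1" "e < c" by (auto simp: e_def)
  define C where "C = (- q) powr e * Gamma (c - e)"
  show ?thesis
    unfolding c_def[symmetric]
  proof (rule tendsto_sandwich)
    have "((\<lambda>y. Gamma c - C * y powr e) \<longlongrightarrow> Gamma c - C * 0 powr e) (at_right 0)"
      using e by (intro tendsto_intros) (auto simp: eventually_at_right_field intro!: exI[of _ 1])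
    then show "((\<lambda>y. Gamma c - C * y powr e) \<longlongrightarrow> Gamma c) (at_right 0)" using e by simp
    have pos: "\<forall>\<^sub>F y in at_right 0. y > (0::real)" by (simp add: eventually_at_right_less)
    show "\<forall>\<^sub>F y in at_right 0. tricomi_integral p q y * y powr c \<le> Gamma c"
      using pos
    proof eventually_elim
      case (elim y)
      have "tricomi_integral p q y \<le> Gamma c * y powr (- c)"
      proof (rule has_integral_le[OF has_integral_tricomi_kernel has_integral_scaled_Gamma])
        fix t :: real assume t: "t \<in> {0<..}"
        have "(1 + t) powr q \<le> t powr q" using assms t by (intro powr_mono2') auto
        then have "t powr (p - 1) * exp (- y * t) * (1 + t) powr q \<le> t powr (p - 1) * exp (- y * t) * t powr q"
          by (intro mult_left_mono) auto
        also have "\<dots> = t powr (c - 1) * exp (- y * t)"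
          using t by (simp add: c_def powr_add powr_diff)
        finally show "tricomi_kernel p q y t \<le> t powr (c - 1) * exp (- y * t)"
          by (simp add: tricomi_kernel_def mult_ac)
      qed (use assms e elim in auto)
      then have "tricomi_integral p q y * y powr c \<le> Gamma c * y powr (- c) * y powr c"
        by (intro mult_right_mono) auto
      then show ?case using elim by (simp add: powr_minus_divide)
    qed
    show "\<forall>\<^sub>F y in at_right 0. Gamma c - C * y powr e \<le> tricomi_integral p q y * y powr c"
      using pos
    proof eventually_elim
      case (elim y)
      have "Gamma c * y powr (- c) - (- q) powr e * (Gamma (c - e) * y powr (- (c - e))) \<le> tricomi_integral p q y"
      proof (rule has_integral_le[OF has_integral_diff[OF has_integral_scaled_Gamma has_integral_mult_right[OF has_integral_scaled_Gamma]] has_integral_tricomi_kernel])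
        fix t :: real assume t: "t \<in> {0<..}"
        have "ln (1 + t) = ln t + ln (1 + 1 / t)"
          using t ln_mult_pos[of t "1 + 1 / t"] by (simp add: distrib_left add.commute add_pos_pos)
        also have "\<dots> \<le> ln t + 1 / t" using t by (intro add_left_mono ln_add_one_self_le_self) auto
        finally have "q * (ln t + 1 / t) \<le> q * ln (1 + t)" using assms by (intro mult_left_mono_neg) auto
        then have "exp (q * ln t) * exp (q / t) \<le> (1 + t) powr q" using t by (simp add: powr_def algebra_simps flip: exp_add)
        then have l1: "t powr q * exp (q / t) \<le> (1 + t) powr q" using t by (simp add: powr_def)
        have l2: "1 - (- q) powr e * t powr (- e) \<le> exp (q / t)"
        proof -
          define s where "s = - q / t"
          have "s \<ge> 0" using assms t by (simp add: s_def divide_nonpos_pos)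
          \<comment> \<open>For \<open>s \<ge> 1\<close> the left side is not positive; for
            \<open>s < 1\<close> it is at most \<open>1 - s\<close>.\<close>
          have "1 - s powr e \<le> exp (- s)"
          proof (cases "s \<ge> 1")
            case True
            then have "1 \<le> s powr e" using e by (simp add: ge_one_powr_ge_zero)
            then show ?thesis by (smt (verit) exp_ge_zero)
          next
            case False
            have "s powr 1 \<le> s powr e" using False \<open>s \<ge> 0\<close> e by (intro powr_mono') auto
            moreover have "1 - s \<le> exp (- s)" using exp_ge_add_one_self[of "- s"] by simp
            ultimately show ?thesis using \<open>s \<ge> 0\<close> by simp
          qed
          moreover have "s powr e = (- q) powr e / t powr e"
            unfolding s_def by (rule powr_divide)
          ultimately show ?thesis by (simp add: s_def powr_minus_divide)
        qed
        have "t powr q * (1 - (- q) powr e * t powr (- e)) \<le> (1 + t) powr q"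
          using l1 l2 by (meson mult_left_mono order_trans powr_ge_zero)
        then have "t powr (p - 1) * exp (- y * t) * (t powr q * (1 - (- q) powr e * t powr (- e))) \<le>
           t powr (p - 1) * exp (- y * t) * (1 + t) powr q"
          by (intro mult_left_mono) auto
        also have "t powr (p - 1) * exp (- y * t) * (t powr q * (1 - (- q) powr e * t powr (- e))) =
           t powr (c - 1) * exp (- y * t) - (- q) powr e * (t powr (c - e - 1) * exp (- y * t))"
          using t by (simp add: c_def powr_add powr_diff powr_minus field_simps)
        finally show "t powr (c - 1) * exp (- y * t) - (- q) powr e * (t powr (c - e - 1) * exp (- y * t)) \<le> tricomi_kernel p q y t"
          by (simp add: tricomi_kernel_def mult_ac)
      qed (use assms e elim in auto)
      then have "(Gamma c * y powr (- c) - (- q) powr e * (Gamma (c - e) * y powr (- (c - e)))) * y powr c \<le> tricomi_integral p q y * y powr c"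
        by (intro mult_right_mono) auto
      moreover have "(Gamma c * y powr (- c) - (- q) powr e * (Gamma (c - e) * y powr (- (c - e)))) * y powr c = Gamma c - C * y powr e"
        using elim by (simp add: C_def powr_minus powr_diff field_simps)
      ultimately show ?case by simp
    qed
  qed auto
qed

text \<open>From \<open>(1 - z) * exp z \<le> 1\<close> one gets
  \<open>exp z - 1 - z \<le> z * (exp z - 1)\<close>, which is quadratic in \<open>z\<close>. This
  is the error term for differentiating under the integral.\<close>

lemma abs_exp_minus_one_minus_le: "\<bar>exp z - 1 - z\<bar> \<le> z\<^sup>2 * exp \<bar>z\<bar>" for z :: real
proof -
  have 0: "exp z - 1 - z \<ge> 0" using exp_ge_add_one_self[of z] by linarith
  have "(1 - z) * exp z \<le> exp (- z) * exp z"
    using exp_ge_add_one_self[of "- z"] by (intro mult_right_mono) auto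
  then have 1: "exp z - 1 - z \<le> z * (exp z - 1)" by (simp add: algebra_simps flip: exp_add)
  also have "\<dots> \<le> z\<^sup>2 * exp \<bar>z\<bar>"
  proof (cases "z \<ge> 0")
    case True
    have "exp z - 1 \<le> z * exp z" using \<open>(1 - z) * exp z \<le> exp (- z) * exp z\<close> by (simp add: algebra_simps flip: exp_add)
    then show ?thesis using True by (simp add: power2_eq_square mult.assoc mult_left_mono)
  next
    case False
    have "z * (exp z - 1) = \<bar>z\<bar> * (1 - exp z)" using False by (simp add: algebra_simps)
    also have "\<dots> \<le> \<bar>z\<bar> * (\<bar>z\<bar> * 1)" using exp_ge_add_one_self[of z] False by (intro mult_left_mono) linarith+
    also have "\<dots> \<le> z\<^sup>2 * exp \<bar>z\<bar>"
    proof -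
      have "z\<^sup>2 * 1 \<le> z\<^sup>2 * exp \<bar>z\<bar>" by (intro mult_left_mono) auto
      then show ?thesis by (simp add: power2_eq_square flip: abs_mult)
    qed
    finally show ?thesis .
  qed
  finally show ?thesis using 0 by simp
qed

text \<open>For \<open>\<bar>z - y\<bar> < y / 2\<close> the factor
  \<open>exp \<bar>(z - y) * t\<bar>\<close> uses up at most half of the decay. The remainder of
  second order is then at most \<open>(z - y) ^ 2\<close> times the integral with parameter
  \<open>p + 2\<close> at \<open>y / 2\<close>.\<close>

lemma tricomi_integral_has_derivative:
  assumes "p > 0" "q \<le> 0" "y > 0"
  shows "(tricomi_integral p q has_real_derivative - tricomi_integral (p + 1) q y) (at y)"
proof -
  define C where "C = tricomi_integral (p + 2) q (y / 2)"
  have C: "C > 0" unfolding C_def using assms by (intro tricomi_integral_pos) auto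
  have bound: "\<bar>tricomi_integral p q z - tricomi_integral p q y + tricomi_integral (p + 1) q y * (z - y)\<bar> \<le> C * (z - y)\<^sup>2"
    if z: "\<bar>z - y\<bar> < y / 2" for z
  proof -
    have "z > 0" using z assms by linarith
    let ?k = "\<lambda>t. tricomi_kernel p q z t - tricomi_kernel p q y t + (z - y) * tricomi_kernel (p + 1) q y t"
    have k: "(?k has_integral (tricomi_integral p q z - tricomi_integral p q y + (z - y) * tricomi_integral (p + 1) q y)) {0<..}"
      using assms \<open>z > 0\<close>
      by (intro has_integral_add has_integral_diff has_integral_mult_right has_integral_tricomi_kernel) auto
    have b: "((\<lambda>t. (z - y)\<^sup>2 * tricomi_kernel (p + 2) q (y / 2) t) has_integral (z - y)\<^sup>2 * C) {0<..}"
      unfolding C_def using assms by (intro has_integral_mult_right has_integral_tricomi_kernel) auto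
    have le: "norm (?k t) \<le> (z - y)\<^sup>2 * tricomi_kernel (p + 2) q (y / 2) t" if t: "t \<in> {0<..}" for t
    proof -
      have "?k t = tricomi_kernel p q y t * (exp (- (z - y) * t) - 1 - (- (z - y) * t))"
        using t by (simp add: tricomi_kernel_Suc) (simp add: tricomi_kernel_def algebra_simps flip: exp_add)
      then have "norm (?k t) = tricomi_kernel p q y t * \<bar>exp (- (z - y) * t) - 1 - (- (z - y) * t)\<bar>"
        using tricomi_kernel_pos[of t p q y] t by (simp add: abs_mult)
      also have "\<dots> \<le> tricomi_kernel p q y t * ((- (z - y) * t)\<^sup>2 * exp \<bar>- (z - y) * t\<bar>)"
        using tricomi_kernel_pos[of t p q y] t by (intro mult_left_mono abs_exp_minus_one_minus_le) auto
      also have "\<bar>- (z - y) * t\<bar> \<le> y / 2 * t"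
        using z t by (auto simp: abs_mult abs_minus_commute intro!: mult_right_mono)
      then have "exp \<bar>- (z - y) * t\<bar> \<le> exp (y / 2 * t)" by simp
      then have "tricomi_kernel p q y t * ((- (z - y) * t)\<^sup>2 * exp \<bar>- (z - y) * t\<bar>) \<le>
         tricomi_kernel p q y t * ((- (z - y) * t)\<^sup>2 * exp (y / 2 * t))"
        using tricomi_kernel_pos[of t p q y] t by (intro mult_left_mono) auto
      also have "\<dots> = (z - y)\<^sup>2 * (t\<^sup>2 * (tricomi_kernel p q y t * exp (y / 2 * t)))"
        by (simp add: power_mult_distrib power2_commute)
      also have "tricomi_kernel p q y t * exp (y / 2 * t) = tricomi_kernel p q (y / 2) t"
        by (simp add: tricomi_kernel_def flip: exp_add)
      also have "t\<^sup>2 * tricomi_kernel p q (y / 2) t = tricomi_kernel (p + 2) q (y / 2) t"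
        using t tricomi_kernel_Suc[of t p q "y/2"] tricomi_kernel_Suc[of t "p + 1" q "y/2"]
        by (simp add: power2_eq_square algebra_simps)
      finally show ?thesis .
    qed
    have "norm (integral {0<..} ?k) \<le> integral {0<..} (\<lambda>t. (z - y)\<^sup>2 * tricomi_kernel (p + 2) q (y / 2) t)"
      by (rule integral_norm_bound_integral) (use k b le in auto)
    then show ?thesis unfolding integral_unique[OF k] integral_unique[OF b] by (simp add: mult.commute)
  qed
  show ?thesis
    unfolding has_field_derivative_def has_derivative_at_alt
  proof (intro conjI allI impI)
    fix e :: real assume "e > 0"
    show "\<exists>d>0. \<forall>z. norm (z - y) < d \<longrightarrow> norm (tricomi_integral p q z - tricomi_integral p q y -
              - tricomi_integral (p + 1) q y * (z - y)) \<le> e * norm (z - y)"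
    proof (rule exI[of _ "min (y / 2) (e / C)"], intro conjI allI impI)
      fix z assume z: "norm (z - y) < min (y / 2) (e / C)"
      have "\<bar>tricomi_integral p q z - tricomi_integral p q y + tricomi_integral (p + 1) q y * (z - y)\<bar> \<le> C * (z - y)\<^sup>2"
        using z by (intro bound) auto
      also have "C * (z - y)\<^sup>2 = (C * \<bar>z - y\<bar>) * \<bar>z - y\<bar>" by (simp add: power2_eq_square)
      also have "\<dots> \<le> e * \<bar>z - y\<bar>" using z C by (intro mult_right_mono) (auto simp: field_simps)
      finally show "norm (tricomi_integral p q z - tricomi_integral p q y -
              - tricomi_integral (p + 1) q y * (z - y)) \<le> e * norm (z - y)" by simp
    qed (use assms \<open>e > 0\<close> C in auto)
  qed (rule bounded_linear_mult_right)
qed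

text \<open>Kummer's equation in integrated form: the left side is the integral of the derivative of
  \<open>t powr p * (1 + t) powr (q + 1) * exp (- y * t)\<close>, which vanishes at both
  ends.\<close>

lemma tricomi_integral_recurrence:
  assumes "p > 0" "q \<le> 0" "y > 0"
  shows "p * tricomi_integral p q y + (p + q + 1 - y) * tricomi_integral (p + 1) q y
     - y * tricomi_integral (p + 2) q y = 0"
proof -
  define F where "F t = t powr p * (1 + t) powr (q + 1) * exp (- y * t)" for t :: real
  define f where "f t = p * tricomi_kernel p q y t + (p + q + 1 - y) * tricomi_kernel (p + 1) q y t
     - y * tricomi_kernel (p + 2) q y t" for t
  have f: "f absolutely_integrable_on {0<..}"
    unfolding f_def using assms
    by (intro set_integral_diff set_integral_add set_integrable_mult_right absolutely_integrable_tricomi_kernel) auto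
  have fi: "(f has_integral (p * tricomi_integral p q y + (p + q + 1 - y) * tricomi_integral (p + 1) q y
     - y * tricomi_integral (p + 2) q y)) {0<..}"
    unfolding f_def using assms
    by (intro has_integral_add has_integral_diff has_integral_mult_right has_integral_tricomi_kernel) auto
  have fc: "continuous_on {0<..} f"
    unfolding f_def by (intro continuous_intros continuous_on_tricomi_kernel)
  have F: "(F has_real_derivative f t) (at t)" if "t > 0" for t
  proof -
    have k: "tricomi_kernel (p + 1) q y t = t * tricomi_kernel p q y t" "tricomi_kernel (p + 2) q y t = t * (t * tricomi_kernel p q y t)"
      using that tricomi_kernel_Suc[of t p q y] tricomi_kernel_Suc[of t "p + 1" q y] by (auto simp: algebra_simps)
    have e: "t powr p = t * t powr (p - 1)" "(1 + t) powr (q + 1) = (1 + t) * (1 + t) powr q"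
      using that by (simp_all add: powr_diff powr_add)
    have "(F has_real_derivative (p * t powr (p - 1) * (1 + t) powr (q + 1) * exp (- y * t)
        + t powr p * ((q + 1) * (1 + t) powr q) * exp (- y * t) - y * (t powr p * (1 + t) powr (q + 1) * exp (- y * t)))) (at t)"
      unfolding F_def using that by (auto intro!: derivative_eq_intros simp: algebra_simps)
    also have "p * t powr (p - 1) * (1 + t) powr (q + 1) * exp (- y * t)
        + t powr p * ((q + 1) * (1 + t) powr q) * exp (- y * t) - y * (t powr p * (1 + t) powr (q + 1) * exp (- y * t)) = f t"
      unfolding f_def k e by (simp add: tricomi_kernel_def algebra_simps)
    finally show ?thesis .
  qed
  have "(LBINT t=0..\<infinity>. f t) = 0 - 0"
  proof (rule interval_integral_FTC_integrable[where F = F])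
    show "(F has_vector_derivative f t) (at t)" if "0 < ereal t" for t
      using F[of t] that by (simp add: has_real_derivative_iff_has_vector_derivative)
    show "isCont f t" if "0 < ereal t" for t
      using fc that by (simp add: continuous_on_eq_continuous_at)
    have "set_integrable lebesgue {0<..} f" using f .
    moreover have "f \<in> borel_measurable (restrict_space borel {0<..})"
      by (rule borel_measurable_continuous_on_restrict[OF fc])
    then have "(\<lambda>x. indicator {0<..} x *\<^sub>R f x) \<in> borel_measurable borel"
      by (subst (asm) borel_measurable_restrict_space_iff) auto
    ultimately show "set_integrable lborel (einterval 0 \<infinity>) f"
      unfolding set_integrable_def by (simp add: integrable_completion einterval_eq_Ici zero_ereal_def)
    have "((\<lambda>t. t powr p * (1 + t) powr (q + 1) * exp (- y * t)) \<longlongrightarrow> 0 powr p * (1 + 0) powr (q + 1) * exp (- y * 0)) (at_right 0)"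
      using assms by (intro tendsto_intros) (auto simp: eventually_at_right_field intro!: exI[of _ 1])
    then show "((F \<circ> real_of_ereal) \<longlongrightarrow> 0) (at_right 0)"
      using assms by (simp add: F_def[abs_def] zero_ereal_def ereal_tendsto_simps1)
    have "((\<lambda>t. t powr p * (1 + t) powr (q + 1) * exp (- y * t)) \<longlongrightarrow> 0) at_top"
      using assms by real_asymp
    then show "((F \<circ> real_of_ereal) \<longlongrightarrow> 0) (at_left \<infinity>)"
      by (simp add: F_def[abs_def] ereal_tendsto_simps1)
  qed auto
  moreover have "(LBINT t=0..\<infinity>. f t) = integral {0<..} f"
  proof -
    have "(LBINT t=0..\<infinity>. f t) = (LBINT t:{0<..}. f t)"
      using interval_integral_to_infinity_eq[where a = 0 and M = lborel and f = f] by (simp add: zero_ereal_def)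
    also have "\<dots> = (LINT t:{0<..}|lebesgue. f t)"
      unfolding set_lebesgue_integral_def
    proof (rule integral_completion[symmetric])
      have "f \<in> borel_measurable (restrict_space borel {0<..})"
        by (rule borel_measurable_continuous_on_restrict[OF fc])
      then show "(\<lambda>x. indicator {0<..} x *\<^sub>R f x) \<in> borel_measurable lborel"
        by (subst (asm) borel_measurable_restrict_space_iff) auto
    qed
    also have "\<dots> = integral {0<..} f" by (rule set_lebesgue_integral_eq_integral(2)[OF f])
    finally show ?thesis .
  qed
  ultimately show ?thesis using integral_unique[OF fi] by simp
qed

subsection \<open>Existence and uniqueness of Tricomi's function\<close>

text \<open>The hypothesis \<open>B \<le> A + 1\<close> says \<open>q \<le> 0\<close> for the
  exponent \<open>q = B - A - 1\<close>, which is what the kernel estimates require.\<close>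

lemma is_tricomi_tricomi_integral:
  assumes "A > 0" "B \<le> A + 1"
  shows "is_tricomi A B (\<lambda>y. tricomi_integral A (B - A - 1) y / Gamma A)"
proof -
  define q where "q = B - A - 1"
  have q: "q \<le> 0" using assms by (simp add: q_def)
  have G: "Gamma A > 0" using assms by (simp add: Gamma_real_pos)
  let ?u = "\<lambda>y. tricomi_integral A q y / Gamma A"
  let ?u' = "\<lambda>y. - tricomi_integral (A + 1) q y / Gamma A"
  let ?u'' = "\<lambda>y. tricomi_integral (A + 2) q y / Gamma A"
  have hd: "(?u has_real_derivative ?u' y) (at y)" "(?u' has_real_derivative ?u'' y) (at y)"
    "y * ?u'' y + (B - y) * ?u' y - A * ?u y = 0" if "y > 0" for y
  proof -
    show "(?u has_real_derivative ?u' y) (at y)"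
      using DERIV_cdivide[OF tricomi_integral_has_derivative[OF assms(1) q that], of "Gamma A"] by simp
    show "(?u' has_real_derivative ?u'' y) (at y)"
      using DERIV_cdivide[OF DERIV_minus[OF tricomi_integral_has_derivative[of "A + 1" q y]], of "Gamma A"] assms(1) q that
      by (simp add: add.assoc)
    have B: "B = A + q + 1" by (simp add: q_def)
    show "y * ?u'' y + (B - y) * ?u' y - A * ?u y = 0"
    proof -
      have "y * ?u'' y + (B - y) * ?u' y - A * ?u y =
         - (A * tricomi_integral A q y + (A + q + 1 - y) * tricomi_integral (A + 1) q y
             - y * tricomi_integral (A + 2) q y) / Gamma A"
        unfolding B by (simp add: diff_divide_distrib add_divide_distrib algebra_simps)
      then show ?thesis by (simp add: tricomi_integral_recurrence[OF assms(1) q that])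
    qed
  qed
  have ha: "?u \<sim>[at_top] (\<lambda>y. y powr (- A))"
  proof (rule asymp_equivI')
    have "((\<lambda>y. tricomi_integral A q y * y powr A / Gamma A) \<longlongrightarrow> Gamma A / Gamma A) at_top"
      using G by (intro tendsto_divide tricomi_integral_asymp_equiv_at_top assms q) auto
    then show "((\<lambda>y. ?u y / y powr (- A)) \<longlongrightarrow> 1) at_top"
      using G by (simp add: powr_minus divide_inverse mult_ac)
  qed
  show ?thesis
    unfolding is_tricomi_def q_def[symmetric]
    by (intro conjI ha exI[of _ ?u'] exI[of _ ?u''] allI impI hd)
qed

text \<open>The Wronskian of two solutions is \<open>c * y powr - B * exp y\<close>; unless \<open>c = 0\<close> it makes the ratio of
  the solutions diverge at infinity.\<close>

lemma is_tricomi_unique: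
  assumes u0: "is_tricomi A B u0" and pos: "\<And>y. y > 0 \<Longrightarrow> u0 y > 0" and u: "is_tricomi A B u" and "y > 0"
  shows "u y = u0 y"
proof -
  obtain u0' u0'' where u0: "\<And>y. y > 0 \<Longrightarrow> (u0 has_real_derivative u0' y) (at y)"
     "\<And>y. y > 0 \<Longrightarrow> (u0' has_real_derivative u0'' y) (at y)"
     "\<And>y. y > 0 \<Longrightarrow> y * u0'' y + (B - y) * u0' y - A * u0 y = 0"
     and as0: "u0 \<sim>[at_top] (\<lambda>y. y powr (- A))"
    using u0 unfolding is_tricomi_def by blast
  obtain u' u'' where u: "\<And>y. y > 0 \<Longrightarrow> (u has_real_derivative u' y) (at y)"
     "\<And>y. y > 0 \<Longrightarrow> (u' has_real_derivative u'' y) (at y)"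
     "\<And>y. y > 0 \<Longrightarrow> y * u'' y + (B - y) * u' y - A * u y = 0"
     and as: "u \<sim>[at_top] (\<lambda>y. y powr (- A))"
    using u unfolding is_tricomi_def by blast
  define W where "W y = u' y * u0 y - u y * u0' y" for y
  have "((\<lambda>y. y powr B * exp (- y) * W y) has_real_derivative 0) (at y)" if "y > 0" for y
  proof -
    have W: "(W has_real_derivative u'' y * u0 y - u y * u0'' y) (at y)"
      unfolding W_def using u(1,2) u0(1,2) that
      by (auto intro!: derivative_eq_intros simp: algebra_simps)
    have "((\<lambda>y. y powr B * exp (- y) * W y) has_real_derivative
       (B * y powr (B - 1) * exp (- y) - y powr B * exp (- y)) * W y + y powr B * exp (- y) * (u'' y * u0 y - u y * u0'' y)) (at y)"
      using that by (auto intro!: derivative_eq_intros W simp: algebra_simps)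
    moreover have "(B * y powr (B - 1) * exp (- y) - y powr B * exp (- y)) * W y + y powr B * exp (- y) * (u'' y * u0 y - u y * u0'' y)
      = y powr (B - 1) * exp (- y) * ((B - y) * W y + ((y * u'' y) * u0 y - u y * (y * u0'' y)))"
      using that by (simp add: powr_diff field_simps)
    moreover have eqs: "y * u'' y = A * u y - (B - y) * u' y" "y * u0'' y = A * u0 y - (B - y) * u0' y"
      using u(3)[OF that] u0(3)[OF that] by linarith+
    have "(B - y) * W y + ((y * u'' y) * u0 y - u y * (y * u0'' y)) = 0"
      unfolding eqs W_def by (simp add: algebra_simps)
    ultimately show ?thesis by simp
  qed
  then have "\<exists>c. \<forall>y\<in>{0<..}. y powr B * exp (- y) * W y = c"
    by (intro has_field_derivative_zero_constant) (auto intro: has_field_derivative_at_within)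
  then obtain c where c: "\<And>y. y > 0 \<Longrightarrow> y powr B * exp (- y) * W y = c" by auto
  define r where "r y = u y / u0 y" for y
  have r: "(r has_real_derivative c / (y powr B * exp (- y) * (u0 y)\<^sup>2)) (at y)" if "y > 0" for y
  proof -
    have "(r has_real_derivative W y / (u0 y)\<^sup>2) (at y)"
      unfolding r_def using u(1)[OF that] u0(1)[OF that] pos[OF that]
      by (auto intro!: derivative_eq_intros simp: W_def power2_eq_square)
    also have "W y = c / (y powr B * exp (- y))" using c[OF that] that by (simp add: field_simps)
    finally show ?thesis by (simp add: mult_ac)
  qed
  have rlim: "(r \<longlongrightarrow> 1) at_top"
  proof -
    have "(\<lambda>y. u y / u0 y) \<sim>[at_top] (\<lambda>y. y powr (- A) / y powr (- A))"
      by (rule asymp_equiv_intros as as0)+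
    also have "(\<lambda>y. y powr (- A) / y powr (- A)) \<sim>[at_top] (\<lambda>_. 1)"
      by (rule asymp_equiv_refl_ev) (auto intro: eventually_mono[OF eventually_gt_at_top[of 0]])
    finally have "r \<sim>[at_top] (\<lambda>_. 1)" unfolding r_def .
    then show ?thesis using asymp_equiv_tendsto_transfer asymp_equiv_symI tendsto_const by blast
  qed
  \<comment> \<open>Since \<open>r\<close> tends to \<open>1\<close>, its increments over unit steps
    tend to \<open>0\<close>. By the mean value theorem they equal
    \<open>c / (z powr B * exp (- z) * (u0 z) ^ 2)\<close>, whose denominator tends to
    \<open>0\<close>.\<close>
  have "c = 0"
  proof (rule ccontr)
    assume "c \<noteq> 0"
    have lim1: "((\<lambda>y. r (y + 1) - r y) \<longlongrightarrow> 1 - 1) at_top"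
      by (intro tendsto_diff rlim filterlim_compose[OF rlim] filterlim_at_top_mono[OF filterlim_ident]) auto
    have "\<forall>\<^sub>F y in at_top. \<bar>r (y + 1) - r y\<bar> < 1"
      using tendstoD[OF lim1 zero_less_one] by (simp add: dist_real_def)
    moreover have lim2: "((\<lambda>y. y powr B * exp (- y) * (u0 y)\<^sup>2) \<longlongrightarrow> 0) at_top"
    proof -
      have "(\<lambda>y. y powr B * exp (- y) * (u0 y)\<^sup>2) \<sim>[at_top] (\<lambda>y. y powr B * exp (- y) * (y powr (- A))\<^sup>2)"
        by (intro asymp_equiv_intros as0)
      from asymp_equiv_symI[OF this] show ?thesis
        by (rule asymp_equiv_tendsto_transfer) real_asymp
    qed
    then have "\<forall>\<^sub>F y in at_top. \<bar>y powr B * exp (- y) * (u0 y)\<^sup>2\<bar> < \<bar>c\<bar>"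
      using tendstoD[OF lim2, of "\<bar>c\<bar>"] \<open>c \<noteq> 0\<close> by (simp add: dist_real_def)
    ultimately have "\<forall>\<^sub>F y in at_top. \<bar>r (y + 1) - r y\<bar> < 1 \<and> \<bar>y powr B * exp (- y) * (u0 y)\<^sup>2\<bar> < \<bar>c\<bar>"
      by eventually_elim simp
    then obtain Y where Y: "\<And>y. y \<ge> Y \<Longrightarrow> \<bar>r (y + 1) - r y\<bar> < 1 \<and> \<bar>y powr B * exp (- y) * (u0 y)\<^sup>2\<bar> < \<bar>c\<bar>"
      unfolding eventually_at_top_linorder by blast
    define y where "y = max Y 1"
    have y: "y \<ge> Y" "y > 0" by (auto simp: y_def)
    obtain z where z: "y < z" "r (y + 1) - r y = (y + 1 - y) * (c / (z powr B * exp (- z) * (u0 z)\<^sup>2))"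
      using MVT2[of y "y + 1" r "\<lambda>z. c / (z powr B * exp (- z) * (u0 z)\<^sup>2)"] r y by auto
    have zp: "z powr B * exp (- z) * (u0 z)\<^sup>2 > 0" using pos[of z] z y by (intro mult_pos_pos) auto
    have "\<bar>z powr B * exp (- z) * (u0 z)\<^sup>2\<bar> < \<bar>c\<bar>" using Y[of z] y z by auto
    then have "1 < \<bar>c / (z powr B * exp (- z) * (u0 z)\<^sup>2)\<bar>"
      using zp by (simp add: abs_div_pos[symmetric] del: mult_pos_pos)
    then show False using z(2) Y[of y] y by simp
  qed
  then have "\<exists>d. \<forall>y\<in>{0<..}. r y = d"
    using r by (intro has_field_derivative_zero_constant) (auto intro: has_field_derivative_at_within)
  then obtain d where d: "\<And>y. y > 0 \<Longrightarrow> r y = d" by auto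
  have "(r \<longlongrightarrow> d) at_top"
    by (rule tendsto_eventually) (use d in \<open>auto intro: eventually_mono[OF eventually_gt_at_top[of 0]]\<close>)
  then have "d = 1" using rlim tendsto_unique trivial_limit_at_top_linorder by blast
  then show ?thesis using d[OF \<open>y > 0\<close>] pos[OF \<open>y > 0\<close>] by (simp add: r_def)
qed

text \<open>The description ranges over all normalised solutions; comparing them needs one positive
  solution, and the Laplace integral is one.\<close>

lemma tricomi_eq_integral:
  assumes "A > 0" "B \<le> A + 1" "y > 0"
  shows "tricomi A B y = tricomi_integral A (B - A - 1) y / Gamma A"
  unfolding tricomi_def
proof (rule the_equality)
  show "\<exists>u. is_tricomi A B u \<and> tricomi_integral A (B - A - 1) y / Gamma A = u y"
    using is_tricomi_tricomi_integral[OF assms(1,2)] by blast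
  fix v assume "\<exists>u. is_tricomi A B u \<and> v = u y"
  then obtain u where u: "is_tricomi A B u" "v = u y" by blast
  have "u y = tricomi_integral A (B - A - 1) y / Gamma A"
    using assms by (intro is_tricomi_unique[OF is_tricomi_tricomi_integral _ u(1)])
      (auto intro!: divide_pos_pos tricomi_integral_pos Gamma_real_pos)
  then show "v = tricomi_integral A (B - A - 1) y / Gamma A" using u by simp
qed

text \<open>Kummer's transformation
  \<open>U(A, B, y) = y powr (1 - B) * U(A - B + 1, 2 - B, y)\<close> with \<open>B = 1 + a\<close>.
  The right side solves the same equation with the same normalisation at infinity, so uniqueness
  applies; \<open>L > a\<close> makes its first parameter positive.\<close>

lemma tricomi_kummer:
  assumes "L > a" "a > 0" "y > 0"
  shows "tricomi L (1 + a) y = y powr (- a) * (tricomi_integral (L - a) (- L) y / Gamma (L - a))"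
proof -
  define A where "A = L - a"
  have A: "A > 0" "1 - a \<le> A + 1" "(1 - a) - A - 1 = - L" using assms by (auto simp: A_def)
  define V where "V = (\<lambda>y. tricomi_integral A (- L) y / Gamma A)"
  have "is_tricomi A (1 - a) V" using is_tricomi_tricomi_integral[OF A(1,2)] A(3) by (simp add: V_def)
  then obtain v' v'' where v: "\<And>y. y > 0 \<Longrightarrow> (V has_real_derivative v' y) (at y)"
     "\<And>y. y > 0 \<Longrightarrow> (v' has_real_derivative v'' y) (at y)"
     "\<And>y. y > 0 \<Longrightarrow> y * v'' y + (1 - a - y) * v' y - A * V y = 0"
     and as: "V \<sim>[at_top] (\<lambda>y. y powr (- A))"
    unfolding is_tricomi_def by blast
  let ?u = "\<lambda>y. y powr (- a) * V y"
  let ?u' = "\<lambda>y. y powr (- a) * v' y - a * y powr (- a - 1) * V y"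
  let ?u'' = "\<lambda>y. y powr (- a) * v'' y - 2 * a * y powr (- a - 1) * v' y + a * (a + 1) * y powr (- a - 2) * V y"
  have hd: "(?u has_real_derivative ?u' y) (at y) \<and> (?u' has_real_derivative ?u'' y) (at y) \<and>
    y * ?u'' y + (1 + a - y) * ?u' y - L * ?u y = 0" if "y > 0" for y
  proof (intro conjI)
    show "(?u has_real_derivative ?u' y) (at y)"
      using that v(1) by (auto intro!: derivative_eq_intros simp: algebra_simps)
    show "(?u' has_real_derivative ?u'' y) (at y)"
      using that v(1,2) by (auto intro!: derivative_eq_intros simp: algebra_simps)
    have e: "y powr (- a - 1) = y powr (- a) / y" "y powr (- a - 2) = y powr (- a) / (y * y)"
      using that by (simp_all add: powr_diff power2_eq_square powr_numeral)
    have "y * ?u'' y + (1 + a - y) * ?u' y - L * ?u y = y powr (- a) * (y * v'' y + (1 - a - y) * v' y - A * V y)"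
      unfolding e A_def using that by (simp add: field_simps)
    then show "y * ?u'' y + (1 + a - y) * ?u' y - L * ?u y = 0" using v(3)[OF that] by simp
  qed
  have ha: "?u \<sim>[at_top] (\<lambda>y. y powr (- L))"
  proof -
    have "?u \<sim>[at_top] (\<lambda>y. y powr (- a) * y powr (- A))"
      by (intro asymp_equiv_intros as)
    also have "(\<lambda>y. y powr (- a) * y powr (- A)) \<sim>[at_top] (\<lambda>y. y powr (- L))"
      by (rule asymp_equiv_refl_ev) (auto simp: A_def simp flip: powr_add intro: eventually_mono[OF eventually_gt_at_top[of 0]])
    finally show ?thesis .
  qed
  have u: "is_tricomi L (1 + a) ?u"
    unfolding is_tricomi_def
    by (intro conjI ha exI[of _ ?u'] exI[of _ ?u''] allI impI hd[THEN conjunct1] hd[THEN conjunct2, THEN conjunct1] hd[THEN conjunct2, THEN conjunct2])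
  have L: "L > 0" "1 + a \<le> L + 1" using assms by auto
  have "?u y = tricomi_integral L (1 + a - L - 1) y / Gamma L"
    using assms by (intro is_tricomi_unique[OF is_tricomi_tricomi_integral[OF L] _ u])
      (auto intro!: divide_pos_pos tricomi_integral_pos Gamma_real_pos)
  then show ?thesis
    unfolding tricomi_eq_integral[OF L assms(3)] by (simp add: V_def A_def)
qed

text \<open>Near \<open>0\<close> the solution is a multiple of \<open>y powr (- a)\<close> plus a
  constant. The derivative of the first integral isolates the singular coefficient. The combination
  \<open>a * u + y * u'\<close> annihilates \<open>y powr (- a)\<close>, so its limit is
  \<open>a\<close> times the constant, obtained from the integral after Kummer's
  transformation.\<close>

lemma tricomi_exponents:
  assumes "0 < a" "a < 1" "L > 1"
  obtains u' u'' where
    "\<And>y. y > 0 \<Longrightarrow> (tricomi L (1 + a) has_real_derivative u' y) (at y)"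
    "\<And>y. y > 0 \<Longrightarrow> (u' has_real_derivative u'' y) (at y)"
    "\<And>y. y > 0 \<Longrightarrow> y * u'' y + (1 + a - y) * u' y - L * tricomi L (1 + a) y = 0"
    "\<And>y. y > 0 \<Longrightarrow> tricomi L (1 + a) y > 0"
    "\<And>y. y > 0 \<Longrightarrow> u' y < 0"
    "tricomi L (1 + a) \<sim>[at_top] (\<lambda>y. y powr (- L))"
    "((\<lambda>y. y powr (1 + a) * u' y) \<longlongrightarrow> - (Gamma (1 + a) * rGamma L)) (at_right 0)"
    "((\<lambda>y. a * tricomi L (1 + a) y + y * u' y) \<longlongrightarrow> a * (Gamma (- a) * rGamma (L - a))) (at_right 0)"
proof -
  have L: "L > 0" "1 + a \<le> L + 1" "L > a" using assms by auto
  define U where "U = tricomi L (1 + a)"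
  have U: "U y = tricomi_integral L (a - L) y / Gamma L" if "y > 0" for y
    using tricomi_eq_integral[OF L(1,2) that] by (simp add: U_def algebra_simps)
  have UK: "U y = y powr (- a) * (tricomi_integral (L - a) (- L) y / Gamma (L - a))" if "y > 0" for y
    unfolding U_def using tricomi_kummer[OF L(3) assms(1) that] .
  have G: "Gamma L > 0" "Gamma (L - a) > 0" using L by (auto intro: Gamma_real_pos)
  have "is_tricomi L (1 + a) (\<lambda>y. tricomi_integral L (1 + a - L - 1) y / Gamma L)"
    by (rule is_tricomi_tricomi_integral[OF L(1,2)])
  then have "is_tricomi L (1 + a) (\<lambda>y. tricomi_integral L (a - L) y / Gamma L)" by (simp add: algebra_simps)
  then obtain u' u'' where u: "\<And>y. y > 0 \<Longrightarrow> ((\<lambda>y. tricomi_integral L (a - L) y / Gamma L) has_real_derivative u' y) (at y)"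
     "\<And>y. y > 0 \<Longrightarrow> (u' has_real_derivative u'' y) (at y)"
     "\<And>y. y > 0 \<Longrightarrow> y * u'' y + (1 + a - y) * u' y - L * (tricomi_integral L (a - L) y / Gamma L) = 0"
     and as: "(\<lambda>y. tricomi_integral L (a - L) y / Gamma L) \<sim>[at_top] (\<lambda>y. y powr (- L))"
    unfolding is_tricomi_def by blast
  have dU: "(U has_real_derivative u' y) (at y)" if "y > 0" for y
    by (rule has_field_derivative_transform_within_open[OF u(1), of _ "{0<..}"]) (use that U in auto)
  have u'1: "u' y = - tricomi_integral (L + 1) (a - L) y / Gamma L" if "y > 0" for y
  proof (rule DERIV_unique[OF u(1)[OF that]])
    show "((\<lambda>y. tricomi_integral L (a - L) y / Gamma L) has_real_derivative - tricomi_integral (L + 1) (a - L) y / Gamma L) (at y)"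
      using DERIV_cdivide[OF tricomi_integral_has_derivative[of L "a - L" y], of "Gamma L"] L that by simp
  qed
  \<comment> \<open>Differentiating the factor \<open>y powr (- a)\<close> gives exactly the term
    that \<open>a * U y\<close> cancels; only the derivative of the integral is left.\<close>
  have u'2: "a * U y + y * u' y = - (tricomi_integral (L - a + 1) (- L) y * y powr (1 - a)) / Gamma (L - a)" if "y > 0" for y
  proof -
    let ?J = "tricomi_integral (L - a) (- L) y" and ?J1 = "tricomi_integral (L - a + 1) (- L) y"
    have "((\<lambda>y. y powr (- a) * (tricomi_integral (L - a) (- L) y / Gamma (L - a))) has_real_derivative
        - a * y powr (- a - 1) * (?J / Gamma (L - a)) + y powr (- a) * (- ?J1 / Gamma (L - a))) (at y)"
    proof -
      have "((\<lambda>y. y powr (- a)) has_real_derivative - a * y powr (- a - 1)) (at y)"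
        using that by (auto intro!: derivative_eq_intros)
      from DERIV_mult[OF this DERIV_cdivide[OF tricomi_integral_has_derivative[of "L - a" "- L" y], of "Gamma (L - a)"]]
      show ?thesis using L that by (simp add: mult.commute)
    qed
    then have "(U has_real_derivative - a * y powr (- a - 1) * (?J / Gamma (L - a)) + y powr (- a) * (- ?J1 / Gamma (L - a))) (at y)"
      by (rule has_field_derivative_transform_within_open[of _ _ _ "{0<..}"]) (use that UK in auto)
    then have "u' y = - a * y powr (- a - 1) * (?J / Gamma (L - a)) + y powr (- a) * (- ?J1 / Gamma (L - a))"
      using DERIV_unique dU[OF that] by blast
    then show ?thesis using that G UK[OF that] by (simp add: powr_diff powr_minus field_simps)
  qed
  have pos: "\<forall>\<^sub>F y in at_right 0. y > (0::real)" by (simp add: eventually_at_right_less)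
  show thesis
  proof (rule that[of u' u'', folded U_def])
    show "y * u'' y + (1 + a - y) * u' y - L * U y = 0" if "y > 0" for y
      using u(3)[OF that] U[OF that] by simp
    show "U y > 0" if "y > 0" for y
      unfolding U[OF that] using L G that by (auto intro!: divide_pos_pos tricomi_integral_pos)
    show "u' y < 0" if "y > 0" for y
      unfolding u'1[OF that] using L G tricomi_integral_pos[of "L + 1" "a - L" y] that
      by (simp add: divide_pos_pos)
    have "U \<sim>[at_top] (\<lambda>y. tricomi_integral L (a - L) y / Gamma L)"
      by (rule asymp_equiv_refl_ev) (use U in \<open>auto intro: eventually_mono[OF eventually_gt_at_top[of 0]]\<close>)
    then show "U \<sim>[at_top] (\<lambda>y. y powr (- L))" using as asymp_equiv_trans by blast
    have "((\<lambda>y. tricomi_integral (L + 1) (a - L) y * y powr (L + 1 + (a - L))) \<longlongrightarrow> Gamma (L + 1 + (a - L))) (at_right 0)"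
      using assms by (intro tricomi_integral_tendsto_at_right_0) auto
    then have "((\<lambda>y. - (tricomi_integral (L + 1) (a - L) y * y powr (1 + a)) / Gamma L) \<longlongrightarrow> - Gamma (1 + a) / Gamma L) (at_right 0)"
      using G by (intro tendsto_intros) auto
    then have "((\<lambda>y. y powr (1 + a) * u' y) \<longlongrightarrow> - Gamma (1 + a) / Gamma L) (at_right 0)"
      by (rule Lim_transform_eventually) (use pos u'1 in \<open>auto elim!: eventually_mono\<close>)
    then show "((\<lambda>y. y powr (1 + a) * u' y) \<longlongrightarrow> - (Gamma (1 + a) * rGamma L)) (at_right 0)"
      by (simp add: rGamma_inverse_Gamma divide_inverse)
    have "((\<lambda>y. tricomi_integral (L - a + 1) (- L) y * y powr (L - a + 1 + (- L))) \<longlongrightarrow> Gamma (L - a + 1 + (- L))) (at_right 0)"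
      using assms by (intro tricomi_integral_tendsto_at_right_0) auto
    then have "((\<lambda>y. - (tricomi_integral (L - a + 1) (- L) y * y powr (1 - a)) / Gamma (L - a)) \<longlongrightarrow> - Gamma (1 - a) / Gamma (L - a)) (at_right 0)"
      using G by (intro tendsto_intros) auto
    then have "((\<lambda>y. a * U y + y * u' y) \<longlongrightarrow> - Gamma (1 - a) / Gamma (L - a)) (at_right 0)"
      by (rule Lim_transform_eventually) (use pos u'2 in \<open>auto elim!: eventually_mono\<close>)
    \<comment> \<open>\<open>0 < a < 1\<close> keeps \<open>- a\<close> away from the poles, so the
      functional equation turns \<open>Gamma (1 - a)\<close> into
      \<open>- a * Gamma (- a)\<close>.\<close>
    moreover have "- a \<notin> \<int>\<^sub>\<le>\<^sub>0"
    proof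
      assume "- a \<in> \<int>\<^sub>\<le>\<^sub>0"
      then obtain n :: int where "- a = of_int n" by (auto elim: nonpos_Ints_cases)
      then have "real_of_int (-1) < real_of_int n" "real_of_int n < 0" using assms by simp_all
      then show False unfolding of_int_less_iff by simp
    qed
    then have "Gamma (1 - a) = - a * Gamma (- a)"
      using Gamma_plus1[of "- a"] by simp
    ultimately show "((\<lambda>y. a * U y + y * u' y) \<longlongrightarrow> a * (Gamma (- a) * rGamma (L - a))) (at_right 0)"
      by (simp add: rGamma_inverse_Gamma divide_inverse mult.assoc)
  qed (use dU u in auto)
qed

subsection \<open>Integration over the positive half-line\<close>

abbreviation leb_pos :: "real measure" where
  "leb_pos \<equiv> lebesgue_on {0<..}"

lemma integrable_leb_pos_iff:
  fixes f :: "real \<Rightarrow> real"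
  shows "integrable leb_pos f \<longleftrightarrow> f absolutely_integrable_on {0<..}"
  unfolding set_integrable_def by (subst integrable_restrict_space) auto

lemma borel_measurable_leb_pos_continuous:
  fixes f :: "real \<Rightarrow> real"
  shows "continuous_on {0<..} f \<Longrightarrow> f \<in> borel_measurable leb_pos"
  by (rule continuous_imp_measurable_on_sets_lebesgue) auto

text \<open>By completeness a change on a null set preserves measurability. It is applied to
  \<open>L p\<close>, which is known only almost everywhere.\<close>

lemma borel_measurable_leb_pos_AE:
  fixes f g :: "real \<Rightarrow> real"
  assumes f: "f \<in> borel_measurable leb_pos" and ae: "AE x in leb_pos. f x = g x"
  shows "g \<in> borel_measurable leb_pos"
proof -
  have "(\<lambda>x. indicator {0<..} x *\<^sub>R f x) \<in> borel_measurable lebesgue"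
    using f by (subst (asm) borel_measurable_restrict_space_iff) auto
  moreover have "AE x in lebesgue. indicator {0<..} x *\<^sub>R f x = indicator {0<..} x *\<^sub>R g x"
    using ae by (subst (asm) AE_restrict_space_iff) (auto elim!: eventually_mono simp: indicator_def)
  ultimately have "(\<lambda>x. indicator {0<..} x *\<^sub>R g x) \<in> borel_measurable lebesgue"
    by (rule borel_measurable_AE)
  then show ?thesis by (subst borel_measurable_restrict_space_iff) auto
qed

lemma integrable_leb_pos_subinterval:
  fixes h :: "real \<Rightarrow> real"
  assumes "integrable leb_pos h" "0 < a"
  shows "h absolutely_integrable_on {a..b}"
  using assms(1) unfolding integrable_leb_pos_iff by (rule set_integrable_subset) (use assms(2) in auto)

text \<open>The primitive of \<open>- h\<close> normalised to vanish at infinity. Integrating over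
  the whole half-line with an indicator lets dominated convergence yield both boundary
  limits.\<close>

definition tail_integral :: "(real \<Rightarrow> real) \<Rightarrow> real \<Rightarrow> real" where
  "tail_integral h t = (LINT x|leb_pos. indicator {t<..} x * h x)"

lemma integrable_indicator_leb_pos:
  fixes h :: "real \<Rightarrow> real"
  assumes "integrable leb_pos h" "A \<in> sets borel"
  shows "integrable leb_pos (\<lambda>x. indicator A x * h x)"
proof -
  have "A \<inter> {0<..} \<in> sets leb_pos"
    using assms(2) unfolding sets_restrict_space by (intro image_eqI[of _ _ A]) auto
  then have "integrable leb_pos (\<lambda>x. indicator (A \<inter> {0<..}) x *\<^sub>R h x)"
    by (rule integrable_mult_indicator[OF _ assms(1)])
  moreover have "integrable leb_pos (\<lambda>x. indicator (A \<inter> {0<..}) x *\<^sub>R h x) \<longleftrightarrow> integrable leb_pos (\<lambda>x. indicator A x * h x)"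
  proof (rule Bochner_Integration.integrable_cong[OF refl])
    fix x assume "x \<in> space leb_pos"
    then show "indicator (A \<inter> {0<..}) x *\<^sub>R h x = indicator A x * h x" by (simp add: indicator_def)
  qed
  ultimately show ?thesis by blast
qed

lemma tail_integral_diff:
  assumes h: "integrable leb_pos h" and at: "0 < a" "a \<le> t"
  shows "tail_integral h a = integral {a..t} h + tail_integral h t"
proof -
  have "tail_integral h a - tail_integral h t = (LINT x|leb_pos. indicator {a<..} x * h x - indicator {t<..} x * h x)"
    unfolding tail_integral_def by (intro Bochner_Integration.integral_diff[symmetric] integrable_indicator_leb_pos h) auto
  also have "\<dots> = (LINT x|leb_pos. indicator {a<..t} x *\<^sub>R h x)"
    using at by (intro Bochner_Integration.integral_cong) (auto simp: indicator_def)
  also have "\<dots> = (LINT x:{a<..t}|lebesgue. h x)"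
    unfolding set_lebesgue_integral_def using at
    by (subst integral_restrict_space) (auto intro!: Bochner_Integration.integral_cong simp: indicator_def)
  also have "\<dots> = integral {a<..t} h"
    using integrable_leb_pos_subinterval[OF h at(1), of t]
    by (intro set_lebesgue_integral_eq_integral(2)) (auto intro: set_integrable_subset)
  also have "\<dots> = integral {a..t} h"
    by (rule integral_subset_negligible) (auto intro: negligible_subset[of "{a}"])
  finally show ?thesis by simp
qed

lemma tail_integral_at_top:
  assumes h: "integrable leb_pos h"
  shows "(tail_integral h \<longlongrightarrow> 0) at_top"
proof -
  have "((\<lambda>t. LINT x|leb_pos. indicator {t<..} x * h x) \<longlongrightarrow> (LINT x|leb_pos. 0)) at_top"
  proof (rule integral_dominated_convergence_at_top[where w = "\<lambda>x. \<bar>h x\<bar>"])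
    show "AE x in leb_pos. ((\<lambda>t. indicator {t<..} x * h x) \<longlongrightarrow> 0) at_top"
    proof (rule AE_I2)
      fix x show "((\<lambda>t. indicator {t<..} x * h x) \<longlongrightarrow> 0) at_top"
        by (rule tendsto_eventually, rule eventually_mono[OF eventually_ge_at_top[of x]]) auto
    qed
    show "\<forall>\<^sub>F t in at_top. AE x in leb_pos. norm (indicator {t<..} x * h x) \<le> \<bar>h x\<bar>"
      by (intro always_eventually allI AE_I2) (auto simp: indicator_def)
  qed (use h integrable_indicator_leb_pos[OF h] in \<open>auto intro!: borel_measurable_integrable\<close>)
  then show ?thesis unfolding tail_integral_def[abs_def] by simp
qed

lemma tail_integral_at_right_0:
  assumes h: "integrable leb_pos h"
  shows "(tail_integral h \<longlongrightarrow> integral\<^sup>L leb_pos h) (at_right 0)"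
proof -
  \<comment> \<open>The convergence rule takes a parameter tending to infinity, so the limit at
    \<open>0\<close> is written with \<open>inverse t\<close>.\<close>
  have "((\<lambda>t. LINT x|leb_pos. indicator {inverse t<..} x * h x) \<longlongrightarrow> (LINT x|leb_pos. h x)) at_top"
  proof (rule integral_dominated_convergence_at_top[where w = "\<lambda>x. \<bar>h x\<bar>"])
    show "AE x in leb_pos. ((\<lambda>t. indicator {inverse t<..} x * h x) \<longlongrightarrow> h x) at_top"
    proof (rule AE_I2)
      fix x assume "x \<in> space leb_pos"
      then have x: "x > 0" by simp
      show "((\<lambda>t. indicator {inverse t<..} x * h x) \<longlongrightarrow> h x) at_top"
      proof (rule tendsto_eventually, rule eventually_mono[OF eventually_gt_at_top[of "inverse x"]])
        fix t assume "inverse x < t"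
        then have "inverse t < inverse (inverse x)" using x by (intro less_imp_inverse_less) auto
        then show "indicator {inverse t<..} x * h x = h x" by simp
      qed
    qed
    show "\<forall>\<^sub>F t in at_top. AE x in leb_pos. norm (indicator {inverse t<..} x * h x) \<le> \<bar>h x\<bar>"
      by (intro always_eventually allI AE_I2) (auto simp: indicator_def)
  qed (use h integrable_indicator_leb_pos[OF h] in \<open>auto intro!: borel_measurable_integrable\<close>)
  then show ?thesis unfolding tail_integral_def[abs_def] filterlim_at_right_to_top by simp
qed

lemma tail_integral_abs_cont:
  assumes h: "integrable leb_pos h"
  shows "loc_abs_cont_pos (tail_integral h)"
  unfolding loc_abs_cont_pos_def
proof (intro allI impI)
  fix a b :: real assume ab: "0 < a \<and> a < b"
  have "abs_cont_on a b (\<lambda>t. tail_integral h a - integral {a..t} h)"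
  proof (rule abs_cont_on_diff)
    show "abs_cont_on a b (\<lambda>_. tail_integral h a)"
      by (rule abs_cont_on_lipschitz[of _ _ _ 0]) simp
    show "abs_cont_on a b (\<lambda>t. integral {a..t} h)"
      using ab by (intro abs_cont_on_integral integrable_leb_pos_subinterval[OF h]) auto
  qed
  then show "abs_cont_on a b (tail_integral h)"
    by (rule abs_cont_on_cong[rotated]) (use ab tail_integral_diff[OF h] in auto)
qed

text \<open>The half-line is exhausted by the intervals from \<open>1 / Suc n\<close> to
  \<open>Suc n\<close>; each contributes a null set, and the countable union of these is
  null.\<close>

lemma tail_integral_has_derivative_AE:
  assumes h: "integrable leb_pos h"
  shows "AE x in leb_pos. (tail_integral h has_real_derivative - h x) (at x)"
proof -
  have "\<exists>N. negligible N \<and> (\<forall>x\<in>{1 / Suc n<..<Suc n} - N. ((\<lambda>t. integral {1 / Suc n..t} h) has_real_derivative h x) (at x))" for n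
    using integrable_leb_pos_subinterval[OF h, of "1 / Suc n" "Suc n"]
    by (intro integral_has_real_derivative_AE) (auto simp: set_lebesgue_integral_eq_integral)
  then obtain N where N: "\<And>n. negligible (N n)"
    "\<And>n x. x \<in> {1 / Suc n<..<Suc n} - N n \<Longrightarrow> ((\<lambda>t. integral {1 / Suc n..t} h) has_real_derivative h x) (at x)"
    by metis
  have "negligible (\<Union>n. N n)" using N(1) by (intro negligible_countable_Union) auto
  moreover have "(tail_integral h has_real_derivative - h x) (at x)" if x: "x > 0" "x \<notin> (\<Union>n. N n)" for x
  proof -
    obtain m where m: "1 / Suc m < x" using nat_approx_posE[OF x(1)] by auto
    obtain k where k: "x < real k" using reals_Archimedean2 by blast
    define n where "n = max m k"
    have "1 / Suc n \<le> 1 / Suc m" by (simp add: n_def frac_le)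
    moreover have "real k \<le> Suc n" by (simp add: n_def)
    ultimately have n: "x \<in> {1 / Suc n<..<Suc n}" using m k by simp
    then have "((\<lambda>t. integral {1 / Suc n..t} h) has_real_derivative h x) (at x)" using N(2) x by blast
    then have "((\<lambda>t. tail_integral h (1 / Suc n) - integral {1 / Suc n..t} h) has_real_derivative - h x) (at x)"
      by (auto intro!: derivative_eq_intros)
    then show ?thesis
    proof (rule has_field_derivative_transform_within_open)
      show "tail_integral h (1 / Suc n) - integral {1 / Suc n..t} h = tail_integral h t"
        if "t \<in> {1 / Suc n<..<Suc n}" for t
        using tail_integral_diff[OF h, of "1 / Suc n" t] that by (simp del: of_nat_Suc)
    qed (use n in auto)
  qed
  then have "{x \<in> {0<..}. \<not> (tail_integral h has_real_derivative - h x) (at x)} \<subseteq> (\<Union>n. N n)"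
    by blast
  ultimately show ?thesis
    by (subst AE_lebesgue_on_iff_negligible) (auto intro: negligible_subset)
qed

lemma loc_abs_cont_pos_imp_continuous_on:
  assumes "loc_abs_cont_pos f"
  shows "continuous_on {0<..} f"
proof (rule continuous_at_imp_continuous_on, rule ballI)
  fix x :: real assume "x \<in> {0<..}"
  then have x: "x > 0" by simp
  then have "abs_cont_on (x / 2) (2 * x) f" using assms unfolding loc_abs_cont_pos_def by auto
  then have "continuous_on {x / 2..2 * x} f" by (rule abs_cont_on_imp_continuous_on)
  then show "isCont f x" by (rule continuous_on_interior) (use x in \<open>auto simp: interior_atLeastAtMost_real\<close>)
qed

lemma loc_abs_cont_pos_C1:
  assumes "\<And>x. x > 0 \<Longrightarrow> (f has_real_derivative f' x) (at x)" "continuous_on {0<..} f'"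
  shows "loc_abs_cont_pos f"
  unfolding loc_abs_cont_pos_def
  by (auto intro!: abs_cont_on_C1[of _ _ _ f'] has_field_derivative_at_within[OF assms(1)] continuous_on_subset[OF assms(2)])

lemma tail_integral_has_derivative:
  assumes h: "integrable leb_pos h" "continuous_on {0<..} h" "x > 0"
  shows "(tail_integral h has_real_derivative - h x) (at x)"
  by (rule loc_abs_cont_pos_imp_C1[OF tail_integral_abs_cont[OF h(1)] _ tail_integral_has_derivative_AE[OF h(1)] h(3)])
     (intro continuous_intros h)

section \<open>Primitives, integrability tests and Cauchy-Schwarz\<close>

lemma has_primitive_pos:
  fixes g :: "real \<Rightarrow> real"
  assumes "continuous_on {0<..} g"
  obtains G where "\<And>x. x > 0 \<Longrightarrow> (G has_real_derivative g x) (at x)"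
proof
  fix x :: real assume x: "x > 0"
  \<comment> \<open>The interval must contain \<open>x\<close> in its interior and also the base
    point \<open>1\<close> of the oriented integral.\<close>
  define a where "a = min (x / 2) 1"
  define b where "b = max (2 * x) 1"
  have ab: "0 < a" "a \<le> 1" "1 \<le> b" "a < x" "x < b" using x by (auto simp: a_def b_def)
  have "((\<lambda>u. LBINT y=1..u. g y) has_vector_derivative g x) (at x within {a..b})"
  proof -
    have "{a..b} \<subseteq> {0<..}" using ab by auto
    then show ?thesis
      using ab continuous_on_subset[OF assms, of "{a..b}"] interval_integral_FTC2[of a 1 b g x]
      by (simp add: one_ereal_def)
  qed
  then show "((\<lambda>u. LBINT y=1..u. g y) has_real_derivative g x) (at x)"
    using ab by (simp add: has_real_derivative_iff_has_vector_derivative at_within_Icc_at)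
qed

lemma integrable_leb_pos_powr_bounds:
  fixes g :: "real \<Rightarrow> real"
  assumes g: "continuous_on {0<..} g"
    and zero: "\<And>x. 0 < x \<Longrightarrow> x \<le> 1 \<Longrightarrow> \<bar>g x\<bar> \<le> C * x powr (- b)" "b < 1"
    and inf: "\<And>x. x \<ge> X \<Longrightarrow> \<bar>g x\<bar> \<le> C' * x powr (- d)" "d > 1" "X > 0"
  shows "integrable leb_pos g"
proof -
  have m: "g \<in> borel_measurable (lebesgue_on S)" if "S \<subseteq> {0<..}" "S \<in> sets lebesgue" for S
    using that continuous_on_subset[OF g that(1)] by (intro continuous_imp_measurable_on_sets_lebesgue)
  have "g absolutely_integrable_on {0<..1}"
  proof (rule measurable_bounded_by_integrable_imp_absolutely_integrable)
    have "(\<lambda>x. x powr (- b)) integrable_on {0<..1}"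
      using zero(2) by (intro integrable_on_powr_from_0') auto
    then show "(\<lambda>x. C * x powr (- b)) integrable_on {0<..1}" by (rule integrable_on_mult_right)
    show "g \<in> borel_measurable (lebesgue_on {0<..1})" by (rule m) auto
  qed (use zero in auto)
  moreover have "g absolutely_integrable_on {X..}"
  proof (rule measurable_bounded_by_integrable_imp_absolutely_integrable)
    have "(\<lambda>x. x powr (- d)) integrable_on {X..}"
      using has_integral_powr_to_inf[of "- d" X] inf by (auto simp: integrable_on_def)
    then show "(\<lambda>x. C' * x powr (- d)) integrable_on {X..}" by (rule integrable_on_mult_right)
    show "g \<in> borel_measurable (lebesgue_on {X..})" by (rule m) (use inf in auto)
  qed (use inf in auto)
  moreover have "g absolutely_integrable_on {1..X}"
    by (rule absolutely_integrable_continuous_real) (auto intro: continuous_on_subset[OF g])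
  ultimately have "g absolutely_integrable_on ({0<..1} \<union> {1..X} \<union> {X..})"
    by (intro set_integrable_Un) auto
  \<comment> \<open>For \<open>X < 1\<close> the middle piece is empty and the outer two overlap, so
    the half-line is still covered.\<close>
  moreover have "{0<..1} \<union> {1..X} \<union> {X..} = {0<..}" using inf(3) by auto
  ultimately show ?thesis unfolding integrable_leb_pos_iff by simp
qed

lemma not_integrable_leb_pos_inverse:
  fixes g :: "real \<Rightarrow> real"
  assumes g: "integrable leb_pos g" and "c > 0" and le: "\<And>x. x \<ge> X \<Longrightarrow> c / x \<le> \<bar>g x\<bar>"
  shows False
proof -
  define a where "a = max X 1"
  have a: "a \<ge> X" "a \<ge> 1" by (auto simp: a_def)
  define I where "I = integral\<^sup>L leb_pos (\<lambda>x. \<bar>g x\<bar>)"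
  have ag: "integrable leb_pos (\<lambda>x. \<bar>g x\<bar>)" using g by simp
  have bd: "c * (ln b - ln a) \<le> I" if b: "b \<ge> a" for b
  proof -
    have h: "((\<lambda>x. c / x) has_integral (c * ln b - c * ln a)) {a..b}"
      using a b by (intro fundamental_theorem_of_calculus)
        (auto intro!: derivative_eq_intros simp: has_real_derivative_iff_has_vector_derivative[symmetric])
    have i: "(\<lambda>x. \<bar>g x\<bar>) absolutely_integrable_on {a..b}"
      using a by (intro integrable_leb_pos_subinterval[OF ag]) auto
    have "c * ln b - c * ln a \<le> integral {a..b} (\<lambda>x. \<bar>g x\<bar>)"
      using i a by (intro has_integral_le[OF h integrable_integral]) (auto simp: set_lebesgue_integral_eq_integral intro!: le)
    also have "\<dots> \<le> tail_integral (\<lambda>x. \<bar>g x\<bar>) a"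
      using tail_integral_diff[OF ag, of a b] a b by (simp add: tail_integral_def)
    also have "\<dots> \<le> I"
      unfolding tail_integral_def I_def
      by (intro integral_mono integrable_indicator_leb_pos ag) (auto simp: indicator_def)
    finally show ?thesis by (simp add: algebra_simps)
  qed
  \<comment> \<open>Chosen so that \<open>c * (ln b - ln a) = \<bar>I\<bar> + 1\<close>, which
    exceeds the bound \<open>I\<close>.\<close>
  define b where "b = a * exp ((\<bar>I\<bar> + 1) / c)"
  have "b \<ge> a * 1" unfolding b_def using a \<open>c > 0\<close> by (intro mult_left_mono) auto
  then have "c * (ln b - ln a) \<le> I" by (intro bd) simp
  moreover have "ln b = ln a + (\<bar>I\<bar> + 1) / c"
    using a by (simp add: b_def ln_mult)
  ultimately show False using \<open>c > 0\<close> by simp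
qed

text \<open>Compactness handles a bounded interval and the limit handles the rest. Applied to
  quotients by powers, this turns asymptotics into bounds that hold on a whole half-line.\<close>

lemma continuous_pos_limit_bounds:
  fixes f :: "real \<Rightarrow> real"
  assumes f: "continuous_on {0<..} f" and pos: "\<And>x. x > 0 \<Longrightarrow> f x > 0" and lim: "(f \<longlongrightarrow> l) at_top" "l > 0" and "a > 0"
  obtains c C where "c > 0" "C > 0" "\<And>x. x \<ge> a \<Longrightarrow> c \<le> f x \<and> f x \<le> C"
proof -
  have "\<forall>\<^sub>F x in at_top. \<bar>f x - l\<bar> < l / 2"
    using tendstoD[OF lim(1), of "l / 2"] lim(2) by (simp add: dist_real_def)
  then obtain X0 where X0: "\<And>x. x \<ge> X0 \<Longrightarrow> \<bar>f x - l\<bar> < l / 2"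
    unfolding eventually_at_top_linorder by blast
  define X where "X = max a X0"
  have K: "compact {a..X}" "{a..X} \<noteq> {}" "continuous_on {a..X} f"
    using \<open>a > 0\<close> by (auto simp: X_def intro: continuous_on_subset[OF f])
  obtain u where u: "u \<in> {a..X}" "\<And>x. x \<in> {a..X} \<Longrightarrow> f u \<le> f x"
    using continuous_attains_inf[OF K] by blast
  obtain v where v: "v \<in> {a..X}" "\<And>x. x \<in> {a..X} \<Longrightarrow> f x \<le> f v"
    using continuous_attains_sup[OF K] by blast
  show thesis
  proof (rule that[of "min (f u) (l / 2)" "max (f v) (2 * l)"])
    fix x assume x: "x \<ge> a"
    show "min (f u) (l / 2) \<le> f x \<and> f x \<le> max (f v) (2 * l)"
    proof (cases "x \<le> X")
      case True
      then show ?thesis using u(2)[of x] v(2)[of x] x by auto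
    next
      case False
      then have "\<bar>f x - l\<bar> < l / 2" by (intro X0) (auto simp: X_def)
      then have "l / 2 \<le> f x" "f x \<le> 2 * l" using lim(2) by linarith+
      then show ?thesis by auto
    qed
  qed (use pos u v \<open>a > 0\<close> lim(2) in \<open>auto simp: less_max_iff_disj\<close>)
qed

lemma Cauchy_Schwarz_integral:
  fixes f g :: "'a \<Rightarrow> real"
  assumes m: "f \<in> borel_measurable M" "g \<in> borel_measurable M"
    and f: "integrable M (\<lambda>x. (f x)\<^sup>2)" and g: "integrable M (\<lambda>x. (g x)\<^sup>2)"
  shows "integrable M (\<lambda>x. f x * g x)"
    and "(\<integral>x. f x * g x \<partial>M)\<^sup>2 \<le> (\<integral>x. (f x)\<^sup>2 \<partial>M) * (\<integral>x. (g x)\<^sup>2 \<partial>M)"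
proof -
  have ab: "\<bar>a * b\<bar> \<le> a\<^sup>2 + b\<^sup>2" for a b :: real
  proof -
    have "2 * \<bar>a\<bar> * \<bar>b\<bar> \<le> a\<^sup>2 + b\<^sup>2" using sum_squares_bound[of "\<bar>a\<bar>" "\<bar>b\<bar>"] by simp
    moreover have "0 \<le> \<bar>a\<bar> * \<bar>b\<bar>" by simp
    ultimately show ?thesis unfolding abs_mult by linarith
  qed
  show fg: "integrable M (\<lambda>x. f x * g x)"
    by (rule Bochner_Integration.integrable_bound[OF Bochner_Integration.integrable_add[OF f g]])
       (use m ab in \<open>auto intro!: AE_I2\<close>)
  define A where "A = (\<integral>x. (f x)\<^sup>2 \<partial>M)"
  define B where "B = (\<integral>x. f x * g x \<partial>M)"
  define C where "C = (\<integral>x. (g x)\<^sup>2 \<partial>M)"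
  have quad: "0 \<le> A + 2 * s * B + s\<^sup>2 * C" for s
  proof -
    have "0 \<le> (\<integral>x. (f x + s * g x)\<^sup>2 \<partial>M)" by simp
    also have "(\<lambda>x. (f x + s * g x)\<^sup>2) = (\<lambda>x. (f x)\<^sup>2 + 2 * s * (f x * g x) + s\<^sup>2 * (g x)\<^sup>2)"
      by (auto simp: power2_eq_square algebra_simps)
    also have "(\<integral>x. (f x)\<^sup>2 + 2 * s * (f x * g x) + s\<^sup>2 * (g x)\<^sup>2 \<partial>M) = A + 2 * s * B + s\<^sup>2 * C"
      using f g fg by (simp add: A_def B_def C_def)
    finally show ?thesis .
  qed
  have "B\<^sup>2 \<le> A * C"
  proof (cases "C = 0")
    case True
    have "B = 0"
    proof (rule ccontr)
      assume "B \<noteq> 0"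
      \<comment> \<open>At this \<open>s\<close> the expression \<open>A + 2 * s * B\<close> equals
        \<open>-1\<close>.\<close>
      then show False using quad[of "- (A + 1) / (2 * B)"] True \<open>B \<noteq> 0\<close> by (simp add: field_simps)
    qed
    then show ?thesis using True by simp
  next
    case False
    have "C \<ge> 0" by (simp add: C_def)
    then have C: "C > 0" using False by simp
    have "0 \<le> A + 2 * (- B / C) * B + (- B / C)\<^sup>2 * C" by (rule quad)
    also have "\<dots> = A - B\<^sup>2 / C" using C by (simp add: power2_eq_square field_simps)
    finally show ?thesis using C by (simp add: field_simps)
  qed
  then show "(\<integral>x. f x * g x \<partial>M)\<^sup>2 \<le> (\<integral>x. (f x)\<^sup>2 \<partial>M) * (\<integral>x. (g x)\<^sup>2 \<partial>M)"
    by (simp add: A_def B_def C_def)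
qed

subsection \<open>The Sturm--Liouville operator\<close>

lemma AE_leb_pos_I: "(\<And>x. x > 0 \<Longrightarrow> P x) \<Longrightarrow> AE x in leb_pos. P x"
  by (rule AE_I2) auto

lemma loc_abs_cont_pos_cong:
  assumes "loc_abs_cont_pos f" "\<And>x. x > 0 \<Longrightarrow> f x = g x"
  shows "loc_abs_cont_pos g"
  unfolding loc_abs_cont_pos_def
proof (intro allI impI)
  fix a b :: real assume ab: "0 < a \<and> a < b"
  then have "abs_cont_on a b f" using assms(1) unfolding loc_abs_cont_pos_def by blast
  then show "abs_cont_on a b g" by (rule abs_cont_on_cong[rotated]) (use ab assms(2) in simp)
qed

lemma eventually_pos_nhds: "x > (0::real) \<Longrightarrow> \<forall>\<^sub>F t in nhds x. t > 0"
  using eventually_nhds_in_open[of "{0<..}" x] by simp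

locale cev =
  fixes \<mu> \<sigma> \<gamma> :: real
  assumes mu: "\<mu> > 0" and sigma: "\<sigma> > 0" and gam: "0 < \<gamma>" "\<gamma> < 1"
begin

abbreviation "W \<equiv> cev_weight \<mu> \<sigma> \<gamma>"
abbreviation "Q2 \<equiv> cev_Q2 \<mu> \<sigma> \<gamma>"
abbreviation "Q0 \<equiv> cev_Q0 \<mu> \<sigma> \<gamma>"
abbreviation "L \<equiv> cev_op \<mu> \<sigma> \<gamma>"
abbreviation "M \<equiv> cev_measure \<mu> \<sigma> \<gamma>"

text \<open>\<open>k\<close> and \<open>n\<close> keep the sign of \<open>\<nu>\<close> out of the
  formulas; \<open>mu_eq\<close> is what ties them to \<open>\<mu>\<close>.\<close>

definition k :: real where "k = \<sigma>\<^sup>2 / 2"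
definition n :: real where "n = \<bar>cev_nu \<mu> \<sigma> \<gamma>\<bar>"

lemma k_pos: "k > 0" using sigma by (simp add: k_def)

lemma nu_eq: "cev_nu \<mu> \<sigma> \<gamma> = - n"
proof -
  have "(\<gamma> - 2) * \<sigma>\<^sup>2 < 0" using gam sigma by (simp add: mult_neg_pos)
  then have "cev_nu \<mu> \<sigma> \<gamma> < 0" using mu by (simp add: cev_nu_def divide_pos_neg)
  then show ?thesis by (simp add: n_def)
qed

lemma n_pos: "n > 0"
  using mu sigma gam by (simp add: n_def cev_nu_def)

lemma mu_eq: "k * n * (2 - \<gamma>) = \<mu>"
proof -
  have "n = - (2 * \<mu> / ((\<gamma> - 2) * \<sigma>\<^sup>2))" using nu_eq by (simp add: cev_nu_def)
  then show ?thesis using gam sigma by (simp add: k_def divide_simps) (simp add: algebra_simps)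
qed

lemma W_eq: "W x = x powr \<gamma> * exp (- n * x powr (2 - \<gamma>))"
  by (simp add: cev_weight_def nu_eq)

lemma W_pos: "x > 0 \<Longrightarrow> W x > 0"
  by (simp add: W_eq)

lemma W_le: "x > 0 \<Longrightarrow> W x \<le> x powr \<gamma>"
  using n_pos by (simp add: W_eq mult_left_le)

lemma Q2_eq: "Q2 x = k * x powr \<gamma> * W x"
  by (simp add: cev_Q2_def k_def)

lemma Q2_pos: "x > 0 \<Longrightarrow> Q2 x > 0"
  using k_pos W_pos by (simp add: Q2_eq)

lemma Q0_eq: "Q0 x = W x * (k * \<gamma> * (\<gamma> - 1) * x powr (\<gamma> - 2) - \<mu>)"
  by (simp add: cev_Q0_def k_def)

lemma W_deriv:
  assumes "x > 0"
  shows "(W has_real_derivative W x * (\<gamma> / x - n * (2 - \<gamma>) * x powr (1 - \<gamma>))) (at x)"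
proof -
  have "((\<lambda>x. x powr \<gamma> * exp (- n * x powr (2 - \<gamma>))) has_real_derivative
     (\<gamma> * x powr (\<gamma> - 1)) * exp (- n * x powr (2 - \<gamma>)) +
      x powr \<gamma> * (exp (- n * x powr (2 - \<gamma>)) * (- n * ((2 - \<gamma>) * x powr (2 - \<gamma> - 1))))) (at x)"
    using assms by (auto intro!: derivative_eq_intros)
  moreover have "(\<gamma> * x powr (\<gamma> - 1)) * exp (- n * x powr (2 - \<gamma>)) +
      x powr \<gamma> * (exp (- n * x powr (2 - \<gamma>)) * (- n * ((2 - \<gamma>) * x powr (2 - \<gamma> - 1)))) =
      W x * (\<gamma> / x - n * (2 - \<gamma>) * x powr (1 - \<gamma>))"
  proof -
    have "x powr (\<gamma> - 1) = x powr \<gamma> / x" "2 - \<gamma> - 1 = 1 - \<gamma>" using assms by (simp_all add: powr_diff)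
    then show ?thesis unfolding W_eq by (simp add: algebra_simps)
  qed
  ultimately show ?thesis unfolding W_eq[abs_def] by simp
qed

lemma Q2_deriv:
  assumes "x > 0"
  shows "(Q2 has_real_derivative W x * (2 * k * \<gamma> * x powr (\<gamma> - 1) - \<mu> * x)) (at x)"
proof -
  have "((\<lambda>x. k * x powr \<gamma> * W x) has_real_derivative
     k * (\<gamma> * x powr (\<gamma> - 1)) * W x + W x * (\<gamma> / x - n * (2 - \<gamma>) * x powr (1 - \<gamma>)) * (k * x powr \<gamma>)) (at x)"
    using assms by (auto intro!: derivative_eq_intros W_deriv)
  moreover have "k * (\<gamma> * x powr (\<gamma> - 1)) * W x + W x * (\<gamma> / x - n * (2 - \<gamma>) * x powr (1 - \<gamma>)) * (k * x powr \<gamma>) =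
     W x * (2 * k * \<gamma> * x powr (\<gamma> - 1) - (k * n * (2 - \<gamma>)) * (x powr (1 - \<gamma>) * x powr \<gamma>))"
    using assms by (simp add: powr_diff algebra_simps)
  moreover have "x powr (1 - \<gamma>) * x powr \<gamma> = x" using assms by (simp flip: powr_add)
  ultimately show ?thesis unfolding mu_eq Q2_eq[abs_def] by simp
qed

lemma W_cont: "continuous_on {0<..} W" and Q2_cont: "continuous_on {0<..} Q2" and Q0_cont: "continuous_on {0<..} Q0"
  by (auto simp: W_eq[abs_def] Q2_eq[abs_def] Q0_eq[abs_def] intro!: continuous_intros)

lemma W_measurable: "W \<in> borel_measurable leb_pos"
  by (rule borel_measurable_leb_pos_continuous[OF W_cont])

section \<open>From the weighted space to Lebesgue measure, and the maximal domain\<close>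

lemma AE_M_iff: "(AE x in M. P x) \<longleftrightarrow> (AE x in leb_pos. P x)"
  unfolding cev_measure_def using W_measurable
  by (subst AE_density) (auto simp: W_pos intro!: AE_cong)

lemma measurable_M: "borel_measurable M = borel_measurable leb_pos"
  by (simp add: cev_measure_def measurable_def)

lemma L2_iff: "f \<in> L2_set_of M \<longleftrightarrow> f \<in> borel_measurable leb_pos \<and> integrable leb_pos (\<lambda>x. W x * (f x)\<^sup>2)"
proof -
  have "integrable M (\<lambda>x. (f x)\<^sup>2) \<longleftrightarrow> integrable leb_pos (\<lambda>x. W x *\<^sub>R (f x)\<^sup>2)" if "f \<in> borel_measurable leb_pos"
    unfolding cev_measure_def using that W_measurable W_pos
    by (intro integrable_density AE_leb_pos_I) (auto intro: less_imp_le)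
  then show ?thesis by (auto simp: L2_set_of_def measurable_M)
qed

lemma L2_norm_eq:
  assumes "f \<in> borel_measurable leb_pos"
  shows "L2_norm_of M f = sqrt (LINT x|leb_pos. W x * (f x)\<^sup>2)"
proof -
  have "integral\<^sup>L M (\<lambda>x. (f x)\<^sup>2) = (LINT x|leb_pos. W x *\<^sub>R (f x)\<^sup>2)"
    unfolding cev_measure_def using assms W_measurable W_pos
    by (intro integral_density AE_leb_pos_I) (auto intro: less_imp_le)
  then show ?thesis by (simp add: L2_norm_of_def)
qed

text \<open>\<open>Q2\<close> is smooth and positive, so dividing by it transfers differentiability.
  This connects the operator, written with second derivatives, to a domain that speaks of
  \<open>Q2 * p'\<close>.\<close>

lemma deriv_of_quasi_deriv:
  assumes "x > 0" "((\<lambda>t. Q2 t * p' t) has_real_derivative d) (at x)"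
  obtains p2 where "(p' has_real_derivative p2) (at x)"
proof -
  have "((\<lambda>t. (Q2 t * p' t) / Q2 t) has_real_derivative
     (d * Q2 x - (Q2 x * p' x) * (W x * (2 * k * \<gamma> * x powr (\<gamma> - 1) - \<mu> * x))) / (Q2 x * Q2 x)) (at x)"
    using assms Q2_pos[of x] by (intro DERIV_divide Q2_deriv) auto
  then have "(p' has_real_derivative
     (d * Q2 x - (Q2 x * p' x) * (W x * (2 * k * \<gamma> * x powr (\<gamma> - 1) - \<mu> * x))) / (Q2 x * Q2 x)) (at x)"
  proof (rule has_field_derivative_transform_within_open)
    show "Q2 t * p' t / Q2 t = p' t" if "t \<in> {0<..}" for t using Q2_pos[of t] that by simp
  qed (use assms in auto)
  then show thesis by (rule that)
qed

lemma L_eq: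
  assumes x: "x > 0" and p: "\<And>t. t > 0 \<Longrightarrow> (p has_real_derivative p' t) (at t)"
    and q: "((\<lambda>t. Q2 t * p' t) has_real_derivative d) (at x)"
  shows "L p x = (d + Q0 x * p x) / W x"
proof -
  obtain p2 where p2: "(p' has_real_derivative p2) (at x)" using deriv_of_quasi_deriv[OF x q] .
  have "L p x = (deriv (\<lambda>t. Q2 t * deriv p t) x + Q0 x * p x) / W x"
    by (rule cev_op_sturm_liouville[OF _ _ x p p2]) (use sigma gam in auto)
  also have "deriv (\<lambda>t. Q2 t * deriv p t) x = deriv (\<lambda>t. Q2 t * p' t) x"
    by (rule deriv_cong_ev[OF _ refl], rule eventually_mono[OF eventually_pos_nhds[OF x]])
      (simp add: DERIV_imp_deriv[OF p])
  also have "\<dots> = d" using q by (rule DERIV_imp_deriv)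
  finally show ?thesis .
qed

text \<open>Absolute continuity of \<open>Q2 * deriv p\<close> makes \<open>deriv p\<close>
  continuous. By \<open>loc_abs_cont_pos_imp_C1\<close> the derivative of \<open>p\<close>, at first
  known almost everywhere, then exists at every point.\<close>

lemma DmaxD:
  assumes "p \<in> cev_Dmax \<mu> \<sigma> \<gamma>"
  shows "\<And>x. x > 0 \<Longrightarrow> (p has_real_derivative deriv p x) (at x)"
    and "continuous_on {0<..} (deriv p)"
    and "loc_abs_cont_pos (\<lambda>x. Q2 x * deriv p x)"
    and "AE x in leb_pos. ((\<lambda>t. Q2 t * deriv p t) has_real_derivative W x * L p x - Q0 x * p x) (at x)"
    and "p \<in> L2_set_of M" "L p \<in> L2_set_of M"
proof -
  show p: "p \<in> L2_set_of M" "L p \<in> L2_set_of M" and ac: "loc_abs_cont_pos (\<lambda>x. Q2 x * deriv p x)"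
    using assms by (auto simp: cev_Dmax_def)
  have ae: "AE x in leb_pos. p differentiable (at x) \<and> (\<lambda>t. Q2 t * deriv p t) differentiable (at x)"
    using assms unfolding cev_Dmax_def AE_M_iff by auto
  have "continuous_on {0<..} (\<lambda>x. (Q2 x * deriv p x) / Q2 x)"
    using Q2_pos by (intro continuous_on_divide Q2_cont loc_abs_cont_pos_imp_continuous_on[OF ac]) force
  then show dc: "continuous_on {0<..} (deriv p)"
    by (rule continuous_on_eq) (use Q2_pos in force)
  show pd: "(p has_real_derivative deriv p x) (at x)" if "x > 0" for x
  proof (rule loc_abs_cont_pos_imp_C1[OF _ dc _ that])
    show "loc_abs_cont_pos p" using assms by (simp add: cev_Dmax_def)
    show "AE x in leb_pos. (p has_real_derivative deriv p x) (at x)"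
      using ae by eventually_elim (simp add: DERIV_deriv_iff_real_differentiable)
  qed
  have "AE x in leb_pos. x > 0" by (rule AE_leb_pos_I)
  with ae show "AE x in leb_pos. ((\<lambda>t. Q2 t * deriv p t) has_real_derivative W x * L p x - Q0 x * p x) (at x)"
  proof eventually_elim
    case (elim x)
    then have q: "((\<lambda>t. Q2 t * deriv p t) has_real_derivative deriv (\<lambda>t. Q2 t * deriv p t) x) (at x)"
      by (simp add: DERIV_deriv_iff_real_differentiable)
    have "L p x = (deriv (\<lambda>t. Q2 t * deriv p t) x + Q0 x * p x) / W x"
      by (rule L_eq[OF _ pd q]) (use elim in auto)
    then have "W x * L p x - Q0 x * p x = deriv (\<lambda>t. Q2 t * deriv p t) x"
      using W_pos[of x] elim by simp
    then show ?case using q by simp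
  qed
qed

text \<open>\<open>p'\<close> and \<open>h\<close> are explicit candidates for the derivative and
  for \<open>L p\<close>. Domain elements can thus be built without evaluating the total functions
  \<open>deriv\<close> and \<open>cev_op\<close> where the derivatives may fail to exist.\<close>

lemma DmaxI:
  assumes p: "\<And>x. x > 0 \<Longrightarrow> (p has_real_derivative p' x) (at x)" "continuous_on {0<..} p'"
    and ac: "loc_abs_cont_pos (\<lambda>x. Q2 x * p' x)"
    and ae: "AE x in leb_pos. ((\<lambda>t. Q2 t * p' t) has_real_derivative W x * h x - Q0 x * p x) (at x)"
    and h: "h \<in> L2_set_of M" and int: "integrable leb_pos (\<lambda>x. W x * (p x)\<^sup>2)"
  shows "p \<in> cev_Dmax \<mu> \<sigma> \<gamma>" "AE x in leb_pos. L p x = h x"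
proof -
  have "AE x in leb_pos. x > 0" by (rule AE_leb_pos_I)
  with ae have both: "AE x in leb_pos. L p x = h x \<and> p differentiable (at x) \<and> (\<lambda>t. Q2 t * deriv p t) differentiable (at x)"
  proof eventually_elim
    case (elim x)
    then have q: "((\<lambda>t. Q2 t * p' t) has_real_derivative W x * h x - Q0 x * p x) (at x)" by simp
    have "L p x = (W x * h x - Q0 x * p x + Q0 x * p x) / W x"
      by (rule L_eq[OF _ p(1) q]) (use elim in auto)
    then have "L p x = h x" using W_pos[of x] elim by simp
    moreover have "((\<lambda>t. Q2 t * deriv p t) has_real_derivative W x * h x - Q0 x * p x) (at x)"
      using q
    proof (rule has_field_derivative_transform_within_open)
      show "Q2 t * p' t = Q2 t * deriv p t" if "t \<in> {0<..}" for t
        using DERIV_imp_deriv[OF p(1)] that by simp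
    qed (use elim in auto)
    ultimately show ?case
      using p(1)[of x] elim unfolding real_differentiable_def by blast
  qed
  then show Lh: "AE x in leb_pos. L p x = h x" by eventually_elim simp
  have pc: "continuous_on {0<..} p"
    using p(1) by (intro continuous_at_imp_continuous_on ballI) (auto intro: DERIV_isCont)
  have "loc_abs_cont_pos p" by (rule loc_abs_cont_pos_C1[OF p])
  moreover have "loc_abs_cont_pos (\<lambda>x. Q2 x * deriv p x)"
    by (rule loc_abs_cont_pos_cong[OF ac]) (simp add: DERIV_imp_deriv[OF p(1)])
  moreover have "p \<in> L2_set_of M"
    unfolding L2_iff using int borel_measurable_leb_pos_continuous[OF pc] by simp
  moreover have "L p \<in> L2_set_of M"
  proof -
    have hm: "h \<in> borel_measurable leb_pos" "integrable leb_pos (\<lambda>x. W x * (h x)\<^sup>2)"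
      using h by (auto simp: L2_iff)
    have Lm: "L p \<in> borel_measurable leb_pos"
      by (rule borel_measurable_leb_pos_AE[OF hm(1)]) (use Lh in \<open>auto elim: eventually_mono\<close>)
    have "integrable leb_pos (\<lambda>x. W x * (L p x)\<^sup>2)"
      by (rule integrable_cong_AE_imp[OF hm(2)])
         (use Lh Lm W_measurable in \<open>auto elim: eventually_mono\<close>)
    then show ?thesis using Lm by (simp add: L2_iff)
  qed
  moreover have "AE x in M. p differentiable (at x) \<and> (\<lambda>t. Q2 t * deriv p t) differentiable (at x)"
    unfolding AE_M_iff using both by eventually_elim simp
  ultimately show "p \<in> cev_Dmax \<mu> \<sigma> \<gamma>" by (simp add: cev_Dmax_def)
qed

text \<open>The classical eigenvalue equation \<open>(Q2 p')' + Q0 p = l W p\<close> as a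
  first-order system; the derivative is carried along, so no second derivative of \<open>p\<close>
  appears.\<close>

definition sol :: "real \<Rightarrow> (real \<Rightarrow> real) \<Rightarrow> (real \<Rightarrow> real) \<Rightarrow> bool" where
  "sol l p p' \<longleftrightarrow> (\<forall>x>0. (p has_real_derivative p' x) (at x) \<and>
     ((\<lambda>t. Q2 t * p' t) has_real_derivative (l * W x - Q0 x) * p x) (at x))"

lemma solD:
  assumes "sol l p p'" "x > 0"
  shows "(p has_real_derivative p' x) (at x)"
    and "((\<lambda>t. Q2 t * p' t) has_real_derivative (l * W x - Q0 x) * p x) (at x)"
  using assms by (auto simp: sol_def)

lemma sol_cont:
  assumes "sol l p p'"
  shows "continuous_on {0<..} p" "continuous_on {0<..} p'"
proof -
  show "continuous_on {0<..} p"
    using solD(1)[OF assms] by (intro continuous_at_imp_continuous_on ballI) (auto intro: DERIV_isCont)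
  have "continuous_on {0<..} (\<lambda>x. Q2 x * p' x)"
    using solD(2)[OF assms] by (intro continuous_at_imp_continuous_on ballI) (auto intro: DERIV_isCont)
  then have "continuous_on {0<..} (\<lambda>x. (Q2 x * p' x) / Q2 x)"
    using Q2_pos by (intro continuous_on_divide Q2_cont) force+
  then show "continuous_on {0<..} p'"
    by (rule continuous_on_eq) (use Q2_pos in force)
qed

text \<open>Regularity: the right side \<open>(l W - Q0) p\<close> is continuous, so the equation
  for the absolutely continuous \<open>Q2 * deriv p\<close> extends from almost every point to every
  point.\<close>

lemma eigenfunction_sol:
  assumes p: "p \<in> cev_Dmax \<mu> \<sigma> \<gamma>" and ev: "AE x in leb_pos. L p x = l * p x"
  shows "sol l p (deriv p)"
  unfolding sol_def
proof (intro allI impI conjI)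
  fix x :: real assume "x > 0"
  show "(p has_real_derivative deriv p x) (at x)" using DmaxD(1)[OF p \<open>x > 0\<close>] .
  show "((\<lambda>t. Q2 t * deriv p t) has_real_derivative (l * W x - Q0 x) * p x) (at x)"
  proof (rule loc_abs_cont_pos_imp_C1[OF DmaxD(3)[OF p] _ _ \<open>x > 0\<close>])
    have "continuous_on {0<..} p"
      using DmaxD(1)[OF p] by (intro continuous_at_imp_continuous_on ballI) (auto intro: DERIV_isCont)
    then show "continuous_on {0<..} (\<lambda>x. (l * W x - Q0 x) * p x)"
      by (intro continuous_intros W_cont Q0_cont)
    show "AE x in leb_pos. ((\<lambda>t. Q2 t * deriv p t) has_real_derivative (l * W x - Q0 x) * p x) (at x)"
      using DmaxD(4)[OF p] ev by eventually_elim (simp add: algebra_simps)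
  qed
qed

lemma sol_Dmax:
  assumes s: "sol l p p'" and int: "integrable leb_pos (\<lambda>x. W x * (p x)\<^sup>2)"
  shows "p \<in> cev_Dmax \<mu> \<sigma> \<gamma>" "AE x in leb_pos. L p x = l * p x"
proof -
  have lp: "(\<lambda>x. l * p x) \<in> L2_set_of M"
    unfolding L2_iff
  proof
    show "(\<lambda>x. l * p x) \<in> borel_measurable leb_pos"
      by (intro borel_measurable_leb_pos_continuous continuous_intros sol_cont[OF s])
    have "integrable leb_pos (\<lambda>x. l\<^sup>2 * (W x * (p x)\<^sup>2))" using int by simp
    then show "integrable leb_pos (\<lambda>x. W x * (l * p x)\<^sup>2)" by (simp add: power_mult_distrib mult_ac)
  qed
  have ac: "loc_abs_cont_pos (\<lambda>x. Q2 x * p' x)"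
    by (rule loc_abs_cont_pos_C1[OF solD(2)[OF s]]) (auto intro!: continuous_intros W_cont Q0_cont sol_cont[OF s])
  have ae: "AE x in leb_pos. ((\<lambda>t. Q2 t * p' t) has_real_derivative W x * (l * p x) - Q0 x * p x) (at x)"
  proof (rule AE_leb_pos_I)
    fix x :: real assume "x > 0"
    from solD(2)[OF s this] show "((\<lambda>t. Q2 t * p' t) has_real_derivative W x * (l * p x) - Q0 x * p x) (at x)"
      by (simp add: algebra_simps)
  qed
  show "p \<in> cev_Dmax \<mu> \<sigma> \<gamma>" "AE x in leb_pos. L p x = l * p x"
    using DmaxI[OF solD(1)[OF s] sol_cont(2)[OF s] ac ae lp int] by auto
qed

text \<open>If \<open>p\<close> vanishes almost everywhere, the constant \<open>0\<close> has
  derivative \<open>p\<close> almost everywhere. Since \<open>p\<close> is continuous this holds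
  everywhere, and so \<open>p\<close> is \<open>0\<close>.\<close>

lemma AE_zero_iff:
  fixes p :: "real \<Rightarrow> real"
  assumes "continuous_on {0<..} p"
  shows "(AE x in leb_pos. p x = 0) \<longleftrightarrow> (\<forall>x>0. p x = 0)"
proof
  assume ae: "AE x in leb_pos. p x = 0"
  have "loc_abs_cont_pos (\<lambda>x::real. 0)"
    by (rule loc_abs_cont_pos_C1[where f' = "\<lambda>_. 0"]) auto
  then have "((\<lambda>x. 0) has_real_derivative p x) (at x)" if "x > 0" for x
    by (rule loc_abs_cont_pos_imp_C1[OF _ assms _ that]) (use ae in \<open>auto elim: eventually_mono\<close>)
  then show "\<forall>x>0. p x = 0" using DERIV_unique[OF _ DERIV_const] by blast
qed (auto intro: AE_leb_pos_I)

subsection \<open>Integrable solutions for non-positive spectral parameter\<close>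

text \<open>The Fokker-Planck operator in divergence form is \<open>L p = J'\<close> with the flux
  \<open>J = (k x powr \<gamma> p)' - \<mu> x p\<close>, expanded here by the product rule.\<close>

definition flux :: "(real \<Rightarrow> real) \<Rightarrow> (real \<Rightarrow> real) \<Rightarrow> real \<Rightarrow> real" where
  "flux p p' x = k * x powr \<gamma> * p' x + (k * \<gamma> * x powr (\<gamma> - 1) - \<mu> * x) * p x"

lemma flux_deriv:
  assumes s: "sol l p p'" and x: "x > 0"
  shows "(flux p p' has_real_derivative l * p x) (at x)"
    and "((\<lambda>x. k * x powr \<gamma> * p x) has_real_derivative \<mu> * x * p x + flux p p' x) (at x)"
proof -
  let ?w = "\<gamma> / x - n * (2 - \<gamma>) * x powr (1 - \<gamma>)"
  have xx: "x powr (1 - \<gamma>) * x powr \<gamma> = x" using x by (simp flip: powr_add)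
  \<comment> \<open>The flux is rewritten with \<open>Q2 p' / W\<close> because the derivative of
    \<open>Q2 p'\<close> is the one that the solution provides.\<close>
  have "((\<lambda>t. (Q2 t * p' t) / W t + (k * \<gamma> * t powr (\<gamma> - 1) - \<mu> * t) * p t) has_real_derivative
      ((l * W x - Q0 x) * p x * W x - (Q2 x * p' x) * (W x * ?w)) / (W x * W x)
     + ((k * \<gamma> * ((\<gamma> - 1) * x powr (\<gamma> - 1 - 1)) - \<mu>) * p x + p' x * (k * \<gamma> * x powr (\<gamma> - 1) - \<mu> * x))) (at x)"
  proof (intro DERIV_add DERIV_divide DERIV_mult solD[OF s x] W_deriv x)
    show "((\<lambda>x. k * \<gamma> * x powr (\<gamma> - 1) - \<mu> * x) has_real_derivative k * \<gamma> * ((\<gamma> - 1) * x powr (\<gamma> - 1 - 1)) - \<mu>) (at x)"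
      using x by (auto intro!: derivative_eq_intros)
  qed (use W_pos[OF x] in auto)
  moreover have "((l * W x - Q0 x) * p x * W x - (Q2 x * p' x) * (W x * ?w)) / (W x * W x)
     + ((k * \<gamma> * ((\<gamma> - 1) * x powr (\<gamma> - 1 - 1)) - \<mu>) * p x + p' x * (k * \<gamma> * x powr (\<gamma> - 1) - \<mu> * x)) = l * p x"
  proof -
    have "(Q2 x * p' x) * (W x * ?w) = W x * W x * (p' x * (k * \<gamma> * x powr (\<gamma> - 1) - (k * n * (2 - \<gamma>)) * (x powr (1 - \<gamma>) * x powr \<gamma>)))"
      using x by (simp add: Q2_eq powr_diff algebra_simps)
    then have e1: "(Q2 x * p' x) * (W x * ?w) = W x * W x * (p' x * (k * \<gamma> * x powr (\<gamma> - 1) - \<mu> * x))"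
      unfolding mu_eq xx .
    have e2: "(l * W x - Q0 x) * p x * W x = W x * W x * ((l - (k * \<gamma> * (\<gamma> - 1) * x powr (\<gamma> - 2) - \<mu>)) * p x)"
      by (simp add: Q0_eq algebra_simps)
    have "((l * W x - Q0 x) * p x * W x - (Q2 x * p' x) * (W x * ?w)) / (W x * W x) =
       (l - (k * \<gamma> * (\<gamma> - 1) * x powr (\<gamma> - 2) - \<mu>)) * p x - p' x * (k * \<gamma> * x powr (\<gamma> - 1) - \<mu> * x)"
      unfolding e1 e2 using W_pos[OF x] by (simp flip: right_diff_distrib)
    then show ?thesis by (simp add: algebra_simps)
  qed
  ultimately have "((\<lambda>t. (Q2 t * p' t) / W t + (k * \<gamma> * t powr (\<gamma> - 1) - \<mu> * t) * p t) has_real_derivative l * p x) (at x)"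
    by simp
  then show "(flux p p' has_real_derivative l * p x) (at x)"
  proof (rule has_field_derivative_transform_within_open)
    show "Q2 t * p' t / W t + (k * \<gamma> * t powr (\<gamma> - 1) - \<mu> * t) * p t = flux p p' t" if "t \<in> {0<..}" for t
      using that W_pos[of t] by (simp add: flux_def Q2_eq)
  qed (use x in auto)
  have "((\<lambda>x. k * x powr \<gamma> * p x) has_real_derivative k * (\<gamma> * x powr (\<gamma> - 1)) * p x + p' x * (k * x powr \<gamma>)) (at x)"
    by (intro DERIV_mult solD[OF s x]) (use x in \<open>auto intro!: derivative_eq_intros\<close>)
  then show "((\<lambda>x. k * x powr \<gamma> * p x) has_real_derivative \<mu> * x * p x + flux p p' x) (at x)"
    by (simp add: flux_def algebra_simps)
qed

text \<open>With \<open>g = k x powr \<gamma> * p\<close> one has \<open>(g / x)' = \<mu> p + J / x - g / x\<^sup>2\<close>; a positive limit of the flux \<open>J\<close> makes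
  \<open>g / x\<close> grow logarithmically.\<close>

lemma flux_limit_not_pos:
  assumes s: "sol l p p'" and p: "integrable leb_pos p" and lim: "(flux p p' \<longlongrightarrow> c) at_top" and "c > 0"
  shows False
proof -
  have pc: "continuous_on {0<..} p" by (rule sol_cont[OF s])
  have ap: "integrable leb_pos (\<lambda>x. \<bar>p x\<bar>)" "continuous_on {0<..} (\<lambda>x. \<bar>p x\<bar>)"
    using p pc by (auto intro: continuous_intros)
  have "\<forall>\<^sub>F x in at_top. flux p p' x > c / 2"
    using order_tendstoD(1)[OF lim, of "c / 2"] \<open>c > 0\<close> by simp
  moreover have "\<forall>\<^sub>F x in at_top. \<bar>tail_integral p x\<bar> < 1"
    using tendstoD[OF tail_integral_at_top[OF p] zero_less_one] by (simp add: dist_real_def)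
  moreover have "\<forall>\<^sub>F x in at_top. x \<ge> (1::real)" by (rule eventually_ge_at_top)
  ultimately have "\<forall>\<^sub>F x in at_top. flux p p' x > c / 2 \<and> \<bar>tail_integral p x\<bar> < 1 \<and> x \<ge> 1"
    by eventually_elim simp
  then obtain X where X: "\<And>x. x \<ge> X \<Longrightarrow> flux p p' x > c / 2 \<and> \<bar>tail_integral p x\<bar> < 1 \<and> x \<ge> 1"
    unfolding eventually_at_top_linorder by blast
  define g where "g x = k * x powr \<gamma> * p x" for x
  \<comment> \<open>The first tail term cancels \<open>\<mu> p\<close>, and the second dominates
    \<open>g / x ^ 2\<close>, which is at most \<open>k * \<bar>p\<bar>\<close> for
    \<open>x \<ge> 1\<close>. What remains of the derivative is at least
    \<open>(J - c / 2) / x\<close>.\<close>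
  define \<Phi> where "\<Phi> x = g x / x + \<mu> * tail_integral p x - c / 2 * ln x - k * tail_integral (\<lambda>x. \<bar>p x\<bar>) x" for x
  have \<Phi>: "(\<Phi> has_real_derivative (\<mu> * x * p x + flux p p' x) / x - g x / x\<^sup>2 - \<mu> * p x - c / 2 / x + k * \<bar>p x\<bar>) (at x)" if "x > 0" for x
  proof -
    have "(g has_real_derivative \<mu> * x * p x + flux p p' x) (at x)"
      unfolding g_def by (rule flux_deriv(2)[OF s that])
    then show ?thesis
      unfolding \<Phi>_def using that
      by (auto intro!: derivative_eq_intros tail_integral_has_derivative[OF p pc] tail_integral_has_derivative[OF ap]
          simp: power2_eq_square field_simps)
  qed
  have mono: "\<Phi> X \<le> \<Phi> x" if "x \<ge> X" for x
  proof (rule DERIV_nonneg_imp_nondecreasing[OF that])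
    fix t assume t: "X \<le> t" "t \<le> x"
    have t1: "t \<ge> 1" and ft: "flux p p' t > c / 2" using X[OF t(1)] by auto
    have "g t / t\<^sup>2 = k * t powr (\<gamma> - 2) * p t" using t1 by (simp add: g_def powr_diff powr_numeral)
    also have "\<dots> \<le> k * 1 * \<bar>p t\<bar>"
    proof -
      have "t powr (\<gamma> - 2) \<le> t powr 0" using t1 gam by (intro powr_mono) auto
      then have le1: "k * t powr (\<gamma> - 2) \<le> k * 1" using k_pos t1 by (intro mult_left_mono) auto
      have "k * t powr (\<gamma> - 2) * p t \<le> k * t powr (\<gamma> - 2) * \<bar>p t\<bar>" using k_pos by (intro mult_left_mono) auto
      also have "\<dots> \<le> k * 1 * \<bar>p t\<bar>" using le1 by (intro mult_right_mono) auto
      finally show ?thesis .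
    qed
    finally have "g t / t\<^sup>2 \<le> k * \<bar>p t\<bar>" by simp
    moreover have "(\<mu> * t * p t + flux p p' t) / t - \<mu> * p t - c / 2 / t = (flux p p' t - c / 2) / t"
      using t1 by (simp add: field_simps)
    moreover have "(flux p p' t - c / 2) / t \<ge> 0" using ft t1 by simp
    ultimately have "0 \<le> (\<mu> * t * p t + flux p p' t) / t - g t / t\<^sup>2 - \<mu> * p t - c / 2 / t + k * \<bar>p t\<bar>"
      by linarith
    then show "\<exists>y. (\<Phi> has_real_derivative y) (at t) \<and> 0 \<le> y"
      using \<Phi>[of t] t1 by auto
  qed
  have "LIM x at_top. c / 2 * ln x + (\<Phi> X - \<mu>) :> at_top"
    using \<open>c > 0\<close> by real_asymp
  then have "\<forall>\<^sub>F x in at_top. c / 2 * ln x + (\<Phi> X - \<mu>) \<ge> 1"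
    by (simp add: filterlim_at_top)
  then obtain Y where Y: "\<And>x. x \<ge> Y \<Longrightarrow> c / 2 * ln x + (\<Phi> X - \<mu>) \<ge> 1"
    unfolding eventually_at_top_linorder by blast
  show False
  proof (rule not_integrable_leb_pos_inverse[OF p, of "1 / k" "max X Y"])
    fix x assume x: "max X Y \<le> x"
    have x1: "x \<ge> 1" "\<bar>tail_integral p x\<bar> < 1" using X[of x] x by auto
    have "tail_integral (\<lambda>x. \<bar>p x\<bar>) x \<ge> 0" by (simp add: tail_integral_def)
    then have "k * tail_integral (\<lambda>x. \<bar>p x\<bar>) x \<ge> 0" using k_pos by simp
    moreover have "\<mu> * tail_integral p x \<le> \<mu> * 1" using x1 mu by (intro mult_left_mono) auto
    ultimately have "g x / x \<ge> 1"
      using mono[of x] Y[of x] x unfolding \<Phi>_def[of x] by simp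
    then have "x \<le> g x" using x1 by (simp add: field_simps)
    then have "1 \<le> g x" using x1 by simp
    have "x powr \<gamma> \<le> x powr 1" using x1 gam by (intro powr_mono) auto
    then have "x powr \<gamma> \<le> x" using x1 by simp
    have "1 / k / x \<le> g x / k / x powr \<gamma>"
      using \<open>1 \<le> g x\<close> \<open>x powr \<gamma> \<le> x\<close> k_pos x1 by (intro frac_le divide_right_mono) auto
    also have "\<dots> = p x" using x1 k_pos by (simp add: g_def)
    finally show "1 / k / x \<le> \<bar>p x\<bar>" by simp
  qed (use k_pos in auto)
qed

text \<open>A Gronwall argument, run downwards from \<open>X\<close>, for the system
  \<open>g' = \<mu> x p + J\<close>, \<open>J' = l p\<close> with
  \<open>g = k x powr \<gamma> p\<close>. The drift term \<open>2 g \<mu> x p\<close> has the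
  favourable sign and needs no constant.\<close>

lemma sol_zero_backward:
  assumes s: "sol l p p'" and "a > 0" "a \<le> X" and z: "p X = 0" "flux p p' X = 0"
  shows "p a = 0"
proof -
  define g where "g x = k * x powr \<gamma> * p x" for x
  define J where "J = flux p p'"
  \<comment> \<open>The \<open>1\<close> pays for the coupling \<open>2 g J\<close>, the second
    summand for \<open>2 J l p\<close>, since \<open>x powr (- \<gamma>)\<close> is largest at
    \<open>a\<close>.\<close>
  define C where "C = 1 + \<bar>l\<bar> * a powr (- \<gamma>) / k"
  define N where "N x = ((g x)\<^sup>2 + (J x)\<^sup>2) * exp (C * x)" for x
  have "N a \<le> N X"
  proof (rule DERIV_nonneg_imp_nondecreasing[OF \<open>a \<le> X\<close>])
    fix x assume x: "a \<le> x" "x \<le> X"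
    then have x0: "x > 0" using \<open>a > 0\<close> by simp
    let ?d = "(2 * g x * (\<mu> * x * p x + J x) + 2 * J x * (l * p x) + C * ((g x)\<^sup>2 + (J x)\<^sup>2)) * exp (C * x)"
    have gd: "(g has_real_derivative \<mu> * x * p x + J x) (at x)"
      unfolding g_def J_def by (rule flux_deriv(2)[OF s x0])
    have Jd: "(J has_real_derivative l * p x) (at x)"
      unfolding J_def by (rule flux_deriv(1)[OF s x0])
    have "(N has_real_derivative ?d) (at x)"
      unfolding N_def by (auto intro!: derivative_eq_intros gd Jd simp: algebra_simps)
    moreover have "?d \<ge> 0"
    proof -
      have px: "p x = x powr (- \<gamma>) / k * g x" using x0 k_pos by (simp add: g_def powr_minus)
      have "2 * g x * (\<mu> * x * p x) = 2 * \<mu> * x * (x powr (- \<gamma>) / k) * (g x)\<^sup>2"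
        by (simp add: px power2_eq_square)
      then have t1: "2 * g x * (\<mu> * x * p x) \<ge> 0" using mu x0 k_pos by simp
      have am: "\<bar>2 * (g x * J x)\<bar> \<le> (g x)\<^sup>2 + (J x)\<^sup>2"
        using sum_squares_bound[of "\<bar>g x\<bar>" "\<bar>J x\<bar>"] by (simp add: abs_mult)
      have "x powr (- \<gamma>) \<le> a powr (- \<gamma>)" using x \<open>a > 0\<close> gam by (intro powr_mono2') auto
      then have b: "\<bar>l\<bar> * x powr (- \<gamma>) / k \<le> \<bar>l\<bar> * a powr (- \<gamma>) / k"
        using k_pos by (intro divide_right_mono mult_left_mono) auto
      have "\<bar>2 * J x * (l * p x)\<bar> = (\<bar>l\<bar> * x powr (- \<gamma>) / k) * \<bar>2 * (g x * J x)\<bar>"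
        using k_pos by (simp add: px abs_mult)
      also have "\<dots> \<le> (\<bar>l\<bar> * a powr (- \<gamma>) / k) * ((g x)\<^sup>2 + (J x)\<^sup>2)"
        using b am k_pos by (intro mult_mono) auto
      finally have t2: "\<bar>2 * J x * (l * p x)\<bar> \<le> (C - 1) * ((g x)\<^sup>2 + (J x)\<^sup>2)" by (simp add: C_def)
      have "2 * g x * (\<mu> * x * p x + J x) + 2 * J x * (l * p x) + C * ((g x)\<^sup>2 + (J x)\<^sup>2)
        = 2 * g x * (\<mu> * x * p x) + (2 * (g x * J x) + ((g x)\<^sup>2 + (J x)\<^sup>2)) + (2 * J x * (l * p x) + (C - 1) * ((g x)\<^sup>2 + (J x)\<^sup>2))"
        by (simp add: algebra_simps)
      also have "\<dots> \<ge> 0" using t1 am t2 by linarith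
      finally show ?thesis by simp
    qed
    ultimately show "\<exists>y. (N has_real_derivative y) (at x) \<and> 0 \<le> y" by blast
  qed
  also have "N X = 0" using z by (simp add: N_def g_def J_def)
  finally have "(g a)\<^sup>2 + (J a)\<^sup>2 \<le> 0" by (simp add: N_def mult_le_0_iff not_le)
  then have "g a = 0" by (simp add: sum_power2_le_zero_iff)
  then show ?thesis using \<open>a > 0\<close> k_pos by (simp add: g_def)
qed

text \<open>For \<open>l < 0\<close> the energy \<open>E = - l / k * x powr - \<gamma> * g\<^sup>2 + J\<^sup>2\<close> is eventually nondecreasing while \<open>J\<close> tends
  to \<open>0\<close>; unless \<open>E\<close> vanishes, \<open>g\<close> stays too large for \<open>p\<close> to be integrable.\<close>

lemma integrable_sol_zero:
  assumes s: "sol l p p'" and p: "integrable leb_pos p" and l: "l \<le> 0" and "x > 0"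
  shows "p x = 0"
proof -
  have pc: "continuous_on {0<..} p" by (rule sol_cont[OF s])
  define g where "g x = k * x powr \<gamma> * p x" for x
  define J where "J = flux p p'"
  have gd: "(g has_real_derivative \<mu> * x * p x + J x) (at x)" if "x > 0" for x
    unfolding g_def J_def by (rule flux_deriv(2)[OF s that])
  have Jd: "(J has_real_derivative l * p x) (at x)" if "x > 0" for x
    unfolding J_def by (rule flux_deriv(1)[OF s that])
  have px: "p x = x powr (- \<gamma>) / k * g x" if "x > 0" for x
    using that k_pos by (simp add: g_def powr_minus)
  \<comment> \<open>\<open>J\<close> is a primitive of \<open>l p\<close>, so integrability of
    \<open>p\<close> makes it converge at infinity.\<close>
  have "((\<lambda>x. J x + l * tail_integral p x) has_real_derivative 0) (at x)" if "x > 0" for x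
    using that by (auto intro!: derivative_eq_intros Jd tail_integral_has_derivative[OF p pc])
  then have "\<exists>c. \<forall>x\<in>{0<..}. J x + l * tail_integral p x = c"
    by (intro has_field_derivative_zero_constant) (auto intro: has_field_derivative_at_within)
  then obtain c where c: "\<And>x. x > 0 \<Longrightarrow> J x = c - l * tail_integral p x"
    by (metis add_diff_cancel_right' greaterThan_iff)
  have "((\<lambda>x. c - l * tail_integral p x) \<longlongrightarrow> c - l * 0) at_top"
    by (intro tendsto_intros tail_integral_at_top p)
  then have "((\<lambda>x. c - l * tail_integral p x) \<longlongrightarrow> c) at_top" by simp
  moreover have "\<forall>\<^sub>F x in at_top. c - l * tail_integral p x = J x"
    by (rule eventually_mono[OF eventually_gt_at_top[of 0]]) (simp add: c)
  ultimately have Jlim: "(J \<longlongrightarrow> c) at_top" by (rule Lim_transform_eventually)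
  have "\<not> c > 0" using flux_limit_not_pos[OF s p] Jlim unfolding J_def by blast
  moreover have "\<not> c < 0"
  proof
    assume "c < 0"
    \<comment> \<open>A negative limit of the flux is a positive one for \<open>- p\<close>.\<close>
    have "sol l (\<lambda>x. - p x) (\<lambda>x. - p' x)"
      unfolding sol_def
    proof (intro allI impI conjI)
      fix x :: real assume "x > 0"
      show "((\<lambda>x. - p x) has_real_derivative - p' x) (at x)"
        by (rule DERIV_minus[OF solD(1)[OF s \<open>x > 0\<close>]])
      show "((\<lambda>t. Q2 t * - p' t) has_real_derivative (l * W x - Q0 x) * - p x) (at x)"
        using DERIV_minus[OF solD(2)[OF s \<open>x > 0\<close>]] by simp
    qed
    moreover have "integrable leb_pos (\<lambda>x. - p x)" using p by simp
    moreover have "flux (\<lambda>x. - p x) (\<lambda>x. - p' x) = (\<lambda>x. - J x)"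
      by (auto simp: flux_def J_def algebra_simps)
    then have "(flux (\<lambda>x. - p x) (\<lambda>x. - p' x) \<longlongrightarrow> - c) at_top" using tendsto_minus[OF Jlim] by simp
    moreover have "- c > 0" using \<open>c < 0\<close> by simp
    ultimately show False by (rule flux_limit_not_pos)
  qed
  ultimately have c0: "c = 0" by simp
  \<comment> \<open>As \<open>\<gamma> < 1\<close>, a lower bound for
    \<open>x powr \<gamma> * \<bar>p\<bar>\<close> makes \<open>\<bar>p\<bar>\<close> at least a
    multiple of \<open>1 / x\<close>.\<close>
  have notlarge: False if "e > 0" "\<And>x. x \<ge> X \<Longrightarrow> e \<le> x powr \<gamma> * \<bar>p x\<bar>" for e X
  proof (rule not_integrable_leb_pos_inverse[OF p \<open>e > 0\<close>, of "max X 1"])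
    fix x assume x: "max X 1 \<le> x"
    have "x powr \<gamma> \<le> x powr 1" using x gam by (intro powr_mono) auto
    then have "x powr \<gamma> * \<bar>p x\<bar> \<le> x * \<bar>p x\<bar>" using x by (intro mult_right_mono) auto
    then show "e / x \<le> \<bar>p x\<bar>" using that(2)[of x] x by (simp add: field_simps)
  qed
  have "\<exists>X>0. \<forall>x\<ge>X. p x = 0 \<and> J x = 0"
  proof (cases "l = 0")
    case True
    then have J0: "J x = 0" if "x > 0" for x using c[OF that] c0 by simp
    have "g x = 0" if "x \<ge> 1" for x
    proof (rule ccontr)
      assume "g x \<noteq> 0"
      \<comment> \<open>With zero flux \<open>g' = \<mu> x p\<close> has the sign of
        \<open>g\<close>, so \<open>g ^ 2\<close> cannot decrease.\<close>
      have ge: "(g x)\<^sup>2 \<le> (g t)\<^sup>2" if "t \<ge> x" for t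
      proof (rule DERIV_nonneg_imp_nondecreasing[OF that])
        fix y assume "x \<le> y"
        then have y: "y > 0" using \<open>x \<ge> 1\<close> by simp
        have "((\<lambda>x. (g x)\<^sup>2) has_real_derivative 2 * g y * (\<mu> * y * p y + J y)) (at y)"
          using y by (auto intro!: derivative_eq_intros gd)
        moreover have "2 * g y * (\<mu> * y * p y + J y) = 2 * \<mu> * y * (y powr (- \<gamma>) / k) * (g y)\<^sup>2"
          using J0[OF y] by (simp add: px[OF y] power2_eq_square)
        moreover have "\<dots> \<ge> 0" using mu y k_pos by simp
        ultimately show "\<exists>d. ((\<lambda>x. (g x)\<^sup>2) has_real_derivative d) (at y) \<and> 0 \<le> d" by metis
      qed
      show False
      proof (rule notlarge[of "\<bar>g x\<bar> / k" x])
        show "0 < \<bar>g x\<bar> / k" using \<open>g x \<noteq> 0\<close> k_pos by simp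
        fix t assume "t \<ge> x"
        then have "\<bar>g x\<bar> \<le> \<bar>g t\<bar>" using ge[of t] by (simp add: abs_le_square_iff)
        also have "\<dots> = k * (t powr \<gamma> * \<bar>p t\<bar>)" using k_pos by (simp add: g_def abs_mult)
        finally show "\<bar>g x\<bar> / k \<le> t powr \<gamma> * \<bar>p t\<bar>" using k_pos by (simp add: field_simps)
      qed
    qed
    then show ?thesis using px J0 by (intro exI[of _ 1]) auto
  next
    case False
    then have l: "l < 0" using l by simp
    define E where "E x = (- l) / k * (x powr (- \<gamma>) * (g x)\<^sup>2) + (J x)\<^sup>2" for x
    \<comment> \<open>For \<open>x \<ge> 1\<close> one has
      \<open>x * x powr (- \<gamma>) \<ge> 1\<close>, so beyond \<open>X\<close> the growth caused
      by the drift outweighs the loss \<open>\<gamma> / x\<close> from the factor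
      \<open>x powr (- \<gamma>)\<close> in \<open>E\<close>.\<close>
    define X where "X = max 1 (\<gamma> * k / (2 * \<mu>))"
    have X: "X \<ge> 1" "X \<ge> \<gamma> * k / (2 * \<mu>)" by (auto simp: X_def)
    have mono: "E s \<le> E t" if "X \<le> s" "s \<le> t" for s t
    proof (rule DERIV_nonneg_imp_nondecreasing[OF that(2)])
      fix x assume x: "s \<le> x" "x \<le> t"
      have x1: "x \<ge> 1" and xX: "x \<ge> X" using x that X by auto
      then have x0: "x > 0" by simp
      let ?d = "(- l) / k * ((- \<gamma> * x powr (- \<gamma> - 1)) * (g x)\<^sup>2 + 2 * g x * (\<mu> * x * p x + J x) * x powr (- \<gamma>)) + 2 * J x * (l * p x)"
      have "((\<lambda>x. x powr (- \<gamma>) * (g x)\<^sup>2) has_real_derivative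
         (- \<gamma> * x powr (- \<gamma> - 1)) * (g x)\<^sup>2 + 2 * g x * (\<mu> * x * p x + J x) * x powr (- \<gamma>)) (at x)"
        using x0 by (auto intro!: derivative_eq_intros gd simp: mult_ac)
      moreover have "((\<lambda>x. (J x)\<^sup>2) has_real_derivative 2 * J x * (l * p x)) (at x)"
        using x0 by (auto intro!: derivative_eq_intros Jd)
      ultimately have "(E has_real_derivative ?d) (at x)"
        unfolding E_def by (intro DERIV_add DERIV_cmult)
      \<comment> \<open>The mixed terms in \<open>g\<close> and \<open>J\<close> cancel since
        \<open>p = x powr (- \<gamma>) / k * g\<close>; this dictates the weight of
        \<open>g ^ 2\<close> in \<open>E\<close>.\<close>
      moreover have "?d = (- l) / k * (x powr (- \<gamma>) * (g x)\<^sup>2) * (2 * \<mu> / k * (x * x powr (- \<gamma>)) - \<gamma> / x)"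
        using x0 k_pos by (simp add: px[OF x0] powr_diff power2_eq_square field_simps)
      moreover have "2 * \<mu> / k * (x * x powr (- \<gamma>)) - \<gamma> / x \<ge> 0"
      proof -
        have "x powr (- \<gamma>) \<ge> x powr (- 1)" using x1 gam by (intro powr_mono) auto
        then have "x * x powr (- \<gamma>) \<ge> x * x powr (- 1)" using x0 by (intro mult_left_mono) auto
        then have "1 \<le> x * x powr (- \<gamma>)" using x0 by (simp add: powr_minus)
        then have "2 * \<mu> / k * 1 \<le> 2 * \<mu> / k * (x * x powr (- \<gamma>))" using mu k_pos by (intro mult_left_mono) auto
        moreover have "\<gamma> * k / (2 * \<mu>) \<le> x" using xX X by simp
        then have "\<gamma> / x \<le> 2 * \<mu> / k" using mu k_pos x0 by (simp add: field_simps)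
        ultimately show ?thesis by simp
      qed
      ultimately show "\<exists>d. (E has_real_derivative d) (at x) \<and> 0 \<le> d"
        using l k_pos by (intro exI[of _ ?d]) (simp add: divide_nonpos_pos mult_nonpos_nonneg)
    qed
    have E0: "E x = 0" if x: "x \<ge> X" for x
    proof (rule ccontr)
      assume "E x \<noteq> 0"
      moreover have "E x \<ge> 0" unfolding E_def using l k_pos by (intro add_nonneg_nonneg mult_nonneg_nonneg) (auto simp: divide_nonpos_pos)
      ultimately have pos: "E x > 0" by simp
      have J2: "((\<lambda>x. (J x)\<^sup>2) \<longlongrightarrow> c\<^sup>2) at_top" by (intro tendsto_intros Jlim)
      then have "\<forall>\<^sub>F t in at_top. (J t)\<^sup>2 < E x / 2" using order_tendstoD(2)[OF J2, of "E x / 2"] pos c0 by simp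
      then obtain Y where Y: "\<And>t. t \<ge> Y \<Longrightarrow> (J t)\<^sup>2 < E x / 2" unfolding eventually_at_top_linorder by blast
      define m where "m = (- l) * k"
      have m: "m > 0" using l k_pos unfolding m_def by (intro mult_pos_pos) auto
      define e where "e = sqrt (E x / 2 / m)"
      have e: "e > 0" using pos m by (simp add: e_def)
      show False
      proof (rule notlarge[of e "max (max x Y) 1", OF e])
        fix t assume t: "max (max x Y) 1 \<le> t"
        then have t1: "t \<ge> 1" by simp
        have "E x \<le> E t" using mono[of x t] x t by simp
        also have "\<dots> \<le> (- l) / k * (t powr (- \<gamma>) * (g t)\<^sup>2) + E x / 2"
          unfolding E_def[of t] using Y[of t] t by simp
        finally have "E x / 2 \<le> (- l) / k * (t powr (- \<gamma>) * (g t)\<^sup>2)" by linarith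
        also have "\<dots> = (- l) * k * (t powr \<gamma> * (p t)\<^sup>2)"
          using t1 k_pos by (simp add: g_def power_mult_distrib powr_minus power2_eq_square field_simps)
        also have "\<dots> \<le> (- l) * k * (t powr \<gamma> * t powr \<gamma> * (p t)\<^sup>2)"
        proof -
          have "1 \<le> t powr \<gamma>" using t1 gam by (simp add: ge_one_powr_ge_zero)
          then have "t powr \<gamma> * 1 \<le> t powr \<gamma> * t powr \<gamma>" by (intro mult_left_mono) auto
          then have "t powr \<gamma> * (p t)\<^sup>2 \<le> t powr \<gamma> * t powr \<gamma> * (p t)\<^sup>2" by (intro mult_right_mono) auto
          then show ?thesis using l k_pos by (intro mult_left_mono) (auto simp: mult_nonpos_nonneg)
        qed
        also have "\<dots> = (- l) * k * (t powr \<gamma> * \<bar>p t\<bar>)\<^sup>2" by (simp add: power_mult_distrib power2_eq_square)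
        finally have "E x / 2 / m \<le> (t powr \<gamma> * \<bar>p t\<bar>)\<^sup>2"
          unfolding m_def[symmetric] using m by (simp add: pos_divide_le_eq mult.commute)
        then have "e \<le> sqrt ((t powr \<gamma> * \<bar>p t\<bar>)\<^sup>2)" unfolding e_def by (rule real_sqrt_le_mono)
        then show "e \<le> t powr \<gamma> * \<bar>p t\<bar>" by simp
      qed
    qed
    have "p x = 0 \<and> J x = 0" if x: "x \<ge> X" for x
    proof -
      have x0: "x > 0" using x X by simp
      have nn: "(- l) / k * (x powr (- \<gamma>) * (g x)\<^sup>2) \<ge> 0" using l k_pos by (intro mult_nonneg_nonneg) (auto simp: divide_nonpos_pos)
      then have "(J x)\<^sup>2 \<le> 0" "(- l) / k * (x powr (- \<gamma>) * (g x)\<^sup>2) \<le> 0"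
        using E0[OF x] zero_le_power2[of "J x"] unfolding E_def by linarith+
      then have "J x = 0" "(- l) / k * (x powr (- \<gamma>) * (g x)\<^sup>2) = 0" using nn by auto
      then show ?thesis using x0 k_pos l px[OF x0] by simp
    qed
    then show ?thesis using X by (intro exI[of _ X]) auto
  qed
  then obtain X where X: "X > 0" "\<And>x. x \<ge> X \<Longrightarrow> p x = 0 \<and> J x = 0" by blast
  show ?thesis
    by (rule sol_zero_backward[OF s \<open>x > 0\<close>, of "max x X"]) (use X in \<open>auto simp: J_def\<close>)
qed

end

subsection \<open>The resolvent\<close>

lemma has_integral_antiderivative:
  fixes g G :: "real \<Rightarrow> real"
  assumes "\<And>x. x > 0 \<Longrightarrow> (G has_real_derivative g x) (at x)" "0 < a" "a \<le> b"
  shows "(g has_integral G b - G a) {a..b}"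
  by (rule fundamental_theorem_of_calculus[OF assms(3)])
     (use assms in \<open>auto simp: has_real_derivative_iff_has_vector_derivative[symmetric] intro: has_field_derivative_at_within\<close>)

text \<open>Monotone convergence along the intervals from \<open>1 / Suc m\<close> to
  \<open>Suc m\<close>. Square integrability of the solution constructed for the resolvent and its
  norm bound come out together.\<close>

lemma integrable_leb_pos_bounded_primitive:
  fixes g P :: "real \<Rightarrow> real"
  assumes g: "\<And>x. x > 0 \<Longrightarrow> g x \<ge> 0"
    and P: "\<And>x. x > 0 \<Longrightarrow> (P has_real_derivative g x) (at x)"
    and le: "\<And>a b. 0 < a \<Longrightarrow> a \<le> b \<Longrightarrow> P b - P a \<le> K"
  shows "integrable leb_pos g" "(LINT x|leb_pos. g x) \<le> K"
proof -
  define f where "f m x = (if x \<in> {1 / real (Suc m)..real (Suc m)} then g x else 0)" for m x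
  have sub: "{1 / real (Suc m)..real (Suc m)} \<subseteq> {0<..}" for m
    by (auto intro: less_le_trans[of 0 "1 / real (Suc m)"] simp del: of_nat_Suc)
  have f: "(f m has_integral P (real (Suc m)) - P (1 / real (Suc m))) {0<..}" for m
  proof -
    have "1 / real (Suc m) \<le> 1" "1 \<le> real (Suc m)" by simp_all
    then have "1 / real (Suc m) \<le> real (Suc m)" by (rule order_trans)
    then have "(g has_integral P (real (Suc m)) - P (1 / real (Suc m))) {1 / real (Suc m)..real (Suc m)}"
      by (intro has_integral_antiderivative P) (auto simp del: of_nat_Suc)
    then show ?thesis
      unfolding f_def using sub[of m] by (subst has_integral_restrict) auto
  qed
  have fle: "f m x \<le> f (Suc m) x" if "x \<in> {0<..}" for m x
  proof -
    have "1 / real (Suc (Suc m)) \<le> 1 / real (Suc m)" by (intro divide_left_mono) auto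
    then have "{1 / real (Suc m)..real (Suc m)} \<subseteq> {1 / real (Suc (Suc m))..real (Suc (Suc m))}" by auto
    then show ?thesis using g[of x] that unfolding f_def by auto
  qed
  have flim: "(\<lambda>m. f m x) \<longlonglongrightarrow> g x" if "x \<in> {0<..}" for x
  proof (rule tendsto_eventually)
    have "0 < x" using that by simp
    then obtain m1 where m1: "1 / real (Suc m1) < x" by (rule nat_approx_posE)
    obtain m2 where m2: "x < real m2" using reals_Archimedean2 by blast
    show "\<forall>\<^sub>F m in sequentially. f m x = g x"
    proof (rule eventually_sequentiallyI[of "max m1 m2"])
      fix m assume m: "max m1 m2 \<le> m"
      have "1 / real (Suc m) \<le> 1 / real (Suc m1)" using m by (intro divide_left_mono) auto
      moreover have "real m2 \<le> real (Suc m)" using m by simp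
      ultimately have "x \<in> {1 / real (Suc m)..real (Suc m)}" using m1 m2 by auto
      then show "f m x = g x" unfolding f_def by simp
    qed
  qed
  have bnd: "0 \<le> integral {0<..} (f m) \<and> integral {0<..} (f m) \<le> K" for m
  proof
    show "0 \<le> integral {0<..} (f m)"
      by (rule integral_nonneg) (use f g in \<open>auto simp: f_def\<close>)
    have "1 / real (Suc m) \<le> 1" "1 \<le> real (Suc m)" by simp_all
    then have "1 / real (Suc m) \<le> real (Suc m)" by (rule order_trans)
    then show "integral {0<..} (f m) \<le> K"
      unfolding integral_unique[OF f] by (intro le) (auto simp del: of_nat_Suc)
  qed
  have mc: "g integrable_on {0<..} \<and> (\<lambda>m. integral {0<..} (f m)) \<longlonglongrightarrow> integral {0<..} g"
  proof (rule monotone_convergence_increasing)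
    show "f m integrable_on {0<..}" for m using f by blast
    show "bounded (range (\<lambda>m. integral {0<..} (f m)))"
      unfolding bounded_iff using bnd by (intro exI[of _ K]) auto
  qed (use fle flim in auto)
  then have "g absolutely_integrable_on {0<..}"
    using g by (intro nonnegative_absolutely_integrable_1) auto
  then show i: "integrable leb_pos g" by (simp add: integrable_leb_pos_iff)
  have "integral {0<..} g \<le> K" by (rule LIMSEQ_le_const2[OF conjunct2[OF mc]]) (use bnd in auto)
  then show "(LINT x|leb_pos. g x) \<le> K" using lebesgue_integral_eq_integral[OF i] by simp
qed

text \<open>A bounded derivative makes \<open>G\<close> Lipschitz near \<open>0\<close>, hence
  uniformly continuous, hence extendable to the end point.\<close>

lemma primitive_limit_at_0:
  fixes g G :: "real \<Rightarrow> real"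
  assumes G: "\<And>x. x > 0 \<Longrightarrow> (G has_real_derivative g x) (at x)"
    and le: "\<And>x. 0 < x \<Longrightarrow> x \<le> 1 \<Longrightarrow> \<bar>g x\<bar> \<le> K"
  obtains c where "(G \<longlongrightarrow> c) (at_right 0)"
proof -
  have K: "K \<ge> 0" using le[of 1] by simp
  have "uniformly_continuous_on {0<..<1} G"
    unfolding uniformly_continuous_on_def
  proof (intro allI impI)
    fix e :: real assume e: "e > 0"
    have lip: "norm (G x - G y) \<le> K * norm (x - y)" if "x \<in> {0<..<1}" "y \<in> {0<..<1}" for x y
      by (rule field_differentiable_bound[of "{0<..<1}" G g])
         (use that G le in \<open>auto intro: has_field_derivative_at_within\<close>)
    show "\<exists>d>0. \<forall>x\<in>{0<..<1}. \<forall>x'\<in>{0<..<1}. dist x' x < d \<longrightarrow> dist (G x') (G x) < e"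
    proof (rule exI[of _ "e / (K + 1)"], intro conjI ballI impI)
      fix x x' :: real assume x: "x \<in> {0<..<1}" "x' \<in> {0<..<1}" "dist x' x < e / (K + 1)"
      have "dist (G x') (G x) \<le> K * dist x' x" using lip[OF x(2,1)] by (simp add: dist_norm)
      also have "\<dots> \<le> (K + 1) * dist x' x" by (intro mult_right_mono) auto
      also have "\<dots> < e" using x(3) K by (simp add: field_simps)
      finally show "dist (G x') (G x) < e" .
    qed (use e K in auto)
  qed
  moreover have "(0::real) \<in> closure {0<..<1}" by simp
  ultimately obtain c where "(G \<longlongrightarrow> c) (at 0 within {0<..<1})"
    using uniformly_continuous_on_extension_at_closure by blast
  moreover have "at 0 within {0<..<1} = at_right (0::real)"
    by (rule at_within_nhd[of _ "{-1<..<1}"]) auto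
  ultimately show thesis using that by simp
qed

lemma (in cev) L2_add:
  assumes f: "f \<in> L2_set_of M" and g: "g \<in> L2_set_of M"
  shows "(\<lambda>x. a * f x + b * g x) \<in> L2_set_of M"
  unfolding L2_iff
proof
  have m: "f \<in> borel_measurable leb_pos" "g \<in> borel_measurable leb_pos"
    and i: "integrable leb_pos (\<lambda>x. W x * (f x)\<^sup>2)" "integrable leb_pos (\<lambda>x. W x * (g x)\<^sup>2)"
    using f g by (auto simp: L2_iff)
  show m': "(\<lambda>x. a * f x + b * g x) \<in> borel_measurable leb_pos" using m by measurable
  have "integrable leb_pos (\<lambda>x. 2 * a\<^sup>2 * (W x * (f x)\<^sup>2) + 2 * b\<^sup>2 * (W x * (g x)\<^sup>2))"
    using i by auto
  then show "integrable leb_pos (\<lambda>x. W x * (a * f x + b * g x)\<^sup>2)"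
  proof (rule Bochner_Integration.integrable_bound)
    show "(\<lambda>x. W x * (a * f x + b * g x)\<^sup>2) \<in> borel_measurable leb_pos" using m' W_measurable by measurable
    show "AE x in leb_pos. norm (W x * (a * f x + b * g x)\<^sup>2) \<le> norm (2 * a\<^sup>2 * (W x * (f x)\<^sup>2) + 2 * b\<^sup>2 * (W x * (g x)\<^sup>2))"
    proof (rule AE_leb_pos_I)
      fix x :: real assume x: "x > 0"
      have "(a * f x + b * g x)\<^sup>2 \<le> 2 * (a * f x)\<^sup>2 + 2 * (b * g x)\<^sup>2"
        using zero_le_power2[of "a * f x - b * g x"] by (simp add: power2_eq_square algebra_simps)
      then have "W x * (a * f x + b * g x)\<^sup>2 \<le> W x * (2 * (a * f x)\<^sup>2 + 2 * (b * g x)\<^sup>2)"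
        using W_pos[OF x] by (intro mult_left_mono) auto
      also have "\<dots> = 2 * a\<^sup>2 * (W x * (f x)\<^sup>2) + 2 * b\<^sup>2 * (W x * (g x)\<^sup>2)"
        by (simp add: power_mult_distrib algebra_simps)
      finally show "norm (W x * (a * f x + b * g x)\<^sup>2) \<le> norm (2 * a\<^sup>2 * (W x * (f x)\<^sup>2) + 2 * b\<^sup>2 * (W x * (g x)\<^sup>2))"
        using W_pos[OF x] by simp
    qed
  qed
qed

text \<open>A positive solution \<open>u\<close> that decays at infinity; \<open>b0\<close> and \<open>i0\<close> are its two boundary values at \<open>0\<close>.\<close>

locale cev_sol = cev +
  fixes l :: real and u u' :: "real \<Rightarrow> real" and Cu \<rho> \<alpha> b0 i0 :: real
  assumes usol: "sol l u u'" and upos: "\<And>x. x > 0 \<Longrightarrow> u x > 0"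
    and ulog: "\<And>x. x > 0 \<Longrightarrow> x * u' x \<le> (1 - \<gamma>) * u x"
    and u_inf: "\<And>x. x \<ge> 1 \<Longrightarrow> u x \<le> Cu * x powr (- \<rho>)" "\<rho> > 1"
    and u_zero: "((\<lambda>x. x powr \<gamma> * u x) \<longlongrightarrow> \<alpha>) (at_right 0)" "\<alpha> > 0"
    and u_fin: "((\<lambda>x. cev_bdry_fin \<gamma> u x) \<longlongrightarrow> b0) (at_right 0)"
    and u_binf: "((\<lambda>x. cev_bdry_inf \<gamma> u x) \<longlongrightarrow> i0) (at_right 0)" "i0 \<noteq> 0"
begin

lemma u_cont: "continuous_on {0<..} u" "continuous_on {0<..} u'"
  using sol_cont[OF usol] by auto

section \<open>Bounds for the decaying solution and the tails of its norm\<close>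

lemma u_zero_bounds:
  obtains c C where "c > 0" "C > 0" "\<And>x. 0 < x \<Longrightarrow> x \<le> 1 \<Longrightarrow> c * x powr (- \<gamma>) \<le> u x \<and> u x \<le> C * x powr (- \<gamma>)"
proof -
  \<comment> \<open>Inversion moves the behaviour at \<open>0\<close> to infinity, where the
    compactness bound is available.\<close>
  define f where "f s = inverse s powr \<gamma> * u (inverse s)" for s
  have "(f \<longlongrightarrow> \<alpha>) at_top"
    using u_zero(1) unfolding f_def filterlim_at_right_to_top by simp
  moreover have "continuous_on {0<..} f"
    unfolding f_def by (intro continuous_intros continuous_on_compose2[OF u_cont(1)]) auto
  moreover have "f s > 0" if "s > 0" for s using upos[of "inverse s"] that by (simp add: f_def)
  ultimately obtain c C where cC: "c > 0" "C > 0" "\<And>s. s \<ge> 1 \<Longrightarrow> c \<le> f s \<and> f s \<le> C"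
    using continuous_pos_limit_bounds[of f \<alpha> 1] u_zero(2) by auto
  show thesis
  proof (rule that[OF cC(1,2)])
    fix x :: real assume x: "0 < x" "x \<le> 1"
    have "inverse x \<ge> 1" using x by (simp add: one_le_inverse_iff)
    then have "c \<le> x powr \<gamma> * u x" "x powr \<gamma> * u x \<le> C" using cC(3)[of "inverse x"] by (auto simp: f_def)
    then show "c * x powr (- \<gamma>) \<le> u x \<and> u x \<le> C * x powr (- \<gamma>)"
      using x by (simp add: powr_minus field_simps)
  qed
qed

lemma u_integrable: "integrable leb_pos u"
proof -
  obtain c C where cC: "c > 0" "C > 0" "\<And>x. 0 < x \<Longrightarrow> x \<le> 1 \<Longrightarrow> c * x powr (- \<gamma>) \<le> u x \<and> u x \<le> C * x powr (- \<gamma>)"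
    using u_zero_bounds by blast
  show ?thesis
    by (rule integrable_leb_pos_powr_bounds[OF u_cont(1), where C = C and b = \<gamma> and X = 1 and C' = Cu and d = \<rho>])
       (use cC upos u_inf gam in \<open>auto simp: less_imp_le abs_of_pos\<close>)
qed

text \<open>The density of the squared norm of \<open>u\<close>; a function \<open>u * R\<close> has
  density \<open>v * R ^ 2\<close>.\<close>

definition v :: "real \<Rightarrow> real" where "v x = W x * (u x)\<^sup>2"

lemma v_cont: "continuous_on {0<..} v"
  unfolding v_def[abs_def] by (intro continuous_intros W_cont u_cont)

lemma v_pos: "x > 0 \<Longrightarrow> v x > 0"
  using W_pos[of x] upos[of x] by (simp add: v_def)

lemma v_integrable: "integrable leb_pos v"
proof -
  obtain c C where cC: "c > 0" "C > 0" "\<And>x. 0 < x \<Longrightarrow> x \<le> 1 \<Longrightarrow> c * x powr (- \<gamma>) \<le> u x \<and> u x \<le> C * x powr (- \<gamma>)"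
    using u_zero_bounds by blast
  \<comment> \<open>One estimate for both ends: \<open>r = - \<gamma>\<close> near \<open>0\<close>,
    where \<open>\<gamma> < 1\<close> gives integrability, and \<open>r = - \<rho>\<close> at
    infinity, where \<open>\<rho> > 1\<close> does.\<close>
  have bd: "\<bar>v x\<bar> \<le> D\<^sup>2 * x powr (\<gamma> + 2 * r)" if "x > 0" "u x \<le> D * x powr r" for x D r
  proof -
    have "\<bar>v x\<bar> = v x" using v_pos[OF that(1)] by simp
    also have "\<dots> \<le> x powr \<gamma> * (D * x powr r)\<^sup>2"
      unfolding v_def using that upos[OF that(1)] W_le[OF that(1)] W_pos[OF that(1)] by (intro mult_mono power_mono) auto
    also have "\<dots> = D\<^sup>2 * x powr (\<gamma> + 2 * r)"
      using that by (simp add: power_mult_distrib powr_add power2_eq_square flip: powr_add)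
    finally show ?thesis .
  qed
  show ?thesis
  proof (rule integrable_leb_pos_powr_bounds[OF v_cont])
    fix x :: real assume "0 < x" "x \<le> 1"
    then show "\<bar>v x\<bar> \<le> C\<^sup>2 * x powr (- \<gamma>)" using bd[of x C "- \<gamma>"] cC by simp
  next
    fix x :: real assume "x \<ge> 1"
    then show "\<bar>v x\<bar> \<le> Cu\<^sup>2 * x powr (- (2 * \<rho> - \<gamma>))"
      using bd[of x "Cu" "- \<rho>"] u_inf(1)[of x] by (simp add: algebra_simps)
  qed (use gam u_inf(2) in auto)
qed

abbreviation "T \<equiv> tail_integral v"
definition "T0 = integral\<^sup>L leb_pos v"

lemma T_deriv: "x > 0 \<Longrightarrow> (T has_real_derivative - v x) (at x)"
  by (rule tail_integral_has_derivative[OF v_integrable v_cont])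

lemma T_nonneg: "T x \<ge> 0"
  unfolding tail_integral_def
  by (intro Bochner_Integration.integral_nonneg_AE AE_leb_pos_I) (simp add: less_imp_le v_pos)

lemma T_le: "T x \<le> T0"
  unfolding tail_integral_def T0_def
  by (rule integral_mono_AE[OF integrable_indicator_leb_pos[OF v_integrable] v_integrable])
     (auto intro!: AE_leb_pos_I simp: indicator_def less_imp_le[OF v_pos])

text \<open>Since \<open>x u' \<le> (1 - \<gamma>) u\<close>, the function \<open>x powr (\<gamma> - 1) * v\<close> decays at least at the rate \<open>v\<close> coming
  from the exponential in the weight.\<close>

lemma T_upper:
  obtains X where "X \<ge> 1" "\<And>x. x \<ge> X \<Longrightarrow> T x \<le> 2 / (n * (2 - \<gamma>)) * (x powr (\<gamma> - 1) * v x)"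
proof -
  define c where "c = n * (2 - \<gamma>)"
  have c: "c > 0" using n_pos gam by (simp add: c_def)
  \<comment> \<open>Beyond \<open>X\<close> one has \<open>1 / x \<le> c / 2\<close>, so the power
    terms use up at most half of the decay rate \<open>c\<close>.\<close>
  define X where "X = max 1 (2 / c)"
  have X: "X \<ge> 1" "X \<ge> 2 / c" by (auto simp: X_def)
  define \<Phi> where "\<Phi> x = T x - 2 / c * (x powr (\<gamma> - 1) * v x)" for x
  have mono: "\<Phi> s \<le> \<Phi> t" if "X \<le> s" "s \<le> t" for s t
  proof (rule DERIV_nonneg_imp_nondecreasing[OF that(2)])
    fix x assume "s \<le> x"
    then have x1: "x \<ge> 1" "x \<ge> 2 / c" using that X by auto
    then have x: "x > 0" by simp
    let ?w = "\<gamma> / x - n * (2 - \<gamma>) * x powr (1 - \<gamma>)"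
    let ?d = "(\<gamma> - 1) * x powr (\<gamma> - 2) * v x + x powr (\<gamma> - 1) * (W x * ?w * (u x)\<^sup>2 + W x * (2 * u x * u' x))"
    have d1: "((\<lambda>x. x powr (\<gamma> - 1)) has_real_derivative (\<gamma> - 1) * x powr (\<gamma> - 2)) (at x)"
      using x by (auto intro!: derivative_eq_intros)
    have d2: "(v has_real_derivative W x * ?w * (u x)\<^sup>2 + W x * (2 * u x * u' x)) (at x)"
      unfolding v_def[abs_def] using x by (auto intro!: derivative_eq_intros W_deriv solD(1)[OF usol])
    have "((\<lambda>x. x powr (\<gamma> - 1) * v x) has_real_derivative ?d) (at x)"
      using DERIV_mult[OF d1 d2] by (simp add: mult.commute)
    then have "(\<Phi> has_real_derivative - v x - 2 / c * ?d) (at x)"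
      unfolding \<Phi>_def by (intro DERIV_diff DERIV_cmult T_deriv x)
    moreover have "?d \<le> - (c / 2) * v x"
    proof -
      have uu: "2 * u x * u' x \<le> 2 * (1 - \<gamma>) / x * (u x)\<^sup>2"
      proof -
        have "u' x \<le> (1 - \<gamma>) * u x / x" using ulog[OF x] x by (simp add: field_simps)
        then have "2 * u x * u' x \<le> 2 * u x * ((1 - \<gamma>) * u x / x)" using upos[OF x] by (intro mult_left_mono) auto
        then show ?thesis by (simp add: power2_eq_square mult_ac)
      qed
      have e: "x powr (\<gamma> - 2) = x powr (\<gamma> - 1) / x" using x powr_diff[of x "\<gamma> - 1" 1] by simp
      have e2: "x powr (\<gamma> - 1) * x powr (1 - \<gamma>) = 1" using x by (simp flip: powr_add)
      have wle: "W x * (2 * u x * u' x) \<le> W x * (2 * (1 - \<gamma>) / x * (u x)\<^sup>2)"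
        using uu W_pos[OF x] by (intro mult_left_mono) auto
      have "?d \<le> (\<gamma> - 1) * x powr (\<gamma> - 2) * v x + x powr (\<gamma> - 1) * (W x * ?w * (u x)\<^sup>2 + W x * (2 * (1 - \<gamma>) / x * (u x)\<^sup>2))"
        by (rule add_left_mono[OF mult_left_mono[OF add_left_mono[OF wle] powr_ge_zero]])
      \<comment> \<open>The power terms combine to a single \<open>1 / x\<close>, because
        \<open>(\<gamma> - 1) + \<gamma> + 2 * (1 - \<gamma>) = 1\<close>.\<close>
      also have "\<dots> = v x * (x powr (\<gamma> - 1) / x - c * (x powr (\<gamma> - 1) * x powr (1 - \<gamma>)))"
        using x unfolding e c_def v_def by (simp add: algebra_simps add_divide_distrib diff_divide_distrib)
      also have "\<dots> \<le> v x * (c / 2 - c)"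
      proof -
        have "x powr (\<gamma> - 1) \<le> x powr 0" using x1 gam by (intro powr_mono) auto
        then have "x powr (\<gamma> - 1) / x \<le> 1 / x" using x by (intro divide_right_mono) auto
        also have "1 / x \<le> c / 2" using x1 c x by (simp add: field_simps)
        finally have "x powr (\<gamma> - 1) / x - c * 1 \<le> c / 2 - c" by linarith
        then show ?thesis unfolding e2 using v_pos[OF x] by (intro mult_left_mono) auto
      qed
      finally show ?thesis by (simp add: algebra_simps)
    qed
    then have "2 / c * ?d \<le> 2 / c * (- (c / 2) * v x)" using c by (intro mult_left_mono) auto
    then have "0 \<le> - v x - 2 / c * ?d" using c by simp
    ultimately show "\<exists>y. (\<Phi> has_real_derivative y) (at x) \<and> 0 \<le> y" by blast
  qed
  have "\<Phi> x \<le> 0" if x: "x \<ge> X" for x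
  proof (rule tendsto_lowerbound[OF tail_integral_at_top[OF v_integrable]])
    show "\<forall>\<^sub>F t in at_top. \<Phi> x \<le> T t"
    proof (rule eventually_mono[OF eventually_ge_at_top[of x]])
      fix t assume t: "x \<le> t"
      have "0 \<le> 2 / c * (t powr (\<gamma> - 1) * v t)" using c v_pos[of t] t x X(1) by (intro mult_nonneg_nonneg) auto
      then show "\<Phi> x \<le> T t" using mono[OF x t] by (simp add: \<Phi>_def)
    qed
  qed simp
  then show thesis using that[OF X(1)] by (simp add: \<Phi>_def c_def)
qed

text \<open>\<open>D\<close> is the derivative of the ratio of a second solution to \<open>u\<close>. The integrand \<open>\<Theta>\<close> is chosen so that for
  \<open>p = u R\<close>, \<open>R' = B D\<close> with \<open>B\<^sup>2 \<le> T F\<close> one has \<open>W p\<^sup>2 + (2 T R\<^sup>2)' \<le> 4 F \<Theta>\<close>, which bounds the norm of \<open>p\<close>.\<close>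

definition "D x = 1 / (Q2 x * (u x)\<^sup>2)"
definition "\<Theta> x = T x ^ 3 * (D x)\<^sup>2 / v x"

lemma D_pos: "x > 0 \<Longrightarrow> D x > 0"
  using Q2_pos[of x] upos[of x] by (simp add: D_def)

lemma D_cont: "continuous_on {0<..} D"
  unfolding D_def using Q2_pos upos by (intro continuous_intros Q2_cont u_cont) force

lemma D_eq: "x > 0 \<Longrightarrow> D x = 1 / (k * x powr \<gamma> * v x)"
  by (simp add: D_def Q2_eq v_def)

lemma \<Theta>_nonneg: "x > 0 \<Longrightarrow> \<Theta> x \<ge> 0"
  unfolding \<Theta>_def using T_nonneg[of x] v_pos[of x] by (intro divide_nonneg_nonneg mult_nonneg_nonneg) (auto intro: less_imp_le)

lemma v_lower:
  obtains c where "c > 0" "\<And>x. 0 < x \<Longrightarrow> x \<le> 1 \<Longrightarrow> c * x powr (- \<gamma>) \<le> v x"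
proof -
  obtain c C where cC: "c > 0" "C > 0" "\<And>x. 0 < x \<Longrightarrow> x \<le> 1 \<Longrightarrow> c * x powr (- \<gamma>) \<le> u x \<and> u x \<le> C * x powr (- \<gamma>)"
    using u_zero_bounds by blast
  show thesis
  proof (rule that[of "exp (- n) * c\<^sup>2"])
    fix x :: real assume x: "0 < x" "x \<le> 1"
    have "x powr (2 - \<gamma>) \<le> 1" using x gam by (intro powr_le1) auto
    then have "exp (- n) \<le> exp (- n * x powr (2 - \<gamma>))" using n_pos by (simp add: mult_left_le)
    then have "x powr \<gamma> * exp (- n) \<le> W x" unfolding W_eq by (intro mult_left_mono) auto
    moreover have "(c * x powr (- \<gamma>))\<^sup>2 \<le> (u x)\<^sup>2" using cC x by (intro power_mono) auto
    ultimately have "(x powr \<gamma> * exp (- n)) * (c * x powr (- \<gamma>))\<^sup>2 \<le> v x"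
      unfolding v_def using W_pos[OF x(1)] by (intro mult_mono) auto
    moreover have "(x powr \<gamma> * exp (- n)) * (c * x powr (- \<gamma>))\<^sup>2 = exp (- n) * c\<^sup>2 * x powr (- \<gamma>)"
      using x by (simp add: power_mult_distrib power2_eq_square powr_minus)
    ultimately show "exp (- n) * c\<^sup>2 * x powr (- \<gamma>) \<le> v x" by simp
  qed (use cC in auto)
qed

text \<open>\<open>x powr \<gamma> * v\<close> is bounded below near \<open>0\<close>. This is what
  later gives the factor \<open>R\<close> in \<open>p = u R\<close> a limit at
  \<open>0\<close>.\<close>

lemma D_bounded:
  obtains K where "\<And>x. 0 < x \<Longrightarrow> x \<le> 1 \<Longrightarrow> D x \<le> K"
proof -
  obtain c where c: "c > 0" "\<And>x. 0 < x \<Longrightarrow> x \<le> 1 \<Longrightarrow> c * x powr (- \<gamma>) \<le> v x" using v_lower by blast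
  have "D x \<le> 1 / (k * c)" if x: "0 < x" "x \<le> 1" for x
  proof -
    have "k * x powr \<gamma> * (c * x powr (- \<gamma>)) \<le> k * x powr \<gamma> * v x" using c(2)[OF x] k_pos by (intro mult_left_mono) auto
    moreover have "k * x powr \<gamma> * (c * x powr (- \<gamma>)) = k * c" using x by (simp add: powr_minus)
    ultimately have "k * c \<le> k * x powr \<gamma> * v x" by simp
    moreover have "k * c > 0" using k_pos c(1) by simp
    ultimately show ?thesis unfolding D_eq[OF x(1)] by (intro frac_le) auto
  qed
  then show thesis by (rule that)
qed

lemma \<Theta>_cont: "continuous_on {0<..} \<Theta>"
proof -
  have "continuous_on {0<..} T"
    by (rule loc_abs_cont_pos_imp_continuous_on[OF tail_integral_abs_cont[OF v_integrable]])
  then show ?thesis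
    unfolding \<Theta>_def[abs_def]
    by (intro continuous_on_divide continuous_on_mult continuous_on_power D_cont v_cont)
       (use v_pos in fastforce)+
qed

text \<open>At infinity each factor \<open>T\<close> is at most a multiple of
  \<open>x powr (\<gamma> - 1) * v\<close>. The three resulting \<open>v\<close> cancel the two in
  \<open>D ^ 2\<close> and the explicit one, leaving \<open>x powr (\<gamma> - 3)\<close>. Near
  \<open>0\<close> both \<open>T\<close> and \<open>D\<close> are bounded and \<open>1 / v\<close>
  is at most a multiple of \<open>x powr \<gamma>\<close>.\<close>

lemma \<Theta>_integrable: "integrable leb_pos \<Theta>"
proof -
  obtain c where c: "c > 0" "\<And>x. 0 < x \<Longrightarrow> x \<le> 1 \<Longrightarrow> c * x powr (- \<gamma>) \<le> v x" using v_lower by blast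
  obtain K where K: "\<And>x. 0 < x \<Longrightarrow> x \<le> 1 \<Longrightarrow> D x \<le> K" using D_bounded by blast
  obtain X where X: "X \<ge> 1" "\<And>x. x \<ge> X \<Longrightarrow> T x \<le> 2 / (n * (2 - \<gamma>)) * (x powr (\<gamma> - 1) * v x)" using T_upper by blast
  define C where "C = 2 / (n * (2 - \<gamma>))"
  have C: "C > 0" using n_pos gam by (simp add: C_def)
  show ?thesis
  proof (rule integrable_leb_pos_powr_bounds[OF \<Theta>_cont])
    fix x :: real assume x: "0 < x" "x \<le> 1"
    have "\<Theta> x \<le> T0 ^ 3 * K\<^sup>2 / (c * x powr (- \<gamma>))"
      unfolding \<Theta>_def using T_nonneg[of x] T_le[of x] D_pos[OF x(1)] K[OF x] c(1) c(2)[OF x] x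
      by (intro frac_le mult_mono power_mono) auto
    also have "\<dots> = T0 ^ 3 * K\<^sup>2 / c * x powr (- (- \<gamma>))" using x by (simp add: powr_minus field_simps)
    finally show "\<bar>\<Theta> x\<bar> \<le> T0 ^ 3 * K\<^sup>2 / c * x powr (- (- \<gamma>))" using \<Theta>_nonneg[OF x(1)] by simp
  next
    fix x :: real assume x: "x \<ge> X"
    then have x0: "x > 0" using X(1) by simp
    have "\<Theta> x \<le> (C * (x powr (\<gamma> - 1) * v x)) ^ 3 * (D x)\<^sup>2 / v x"
      unfolding \<Theta>_def using T_nonneg[of x] X(2)[OF x] v_pos[OF x0]
      by (intro divide_right_mono mult_right_mono power_mono) (auto simp: C_def)
    also have "\<dots> = C ^ 3 / k\<^sup>2 * ((x powr (\<gamma> - 1)) ^ 3 / (x powr \<gamma>)\<^sup>2)"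
      unfolding D_eq[OF x0] using v_pos[OF x0] x0 k_pos by (simp add: power_mult_distrib power_divide power2_eq_square power3_eq_cube mult_ac)
    also have "(x powr (\<gamma> - 1)) ^ 3 / (x powr \<gamma>)\<^sup>2 = x powr (- (3 - \<gamma>))"
    proof -
      have "(x powr (\<gamma> - 1)) ^ 3 / (x powr \<gamma>)\<^sup>2 = x powr (3 * (\<gamma> - 1) - 2 * \<gamma>)"
        using x0 powr_power[of x "\<gamma> - 1" 3] powr_power[of x \<gamma> 2] powr_diff[of x "3 * (\<gamma> - 1)" "2 * \<gamma>"]
        by (simp add: mult.commute)
      then show ?thesis by (simp add: algebra_simps)
    qed
    finally show "\<bar>\<Theta> x\<bar> \<le> C ^ 3 / k\<^sup>2 * x powr (- (3 - \<gamma>))" using \<Theta>_nonneg[OF x0] by simp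
  qed (use gam X(1) in auto)
qed

text \<open>\<open>w\<close> is \<open>Q2\<close> times the Wronskian, constant because both
  functions solve the equation with the same \<open>l\<close>.\<close>

lemma ratio_deriv:
  assumes s: "sol l p p'"
  obtains c where "\<And>x. x > 0 \<Longrightarrow> ((\<lambda>x. p x / u x) has_real_derivative c * D x) (at x)"
proof -
  define w where "w x = Q2 x * p' x * u x - Q2 x * u' x * p x" for x
  have "(w has_real_derivative 0) (at x)" if x: "x > 0" for x
  proof -
    have "(w has_real_derivative ((l * W x - Q0 x) * p x * u x + u' x * (Q2 x * p' x)) - ((l * W x - Q0 x) * u x * p x + p' x * (Q2 x * u' x))) (at x)"
      unfolding w_def by (intro DERIV_diff DERIV_mult solD[OF s x] solD[OF usol x])
    then show ?thesis by (simp add: algebra_simps)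
  qed
  then have "\<exists>c. \<forall>x\<in>{0<..}. w x = c"
    by (intro has_field_derivative_zero_constant) (auto intro: has_field_derivative_at_within)
  then obtain c where c: "\<And>x. x > 0 \<Longrightarrow> w x = c" by auto
  have "((\<lambda>x. p x / u x) has_real_derivative c * D x) (at x)" if x: "x > 0" for x
  proof -
    have "((\<lambda>x. p x / u x) has_real_derivative (p' x * u x - p x * u' x) / (u x * u x)) (at x)"
      using upos[OF x] by (intro DERIV_divide solD(1)[OF s x] solD(1)[OF usol x]) auto
    moreover have "(p' x * u x - p x * u' x) / (u x * u x) = w x * D x"
      using Q2_pos[OF x] upos[OF x] by (simp add: w_def D_def power2_eq_square divide_simps) (simp add: algebra_simps)
    ultimately show ?thesis using c[OF x] by simp
  qed
  then show thesis by (rule that)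
qed

text \<open>Limit-point case at infinity: if \<open>r' = c D\<close> with \<open>c \<noteq> 0\<close>, then \<open>v r\<^sup>2\<close> and \<open>D / r\<^sup>2 = (- 1 / (c r))'\<close> have
  product \<open>1 / (k x powr \<gamma>)\<close>, so they cannot both be integrable at infinity.\<close>

lemma L2_sol_multiple:
  assumes s: "sol l p p'" and p: "integrable leb_pos (\<lambda>x. W x * (p x)\<^sup>2)"
  obtains d where "\<And>x. x > 0 \<Longrightarrow> p x = d * u x"
proof -
  obtain c where r: "\<And>x. x > 0 \<Longrightarrow> ((\<lambda>x. p x / u x) has_real_derivative c * D x) (at x)"
    using ratio_deriv[OF s] by blast
  have "c = 0"
  proof (rule ccontr)
    assume c: "c \<noteq> 0"
    \<comment> \<open>Adding \<open>K * u\<close> to \<open>p\<close> keeps it square integrable and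
      gives \<open>R 1 = c\<close>. Since \<open>c * R\<close> has derivative
      \<open>c ^ 2 * D\<close>, it stays positive from \<open>1\<close> on, so
      \<open>1 / (c * R)\<close> is defined there.\<close>
    define K where "K = c - p 1 / u 1"
    define R where "R x = p x / u x + K" for x
    have Rd: "(R has_real_derivative c * D x) (at x)" if "x > 0" for x
      unfolding R_def using DERIV_add[OF r[OF that] DERIV_const] by simp
    have cR: "c * R x > 0" if x: "x \<ge> 1" for x
    proof -
      have "c * R 1 \<le> c * R x"
      proof (rule DERIV_nonneg_imp_nondecreasing[OF x])
        fix t :: real assume "1 \<le> t"
        then have t: "t > 0" by simp
        show "\<exists>y. ((\<lambda>x. c * R x) has_real_derivative y) (at t) \<and> 0 \<le> y"
          using DERIV_cmult[OF Rd[OF t], of c] D_pos[OF t] by (intro exI[of _ "c * (c * D t)"]) (auto simp flip: mult.assoc)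
      qed
      moreover have "c * R 1 = c * c" by (simp add: R_def K_def)
      moreover have "c * c > 0" using c by (simp add: zero_less_mult_iff) linarith
      ultimately show ?thesis by linarith
    qed
    define g where "g x = v x * (R x)\<^sup>2" for x
    have gc: "continuous_on {0<..} g"
      unfolding g_def by (intro continuous_on_mult continuous_on_power v_cont continuous_at_imp_continuous_on ballI)
        (auto intro: DERIV_isCont[OF Rd])
    have gi: "integrable leb_pos g"
    proof -
      have "p \<in> L2_set_of M" "u \<in> L2_set_of M"
        using p v_integrable[unfolded v_def[abs_def]] sol_cont(1)[OF s] u_cont(1) by (auto simp: L2_iff intro: borel_measurable_leb_pos_continuous)
      from L2_add[OF this, of 1 K] have "integrable leb_pos (\<lambda>x. W x * (1 * p x + K * u x)\<^sup>2)" by (simp add: L2_iff)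
      moreover have "integrable leb_pos (\<lambda>x. W x * (1 * p x + K * u x)\<^sup>2) \<longleftrightarrow> integrable leb_pos g"
      proof (rule Bochner_Integration.integrable_cong[OF refl])
        fix x assume "x \<in> space leb_pos"
        then have "u x > 0" using upos by simp
        then show "W x * (1 * p x + K * u x)\<^sup>2 = g x" by (simp add: g_def R_def v_def power_divide power2_eq_square field_simps)
      qed
      ultimately show ?thesis by simp
    qed
    define \<Phi> where "\<Phi> x = - tail_integral g x - 1 / (c * R x)" for x
    have \<Phi>d: "(\<Phi> has_real_derivative g x + D x / (R x)\<^sup>2) (at x)" if x: "x \<ge> 1" for x
    proof -
      have x0: "x > 0" using x by simp
      have "((\<lambda>x. 1 / (c * R x)) has_real_derivative (0 * (c * R x) - 1 * (c * (c * D x))) / ((c * R x) * (c * R x))) (at x)"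
        using cR[OF x] by (intro DERIV_divide DERIV_const DERIV_cmult Rd x0) auto
      moreover have "(0 * (c * R x) - 1 * (c * (c * D x))) / ((c * R x) * (c * R x)) = - (D x / (R x)\<^sup>2)"
        using c cR[OF x] by (simp add: power2_eq_square)
      ultimately have "((\<lambda>x. 1 / (c * R x)) has_real_derivative - (D x / (R x)\<^sup>2)) (at x)" by simp
      from DERIV_diff[OF DERIV_minus[OF tail_integral_has_derivative[OF gi gc x0]] this]
      show ?thesis unfolding \<Phi>_def by simp
    qed
    \<comment> \<open>From \<open>4 a b \<le> (a + b) ^ 2\<close>: the product of the two terms is
      \<open>1 / (k x powr \<gamma>)\<close>, at least \<open>1 / (k x ^ 2)\<close> for
      \<open>x \<ge> 1\<close>, so their sum is at least \<open>2 / (sqrt k * x)\<close>.\<close>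
    define e where "e = 2 / sqrt k"
    have e: "e > 0" using k_pos by (simp add: e_def)
    have lower: "e / x \<le> g x + D x / (R x)\<^sup>2" if x: "x \<ge> 1" for x
    proof -
      have x0: "x > 0" using x by simp
      have R0: "R x \<noteq> 0" using cR[OF x] by auto
      have gpos: "g x \<ge> 0" "D x / (R x)\<^sup>2 \<ge> 0" using v_pos[OF x0] D_pos[OF x0] by (auto simp: g_def intro: less_imp_le)
      have "x powr \<gamma> \<le> x powr 2" using x gam by (intro powr_mono) auto
      then have xg: "x powr \<gamma> \<le> x\<^sup>2" using x0 by (simp add: powr_numeral)
      have "(e / x)\<^sup>2 = 4 / (k * x\<^sup>2)" using k_pos by (simp add: e_def power_divide power_mult_distrib)
      also have "\<dots> \<le> 4 / (k * x powr \<gamma>)" using xg k_pos x0 by (intro divide_left_mono mult_left_mono) auto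
      also have "\<dots> = 4 * (g x * (D x / (R x)\<^sup>2))"
        unfolding g_def D_eq[OF x0] using R0 v_pos[OF x0] by (simp add: divide_simps)
      also have "\<dots> \<le> (g x + D x / (R x)\<^sup>2)\<^sup>2"
      proof -
        have "4 * (a * b) \<le> (a + b)\<^sup>2" for a b :: real
          using zero_le_power2[of "a - b"] by (simp add: power2_sum power2_diff)
        then show ?thesis .
      qed
      finally show ?thesis by (rule power2_le_imp_le[OF _ add_nonneg_nonneg[OF gpos]])
    qed
    have "e * ln x + \<Phi> 1 \<le> 0" if x: "x \<ge> 1" for x
    proof -
      have "\<Phi> 1 - e * ln 1 \<le> \<Phi> x - e * ln x"
      proof (rule DERIV_nonneg_imp_nondecreasing[OF x])
        fix t :: real assume t: "1 \<le> t"
        have "((\<lambda>x. \<Phi> x - e * ln x) has_real_derivative (g t + D t / (R t)\<^sup>2) - e * (1 / t)) (at t)"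
          using t by (intro DERIV_diff \<Phi>d DERIV_cmult) (auto intro!: derivative_eq_intros)
        then show "\<exists>y. ((\<lambda>x. \<Phi> x - e * ln x) has_real_derivative y) (at t) \<and> 0 \<le> y"
          using lower[OF t] by auto
      qed
      moreover have "tail_integral g x \<ge> 0"
        unfolding tail_integral_def
        by (intro Bochner_Integration.integral_nonneg_AE AE_leb_pos_I mult_nonneg_nonneg) (auto simp: g_def v_pos less_imp_le zero_le_mult_iff)
      moreover have "1 / (c * R x) > 0" using cR[OF x] by simp
      ultimately have "\<Phi> 1 - e * ln 1 \<le> \<Phi> x - e * ln x" "\<Phi> x \<le> 0" unfolding \<Phi>_def[of x] by linarith+
      then show ?thesis by simp
    qed
    \<comment> \<open>At this point \<open>e * ln x = \<bar>\<Phi> 1\<bar> + 1\<close>, more than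
      the inequality allows.\<close>
    from this[of "exp ((\<bar>\<Phi> 1\<bar> + 1) / e)"] show False
      using e by auto
  qed
  then have "((\<lambda>x. p x / u x) has_real_derivative 0) (at x)" if "x > 0" for x using r[OF that] by simp
  then have "\<exists>d. \<forall>x\<in>{0<..}. p x / u x = d"
    by (intro has_field_derivative_zero_constant) (auto intro: has_field_derivative_at_within)
  then obtain d where d: "\<And>x. x > 0 \<Longrightarrow> p x / u x = d" by auto
  have "p x = d * u x" if "x > 0" for x using d[OF that] upos[OF that] by (simp add: field_simps)
  then show thesis by (rule that)
qed

lemma bdry_cong:
  assumes "\<And>x. x > 0 \<Longrightarrow> (p has_real_derivative p' x) (at x)" "x > 0"
  shows "cev_bdry_fin \<gamma> p x = \<gamma> / (2 - \<gamma>) * x powr (\<gamma> - 1) * p x + x powr \<gamma> / (2 - \<gamma>) * p' x"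
    and "cev_bdry_inf \<gamma> p x = x powr \<gamma> * (x * p' x + (\<gamma> - 1) * p x)"
  using DERIV_imp_deriv[OF assms(1)[OF assms(2)]] by (simp_all add: cev_bdry_fin_def cev_bdry_inf_def)

text \<open>Reduction of order: for \<open>p = u R\<close> the equation becomes
  \<open>(Q2 u ^ 2 R')' = W u f\<close>, so \<open>R' = B D\<close> with \<open>B' = W u f\<close>.
  The primitive \<open>B\<close> vanishing at infinity is taken, for which Cauchy-Schwarz gives
  \<open>B ^ 2 \<le> T F\<close>. The constant left in \<open>R\<close> is fixed by the boundary
  condition, which is solvable because \<open>b0 - \<theta> * i0 \<noteq> 0\<close>.\<close>

lemma resolvent_solution:
  assumes \<theta>: "b0 - \<theta> * i0 \<noteq> 0"
  obtains K where "\<And>f. f \<in> L2_set_of M \<Longrightarrow> \<exists>p. p \<in> cev_Dmax \<mu> \<sigma> \<gamma> \<and>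
     ((\<lambda>x. cev_bdry_fin \<gamma> p x - \<theta> * cev_bdry_inf \<gamma> p x) \<longlongrightarrow> 0) (at_right 0) \<and>
     (AE x in leb_pos. L p x - l * p x = f x) \<and>
     (LINT x|leb_pos. W x * (p x)\<^sup>2) \<le> K * (LINT x|leb_pos. W x * (f x)\<^sup>2)"
proof -
  define \<Theta>0 where "\<Theta>0 = integral\<^sup>L leb_pos \<Theta>"
  \<comment> \<open>As \<open>x\<close> tends to \<open>0\<close> the boundary form of
    \<open>u R\<close> tends to \<open>\<kappa> * (b0 - \<theta> * i0) + B0 / ((2 - \<gamma>) * k *
    \<alpha>)\<close>, with \<open>\<kappa>\<close> and \<open>B0\<close> the limits of
    \<open>R\<close> and \<open>B\<close>. It vanishes for
    \<open>\<kappa> = - m * B0\<close>.\<close>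
  define m where "m = 1 / ((2 - \<gamma>) * k * \<alpha> * (b0 - \<theta> * i0))"
  \<comment> \<open>The first summand bounds \<open>2 T0 \<kappa> ^ 2\<close> through
    \<open>B0 ^ 2 \<le> T0 F\<close>; the second is the integral of
    \<open>4 \<Theta>\<close>.\<close>
  define K where "K = 2 * T0 * (m\<^sup>2 * T0) + 4 * \<Theta>0"
  show thesis
  proof (rule that[of K])
    fix f assume f: "f \<in> L2_set_of M"
    then have fm: "f \<in> borel_measurable leb_pos" and fi: "integrable leb_pos (\<lambda>x. W x * (f x)\<^sup>2)" by (auto simp: L2_iff)
    define F where "F = (LINT x|leb_pos. W x * (f x)\<^sup>2)"
    define h where "h x = W x * u x * f x" for x
    have um: "u \<in> borel_measurable leb_pos" by (rule borel_measurable_leb_pos_continuous[OF u_cont(1)])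
    note Wm = W_measurable
    \<comment> \<open>Cauchy-Schwarz is applied with the weight split as
      \<open>sqrt W * sqrt W\<close>. A half-line for \<open>A\<close> yields the bound on
      \<open>B\<close>, the whole line the bound on \<open>B0\<close>.\<close>
    have sqW: "(sqrt (W x))\<^sup>2 = W x" if "x > 0" for x using W_pos[OF that] by simp
    have CS: "integrable leb_pos (\<lambda>x. indicator A x * h x)"
        "(LINT x|leb_pos. indicator A x * h x)\<^sup>2 \<le> (LINT x|leb_pos. indicator A x * v x) * F"
      if A: "A \<in> sets borel" for A :: "real set"
    proof -
      have Am: "indicator A \<in> borel_measurable leb_pos"
        using A by (auto intro!: borel_measurable_indicator' simp: measurable_completion measurable_restrict_space1)
      let ?a = "\<lambda>x. indicator A x * (sqrt (W x) * u x)" and ?b = "\<lambda>x. sqrt (W x) * f x"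
      have am: "?a \<in> borel_measurable leb_pos" "?b \<in> borel_measurable leb_pos"
        using Am Wm um fm by measurable
      have ai: "integrable leb_pos (\<lambda>x. (?a x)\<^sup>2) \<longleftrightarrow> integrable leb_pos (\<lambda>x. indicator A x * v x)"
          "(LINT x|leb_pos. (?a x)\<^sup>2) = (LINT x|leb_pos. indicator A x * v x)"
          "integrable leb_pos (\<lambda>x. (?b x)\<^sup>2) \<longleftrightarrow> integrable leb_pos (\<lambda>x. W x * (f x)\<^sup>2)"
          "(LINT x|leb_pos. (?b x)\<^sup>2) = F"
          "integrable leb_pos (\<lambda>x. ?a x * ?b x) \<longleftrightarrow> integrable leb_pos (\<lambda>x. indicator A x * h x)"
          "(LINT x|leb_pos. ?a x * ?b x) = (LINT x|leb_pos. indicator A x * h x)"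
        unfolding F_def
        by (intro Bochner_Integration.integrable_cong Bochner_Integration.integral_cong refl;
            simp add: h_def v_def power_mult_distrib indicator_def sqW power2_eq_square[symmetric] W_pos less_imp_le)+
      note cs = Cauchy_Schwarz_integral[OF am ai(1)[THEN iffD2] ai(3)[THEN iffD2], OF integrable_indicator_leb_pos[OF v_integrable A] fi]
      show "integrable leb_pos (\<lambda>x. indicator A x * h x)" using cs(1) ai(5) by blast
      show "(LINT x|leb_pos. indicator A x * h x)\<^sup>2 \<le> (LINT x|leb_pos. indicator A x * v x) * F"
        using cs(2) unfolding ai(2,4,6) .
    qed
    have hi: "integrable leb_pos h" using CS(1)[of UNIV] by simp
    define B where "B x = - tail_integral h x" for x
    have B2: "(B x)\<^sup>2 \<le> T x * F" for x using CS(2)[of "{x<..}"] by (simp add: B_def tail_integral_def)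
    define B0 where "B0 = - integral\<^sup>L leb_pos h"
    have B02: "B0\<^sup>2 \<le> T0 * F" using CS(2)[of UNIV] by (simp add: B0_def T0_def)
    have Blim: "(B \<longlongrightarrow> B0) (at_right 0)"
      unfolding B_def B0_def by (intro tendsto_minus tail_integral_at_right_0 hi)
    have Bac: "loc_abs_cont_pos B"
      unfolding loc_abs_cont_pos_def
    proof (intro allI impI)
      fix a b :: real assume "0 < a \<and> a < b"
      then have "abs_cont_on a b (tail_integral h)" using tail_integral_abs_cont[OF hi] by (simp add: loc_abs_cont_pos_def)
      then show "abs_cont_on a b B"
        using abs_cont_on_dominated[of a b "tail_integral h" "tail_integral h" 1 0 B] by (simp add: B_def)
    qed
    have Bc: "continuous_on {0<..} B" by (rule loc_abs_cont_pos_imp_continuous_on[OF Bac])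
    have Bae: "AE x in leb_pos. (B has_real_derivative h x) (at x)"
      using tail_integral_has_derivative_AE[OF hi] unfolding B_def[abs_def]
      by eventually_elim (auto dest: DERIV_minus)
    have F0: "F \<ge> 0" unfolding F_def by (intro Bochner_Integration.integral_nonneg_AE AE_leb_pos_I) (simp add: W_pos less_imp_le)
    have BDc: "continuous_on {0<..} (\<lambda>x. B x * D x)" by (intro continuous_intros Bc D_cont)
    obtain G where G: "\<And>x. x > 0 \<Longrightarrow> (G has_real_derivative B x * D x) (at x)"
      using has_primitive_pos[OF BDc] by blast
    obtain KD where KD: "\<And>x. 0 < x \<Longrightarrow> x \<le> 1 \<Longrightarrow> D x \<le> KD" using D_bounded by blast
    have "\<bar>B x * D x\<bar> \<le> sqrt (T0 * F) * KD" if x: "0 < x" "x \<le> 1" for x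
    proof -
      have "(B x)\<^sup>2 \<le> T0 * F" using B2[of x] T_le[of x] F0 by (meson mult_right_mono order_trans)
      then have "\<bar>B x\<bar> \<le> sqrt (T0 * F)" "0 \<le> sqrt (T0 * F)"
        using real_sqrt_le_mono[of "(B x)\<^sup>2" "T0 * F"] order_trans[OF zero_le_power2] by auto
      then show ?thesis
        unfolding abs_mult using KD[OF x] D_pos[OF x(1)] by (intro mult_mono) auto
    qed
    then obtain g0 where g0: "(G \<longlongrightarrow> g0) (at_right 0)"
      using primitive_limit_at_0[OF G] by blast
    define \<kappa> where "\<kappa> = - m * B0"
    define R where "R x = \<kappa> + (G x - g0)" for x
    have Rd: "(R has_real_derivative B x * D x) (at x)" if "x > 0" for x
      unfolding R_def using G[OF that] by (auto intro!: derivative_eq_intros)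
    have "((\<lambda>x. \<kappa> + (G x - g0)) \<longlongrightarrow> \<kappa> + (g0 - g0)) (at_right 0)" by (intro tendsto_intros g0)
    then have Rlim: "(R \<longlongrightarrow> \<kappa>) (at_right 0)" by (simp add: R_def[abs_def])
    define p where "p x = u x * R x" for x
    define p' where "p' x = u' x * R x + B x * D x * u x" for x
    have pd: "(p has_real_derivative p' x) (at x)" if "x > 0" for x
      unfolding p_def p'_def by (intro DERIV_mult solD(1)[OF usol that] Rd that)
    have Rc: "continuous_on {0<..} R"
      using Rd by (intro continuous_at_imp_continuous_on ballI) (auto intro: DERIV_isCont)
    have p'c: "continuous_on {0<..} p'"
      unfolding p'_def by (intro continuous_intros u_cont Rc Bc D_cont)
    have pc: "continuous_on {0<..} p" unfolding p_def by (intro continuous_intros u_cont Rc)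
    have q: "Q2 x * p' x = Q2 x * u' x * R x + B x * (1 / u x)" if "x > 0" for x
      using Q2_pos[OF that] upos[OF that] by (simp add: p'_def D_def power2_eq_square field_simps)
    have iu: "((\<lambda>x. 1 / u x) has_real_derivative - u' x / (u x)\<^sup>2) (at x)" if "x > 0" for x
      using upos[OF that] solD(1)[OF usol that] by (auto intro!: derivative_eq_intros simp: power2_eq_square)
    have ac: "loc_abs_cont_pos (\<lambda>x. Q2 x * p' x)"
    proof (rule loc_abs_cont_pos_cong)
      have a1: "loc_abs_cont_pos (\<lambda>x. Q2 x * u' x)"
        by (rule loc_abs_cont_pos_C1[OF solD(2)[OF usol]]) (auto intro!: continuous_intros W_cont Q0_cont u_cont)
      have a2: "loc_abs_cont_pos R" by (rule loc_abs_cont_pos_C1[OF Rd BDc])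
      have a3: "loc_abs_cont_pos (\<lambda>x. 1 / u x)"
        by (rule loc_abs_cont_pos_C1[OF iu]) (use upos in \<open>force intro!: continuous_intros u_cont\<close>)+
      show "loc_abs_cont_pos (\<lambda>x. Q2 x * u' x * R x + B x * (1 / u x))"
        unfolding loc_abs_cont_pos_def
      proof (intro allI impI)
        fix a b :: real assume "0 < a \<and> a < b"
        with a1 a2 a3 Bac have "abs_cont_on a b (\<lambda>x. Q2 x * u' x)" "abs_cont_on a b R"
          "abs_cont_on a b (\<lambda>x. 1 / u x)" "abs_cont_on a b B" unfolding loc_abs_cont_pos_def by blast+
        then show "abs_cont_on a b (\<lambda>x. Q2 x * u' x * R x + B x * (1 / u x))"
          by (intro abs_cont_on_add abs_cont_on_mult[of a b "\<lambda>x. Q2 x * u' x"] abs_cont_on_mult[of a b B])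
      qed
    qed (simp add: q)
    have ae: "AE x in leb_pos. ((\<lambda>t. Q2 t * p' t) has_real_derivative W x * (l * p x + 1 * f x) - Q0 x * p x) (at x)"
    proof -
      have "AE x in leb_pos. x > 0" by (rule AE_leb_pos_I)
      with Bae show ?thesis
      proof eventually_elim
        case (elim x)
        then have x: "x > 0" by simp
        have "((\<lambda>x. Q2 x * u' x * R x + B x * (1 / u x)) has_real_derivative
            ((l * W x - Q0 x) * u x * R x + B x * D x * (Q2 x * u' x)) + (h x * (1 / u x) + - u' x / (u x)\<^sup>2 * B x)) (at x)"
          by (intro DERIV_add DERIV_mult solD(2)[OF usol x] Rd x elim(1) iu)
        \<comment> \<open>Because \<open>Q2 * D = 1 / u ^ 2\<close>, the two terms with
          \<open>B u' / u ^ 2\<close> cancel; what remains of the source is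
          \<open>h / u = W f\<close>.\<close>
        moreover have "((l * W x - Q0 x) * u x * R x + B x * D x * (Q2 x * u' x)) + (h x * (1 / u x) + - u' x / (u x)\<^sup>2 * B x)
           = W x * (l * p x + 1 * f x) - Q0 x * p x"
          using upos[OF x] Q2_pos[OF x] by (simp add: D_def h_def p_def algebra_simps)
        ultimately have "((\<lambda>x. Q2 x * u' x * R x + B x * (1 / u x)) has_real_derivative W x * (l * p x + 1 * f x) - Q0 x * p x) (at x)"
          by simp
        then show ?case
          by (rule has_field_derivative_transform_within_open[of _ _ _ "{0<..}"]) (use x q in auto)
      qed
    qed
    have gc: "continuous_on {0<..} (\<lambda>x. W x * (p x)\<^sup>2)" by (intro continuous_intros W_cont pc)
    obtain P where P: "\<And>x. x > 0 \<Longrightarrow> (P has_real_derivative W x * (p x)\<^sup>2) (at x)"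
      using has_primitive_pos[OF gc] by blast
    define E where "E x = P x + 2 * (T x * (R x)\<^sup>2) + 4 * F * tail_integral \<Theta> x" for x
    have Emono: "E b \<le> E a" if ab: "0 < a" "a \<le> b" for a b
    proof (rule DERIV_nonpos_imp_nonincreasing[OF ab(2)])
      fix x assume "a \<le> x"
      then have x: "x > 0" using ab by simp
      have TR: "((\<lambda>x. T x * (R x)\<^sup>2) has_real_derivative - v x * (R x)\<^sup>2 + 2 * R x * (B x * D x) * T x) (at x)"
        using x by (auto intro!: derivative_eq_intros T_deriv Rd)
      have "(E has_real_derivative W x * (p x)\<^sup>2 + 2 * (- v x * (R x)\<^sup>2 + 2 * R x * (B x * D x) * T x) + 4 * F * (- \<Theta> x)) (at x)"
        unfolding E_def
        by (intro DERIV_add DERIV_cmult P x TR tail_integral_has_derivative[OF \<Theta>_integrable \<Theta>_cont])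
      moreover have "W x * (p x)\<^sup>2 + 2 * (- v x * (R x)\<^sup>2 + 2 * R x * (B x * D x) * T x) + 4 * F * (- \<Theta> x) \<le> 0"
      proof -
        have vx: "v x > 0" by (rule v_pos[OF x])
        define z where "z = B x * D x * T x"
        \<comment> \<open>The derivative of \<open>2 T R ^ 2\<close> supplies
          \<open>- 2 v R ^ 2\<close>. One copy offsets \<open>W p ^ 2\<close>, and by this square
          the other absorbs the cross term \<open>4 R z\<close> up to
          \<open>4 z ^ 2 / v\<close>.\<close>
        have "0 \<le> (v x * R x - 2 * z)\<^sup>2" by simp
        then have "4 * R x * z * v x \<le> (v x * (R x)\<^sup>2) * v x + 4 * z\<^sup>2"
          by (simp add: power2_eq_square algebra_simps)
        then have "4 * R x * z \<le> ((v x * (R x)\<^sup>2) * v x + 4 * z\<^sup>2) / v x"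
          using vx by (simp only: pos_le_divide_eq)
        also have "\<dots> = v x * (R x)\<^sup>2 + 4 * (z\<^sup>2 / v x)" using vx by (simp add: add_divide_distrib)
        also have "z\<^sup>2 / v x \<le> F * \<Theta> x"
        proof -
          have "z\<^sup>2 = (B x)\<^sup>2 * ((D x)\<^sup>2 * (T x)\<^sup>2)" by (simp add: z_def power_mult_distrib)
          also have "\<dots> \<le> (T x * F) * ((D x)\<^sup>2 * (T x)\<^sup>2)" using B2 by (intro mult_right_mono) auto
          finally have "z\<^sup>2 / v x \<le> (T x * F) * ((D x)\<^sup>2 * (T x)\<^sup>2) / v x" using vx by (intro divide_right_mono) auto
          then show ?thesis by (simp add: \<Theta>_def power2_eq_square power3_eq_cube mult_ac)
        qed
        finally have "4 * R x * z \<le> v x * (R x)\<^sup>2 + 4 * (F * \<Theta> x)" by simp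
        moreover have "W x * (p x)\<^sup>2 = v x * (R x)\<^sup>2" by (simp add: p_def v_def power_mult_distrib)
        ultimately show ?thesis by (simp add: z_def algebra_simps)
      qed
      ultimately show "\<exists>y. (E has_real_derivative y) (at x) \<and> y \<le> 0" by blast
    qed
    have Tlim: "(T \<longlongrightarrow> T0) (at_right 0)" unfolding T0_def by (rule tail_integral_at_right_0[OF v_integrable])
    have \<Theta>lim: "(tail_integral \<Theta> \<longlongrightarrow> \<Theta>0) (at_right 0)" unfolding \<Theta>0_def by (rule tail_integral_at_right_0[OF \<Theta>_integrable])
    \<comment> \<open>\<open>P\<close> is determined only up to a constant, so a difference is
      estimated. Comparing \<open>E b\<close> with \<open>E x\<close> and letting \<open>x\<close>
      tend to \<open>0\<close> replaces \<open>T\<close>, \<open>R\<close> and the tail of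
      \<open>\<Theta>\<close> by their limits.\<close>
    have Pbound: "P b - P a \<le> 2 * (T0 * \<kappa>\<^sup>2) + 4 * F * \<Theta>0" if ab: "0 < a" "a \<le> b" for a b
    proof (rule tendsto_lowerbound)
      show "((\<lambda>x. 2 * (T x * (R x)\<^sup>2) + 4 * F * tail_integral \<Theta> x) \<longlongrightarrow> 2 * (T0 * \<kappa>\<^sup>2) + 4 * F * \<Theta>0) (at_right 0)"
        by (intro tendsto_intros Tlim Rlim \<Theta>lim)
      have "\<forall>\<^sub>F x in at_right 0. x \<in> {0<..<a}" using eventually_at_right_real[OF ab(1)] .
      then show "\<forall>\<^sub>F x in at_right 0. P b - P a \<le> 2 * (T x * (R x)\<^sup>2) + 4 * F * tail_integral \<Theta> x"
      proof eventually_elim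
        case (elim x)
        have "P x \<le> P a"
        proof (rule DERIV_nonneg_imp_nondecreasing[of x a P])
          fix t assume "x \<le> t"
          then have "t > 0" using elim by simp
          then show "\<exists>y. (P has_real_derivative y) (at t) \<and> 0 \<le> y"
            using P[of t] W_pos[of t] by (intro exI[of _ "W t * (p t)\<^sup>2"]) simp
        qed (use elim in simp)
        moreover have "E b \<le> E x" using elim ab by (intro Emono) auto
        moreover have "tail_integral \<Theta> b \<ge> 0"
          unfolding tail_integral_def
          by (intro Bochner_Integration.integral_nonneg_AE AE_leb_pos_I mult_nonneg_nonneg \<Theta>_nonneg) auto
        then have "4 * F * tail_integral \<Theta> b \<ge> 0" using F0 by simp
        moreover have "2 * (T b * (R b)\<^sup>2) \<ge> 0" using T_nonneg by simp
        ultimately show ?case unfolding E_def by linarith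
      qed
    qed simp
    have pint: "integrable leb_pos (\<lambda>x. W x * (p x)\<^sup>2)"
      and ple: "(LINT x|leb_pos. W x * (p x)\<^sup>2) \<le> 2 * (T0 * \<kappa>\<^sup>2) + 4 * F * \<Theta>0"
      by (rule integrable_leb_pos_bounded_primitive[OF _ P Pbound]; simp add: W_pos less_imp_le)+
    have pL2: "p \<in> L2_set_of M" using pint pc by (auto simp: L2_iff intro: borel_measurable_leb_pos_continuous)
    have D: "p \<in> cev_Dmax \<mu> \<sigma> \<gamma>" "AE x in leb_pos. L p x = l * p x + 1 * f x"
      using DmaxI[OF pd p'c ac ae L2_add[OF pL2 f] pint] by auto
    show "\<exists>p. p \<in> cev_Dmax \<mu> \<sigma> \<gamma> \<and>
     ((\<lambda>x. cev_bdry_fin \<gamma> p x - \<theta> * cev_bdry_inf \<gamma> p x) \<longlongrightarrow> 0) (at_right 0) \<and>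
     (AE x in leb_pos. L p x - l * p x = f x) \<and>
     (LINT x|leb_pos. W x * (p x)\<^sup>2) \<le> K * (LINT x|leb_pos. W x * (f x)\<^sup>2)"
    proof (intro exI[of _ p] conjI)
      show "p \<in> cev_Dmax \<mu> \<sigma> \<gamma>" by (rule D(1))
      show "AE x in leb_pos. L p x - l * p x = f x" using D(2) by eventually_elim simp
      have T0: "T0 \<ge> 0" using T_nonneg[of 1] T_le[of 1] by linarith
      have "\<kappa>\<^sup>2 \<le> m\<^sup>2 * (T0 * F)" unfolding \<kappa>_def using B02 by (simp add: power_mult_distrib mult_left_mono)
      then have "2 * (T0 * \<kappa>\<^sup>2) \<le> 2 * (T0 * (m\<^sup>2 * (T0 * F)))" using T0 by (intro mult_left_mono) auto
      then have "2 * (T0 * \<kappa>\<^sup>2) + 4 * F * \<Theta>0 \<le> K * F" by (simp add: K_def algebra_simps)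
      then show "(LINT x|leb_pos. W x * (p x)\<^sup>2) \<le> K * (LINT x|leb_pos. W x * (f x)\<^sup>2)"
        using ple by (simp add: F_def)
      \<comment> \<open>\<open>z\<close> is \<open>x powr \<gamma> * B D u\<close>, the contribution
        of \<open>R'\<close> to the boundary forms. It has a finite limit at \<open>0\<close>: the
        first form keeps it, whereas in the second it carries an extra factor \<open>x\<close> and
        disappears.\<close>
      define z where "z x = B x / (k * (exp (- n * x powr (2 - \<gamma>)) * (x powr \<gamma> * u x)))" for x
      have zlim: "(z \<longlongrightarrow> B0 / (k * (exp (- n * 0 powr (2 - \<gamma>)) * \<alpha>))) (at_right 0)"
        unfolding z_def using k_pos u_zero(2) gam
        by (intro tendsto_intros Blim u_zero(1)) (auto simp: eventually_at_right_less less_imp_le intro!: always_eventually eventually_mono[OF eventually_at_right_less])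
      have zeq: "x powr \<gamma> * (B x * D x * u x) = z x" if "x > 0" for x
        using that upos[OF that] by (simp add: z_def D_def Q2_eq W_eq power2_eq_square)
      have lim: "((\<lambda>x. R x * cev_bdry_fin \<gamma> u x + z x / (2 - \<gamma>) - \<theta> * (R x * cev_bdry_inf \<gamma> u x + x * z x)) \<longlongrightarrow>
         \<kappa> * b0 + B0 / (k * (exp (- n * 0 powr (2 - \<gamma>)) * \<alpha>)) / (2 - \<gamma>) -
          \<theta> * (\<kappa> * i0 + 0 * (B0 / (k * (exp (- n * 0 powr (2 - \<gamma>)) * \<alpha>))))) (at_right 0)"
        by (intro tendsto_intros Rlim u_fin u_binf zlim) (use gam in auto)
      have "\<kappa> * b0 + B0 / (k * (exp (- n * 0 powr (2 - \<gamma>)) * \<alpha>)) / (2 - \<gamma>) -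
          \<theta> * (\<kappa> * i0 + 0 * (B0 / (k * (exp (- n * 0 powr (2 - \<gamma>)) * \<alpha>)))) = \<kappa> * (b0 - \<theta> * i0) + B0 / ((2 - \<gamma>) * k * \<alpha>)"
        using gam by (simp add: algebra_simps)
      also have "\<dots> = 0" using \<theta> by (simp add: \<kappa>_def m_def)
      finally have "((\<lambda>x. R x * cev_bdry_fin \<gamma> u x + z x / (2 - \<gamma>) - \<theta> * (R x * cev_bdry_inf \<gamma> u x + x * z x)) \<longlongrightarrow> 0) (at_right 0)"
        using lim by simp
      moreover have "\<forall>\<^sub>F x in at_right 0. R x * cev_bdry_fin \<gamma> u x + z x / (2 - \<gamma>) - \<theta> * (R x * cev_bdry_inf \<gamma> u x + x * z x) =
         cev_bdry_fin \<gamma> p x - \<theta> * cev_bdry_inf \<gamma> p x"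
        using eventually_at_right_less
      proof eventually_elim
        case (elim x)
        have pb: "cev_bdry_fin \<gamma> p x = \<gamma> / (2 - \<gamma>) * x powr (\<gamma> - 1) * p x + x powr \<gamma> / (2 - \<gamma>) * p' x"
          "cev_bdry_inf \<gamma> p x = x powr \<gamma> * (x * p' x + (\<gamma> - 1) * p x)"
          by (rule bdry_cong[OF pd]; use elim in simp)+
        have ub: "cev_bdry_fin \<gamma> u x = \<gamma> / (2 - \<gamma>) * x powr (\<gamma> - 1) * u x + x powr \<gamma> / (2 - \<gamma>) * u' x"
          "cev_bdry_inf \<gamma> u x = x powr \<gamma> * (x * u' x + (\<gamma> - 1) * u x)"
          by (rule bdry_cong[OF solD(1)[OF usol]]; use elim in simp)+
        have "cev_bdry_fin \<gamma> p x = R x * cev_bdry_fin \<gamma> u x + z x / (2 - \<gamma>)"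
          unfolding pb ub zeq[OF elim, symmetric]
          unfolding p_def p'_def
          by (simp add: algebra_simps add_divide_distrib)
        moreover have "cev_bdry_inf \<gamma> p x = R x * cev_bdry_inf \<gamma> u x + x * z x"
          unfolding pb ub zeq[OF elim, symmetric]
          unfolding p_def p'_def
          by (simp add: algebra_simps)
        ultimately show ?case by simp
      qed
      ultimately show "((\<lambda>x. cev_bdry_fin \<gamma> p x - \<theta> * cev_bdry_inf \<gamma> p x) \<longlongrightarrow> 0) (at_right 0)"
        by (rule Lim_transform_eventually)
    qed
  qed
qed

end

subsection \<open>Spectrum and eigenfunctions\<close>

context cev
begin

text \<open>With this scaling the eigenvalue condition
  \<open>b0 = scaled_param \<theta> * i0\<close> reduces to the Gamma equation with no further
  constants.\<close>

definition scaled_param :: "real \<Rightarrow> real" where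
  "scaled_param \<theta> = \<theta> * n powr (1 / (2 - \<gamma>)) / (2 - \<gamma>)\<^sup>2"

lemma cev_domain_iff:
  "p \<in> cev_domain \<mu> \<sigma> \<gamma> \<theta> \<longleftrightarrow> p \<in> cev_Dmax \<mu> \<sigma> \<gamma> \<and>
     ((\<lambda>x. cev_bdry_fin \<gamma> p x - scaled_param \<theta> * cev_bdry_inf \<gamma> p x) \<longlongrightarrow> 0) (at_right 0)"
  by (simp add: cev_domain_def scaled_param_def n_def)

lemma cont_of_deriv:
  fixes p :: "real \<Rightarrow> real"
  shows "(\<And>x. x > 0 \<Longrightarrow> (p has_real_derivative p' x) (at x)) \<Longrightarrow> continuous_on {0<..} p"
  by (intro continuous_at_imp_continuous_on ballI) (auto intro: DERIV_isCont)

section \<open>Differences of domain elements\<close>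

lemma Dmax_diff:
  assumes p: "p \<in> cev_Dmax \<mu> \<sigma> \<gamma>" and q: "q \<in> cev_Dmax \<mu> \<sigma> \<gamma>"
  shows "(\<lambda>x. p x - q x) \<in> cev_Dmax \<mu> \<sigma> \<gamma>"
    and "AE x in leb_pos. L (\<lambda>x. p x - q x) x = L p x - L q x"
    and "\<And>x. x > 0 \<Longrightarrow> deriv (\<lambda>x. p x - q x) x = deriv p x - deriv q x"
proof -
  note P = DmaxD[OF p] and Q = DmaxD[OF q]
  have d: "((\<lambda>x. p x - q x) has_real_derivative deriv p x - deriv q x) (at x)" if "x > 0" for x
    by (intro DERIV_diff P(1) Q(1) that)
  then show "\<And>x. x > 0 \<Longrightarrow> deriv (\<lambda>x. p x - q x) x = deriv p x - deriv q x"
    by (rule DERIV_imp_deriv)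
  have c: "continuous_on {0<..} (\<lambda>x. deriv p x - deriv q x)" by (intro continuous_intros P Q)
  have ac: "loc_abs_cont_pos (\<lambda>x. Q2 x * (deriv p x - deriv q x))"
    unfolding loc_abs_cont_pos_def right_diff_distrib
    using P(3) Q(3) by (intro allI impI abs_cont_on_diff) (simp_all add: loc_abs_cont_pos_def)
  have ae: "AE x in leb_pos. ((\<lambda>t. Q2 t * (deriv p t - deriv q t)) has_real_derivative
      W x * (1 * L p x + (- 1) * L q x) - Q0 x * (p x - q x)) (at x)"
    using P(4) Q(4)
  proof eventually_elim
    case (elim x)
    from DERIV_diff[OF this] show ?case by (simp add: algebra_simps)
  qed
  have "(\<lambda>x. 1 * p x + (- 1) * q x) \<in> L2_set_of M" by (rule L2_add[OF P(5) Q(5)])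
  then have int: "integrable leb_pos (\<lambda>x. W x * (p x - q x)\<^sup>2)" by (simp add: L2_iff)
  have "(\<lambda>x. p x - q x) \<in> cev_Dmax \<mu> \<sigma> \<gamma> \<and> (AE x in leb_pos. L (\<lambda>x. p x - q x) x = 1 * L p x + (- 1) * L q x)"
    using DmaxI[OF d c ac ae L2_add[OF P(6) Q(6)] int] by blast
  then show "(\<lambda>x. p x - q x) \<in> cev_Dmax \<mu> \<sigma> \<gamma>" "AE x in leb_pos. L (\<lambda>x. p x - q x) x = L p x - L q x"
    by simp_all
qed

lemma cev_domain_diff:
  assumes p: "p \<in> cev_domain \<mu> \<sigma> \<gamma> \<theta>" and q: "q \<in> cev_domain \<mu> \<sigma> \<gamma> \<theta>"
  shows "(\<lambda>x. p x - q x) \<in> cev_domain \<mu> \<sigma> \<gamma> \<theta>"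
  unfolding cev_domain_iff
proof
  have P: "p \<in> cev_Dmax \<mu> \<sigma> \<gamma>" and Q: "q \<in> cev_Dmax \<mu> \<sigma> \<gamma>" using p q by (auto simp: cev_domain_iff)
  show "(\<lambda>x. p x - q x) \<in> cev_Dmax \<mu> \<sigma> \<gamma>" by (rule Dmax_diff(1)[OF P Q])
  have "((\<lambda>x. (cev_bdry_fin \<gamma> p x - scaled_param \<theta> * cev_bdry_inf \<gamma> p x) -
      (cev_bdry_fin \<gamma> q x - scaled_param \<theta> * cev_bdry_inf \<gamma> q x)) \<longlongrightarrow> 0 - 0) (at_right 0)"
    using p q unfolding cev_domain_iff by (intro tendsto_diff) auto
  moreover have "\<forall>\<^sub>F x in at_right 0. (cev_bdry_fin \<gamma> p x - scaled_param \<theta> * cev_bdry_inf \<gamma> p x) -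
      (cev_bdry_fin \<gamma> q x - scaled_param \<theta> * cev_bdry_inf \<gamma> q x) =
      cev_bdry_fin \<gamma> (\<lambda>x. p x - q x) x - scaled_param \<theta> * cev_bdry_inf \<gamma> (\<lambda>x. p x - q x) x"
    using eventually_at_right_less
    by eventually_elim (simp add: cev_bdry_fin_def cev_bdry_inf_def Dmax_diff(3)[OF P Q] algebra_simps add_divide_distrib diff_divide_distrib)
  ultimately show "((\<lambda>x. cev_bdry_fin \<gamma> (\<lambda>x. p x - q x) x - scaled_param \<theta> * cev_bdry_inf \<gamma> (\<lambda>x. p x - q x) x) \<longlongrightarrow> 0) (at_right 0)"
    by (auto intro: Lim_transform_eventually)
qed

end

context cev_sol
begin

lemma multiple_deriv:
  assumes p: "\<And>x. x > 0 \<Longrightarrow> p x = d * u x" and x: "x > 0"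
  shows "(p has_real_derivative d * u' x) (at x)"
proof -
  have "((\<lambda>x. d * u x) has_real_derivative d * u' x) (at x)" by (rule DERIV_cmult[OF solD(1)[OF usol x]])
  then show ?thesis
    by (rule has_field_derivative_transform_within_open[of _ _ _ "{0<..}"]) (use x p in auto)
qed

lemma multiple_Dmax:
  assumes p: "\<And>x. x > 0 \<Longrightarrow> p x = d * u x"
  shows "p \<in> cev_Dmax \<mu> \<sigma> \<gamma>" "AE x in leb_pos. L p x = l * p x"
proof -
  have s: "sol l p (\<lambda>x. d * u' x)"
    unfolding sol_def
  proof (intro allI impI conjI)
    fix x :: real assume x: "x > 0"
    show "(p has_real_derivative d * u' x) (at x)" by (rule multiple_deriv[OF p x])
    show "((\<lambda>t. Q2 t * (d * u' t)) has_real_derivative (l * W x - Q0 x) * p x) (at x)"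
      using DERIV_cmult[OF solD(2)[OF usol x], of d] by (simp add: p[OF x] mult_ac)
  qed
  have "integrable leb_pos (\<lambda>x. d\<^sup>2 * v x)" using v_integrable by simp
  moreover have "integrable leb_pos (\<lambda>x. d\<^sup>2 * v x) \<longleftrightarrow> integrable leb_pos (\<lambda>x. W x * (p x)\<^sup>2)"
    by (rule Bochner_Integration.integrable_cong) (auto simp: p v_def power_mult_distrib)
  ultimately have "integrable leb_pos (\<lambda>x. W x * (p x)\<^sup>2)" by blast
  from sol_Dmax[OF s this] show "p \<in> cev_Dmax \<mu> \<sigma> \<gamma>" "AE x in leb_pos. L p x = l * p x" .
qed

lemma multiple_bdry:
  assumes p: "\<And>x. x > 0 \<Longrightarrow> p x = d * u x"
  shows "((\<lambda>x. cev_bdry_fin \<gamma> p x) \<longlongrightarrow> d * b0) (at_right 0)"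
    and "((\<lambda>x. cev_bdry_inf \<gamma> p x) \<longlongrightarrow> d * i0) (at_right 0)"
proof -
  have e: "cev_bdry_fin \<gamma> p x = d * cev_bdry_fin \<gamma> u x" "cev_bdry_inf \<gamma> p x = d * cev_bdry_inf \<gamma> u x" if x: "x > 0" for x
    using DERIV_imp_deriv[OF multiple_deriv[OF p x]] DERIV_imp_deriv[OF solD(1)[OF usol x]]
    by (simp_all add: cev_bdry_fin_def cev_bdry_inf_def p[OF x] algebra_simps add_divide_distrib)
  show "((\<lambda>x. cev_bdry_fin \<gamma> p x) \<longlongrightarrow> d * b0) (at_right 0)"
    by (rule Lim_transform_eventually[OF tendsto_mult_left[OF u_fin]], rule eventually_mono[OF eventually_at_right_less])
       (simp add: e)
  show "((\<lambda>x. cev_bdry_inf \<gamma> p x) \<longlongrightarrow> d * i0) (at_right 0)"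
    by (rule Lim_transform_eventually[OF tendsto_mult_left[OF u_binf(1)]], rule eventually_mono[OF eventually_at_right_less])
       (simp add: e)
qed

lemma eigenfunction_multiple:
  assumes p: "p \<in> cev_Dmax \<mu> \<sigma> \<gamma>" and ev: "AE x in leb_pos. L p x = l * p x"
  obtains d where "\<And>x. x > 0 \<Longrightarrow> p x = d * u x"
  using L2_sol_multiple[OF eigenfunction_sol[OF p ev]] DmaxD(5)[OF p] by (auto simp: L2_iff)

text \<open>On \<open>d * u\<close> the boundary form converges to
  \<open>d * (b0 - scaled_param \<theta> * i0)\<close>, so membership is one numerical
  condition.\<close>

lemma multiple_domain_iff:
  assumes p: "\<And>x. x > 0 \<Longrightarrow> p x = d * u x"
  shows "p \<in> cev_domain \<mu> \<sigma> \<gamma> \<theta> \<longleftrightarrow> d * (b0 - scaled_param \<theta> * i0) = 0"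
proof -
  have lim: "((\<lambda>x. cev_bdry_fin \<gamma> p x - scaled_param \<theta> * cev_bdry_inf \<gamma> p x) \<longlongrightarrow>
      d * b0 - scaled_param \<theta> * (d * i0)) (at_right 0)"
    by (intro tendsto_intros multiple_bdry[OF p])
  have "p \<in> cev_domain \<mu> \<sigma> \<gamma> \<theta> \<longleftrightarrow> d * b0 - scaled_param \<theta> * (d * i0) = 0"
  proof
    assume "p \<in> cev_domain \<mu> \<sigma> \<gamma> \<theta>"
    then have "((\<lambda>x. cev_bdry_fin \<gamma> p x - scaled_param \<theta> * cev_bdry_inf \<gamma> p x) \<longlongrightarrow> 0) (at_right 0)"
      by (simp add: cev_domain_iff)
    then show "d * b0 - scaled_param \<theta> * (d * i0) = 0"
      by (rule tendsto_unique[OF trivial_limit_at_right_real lim])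
  next
    assume z: "d * b0 - scaled_param \<theta> * (d * i0) = 0"
    show "p \<in> cev_domain \<mu> \<sigma> \<gamma> \<theta>"
      unfolding cev_domain_iff using lim[unfolded z] multiple_Dmax(1)[OF p] by blast
  qed
  then show ?thesis by (simp add: algebra_simps)
qed

lemma cev_eigenfunction_iff:
  assumes \<theta>: "b0 - scaled_param \<theta> * i0 = 0"
  shows "cev_eigenfunction \<mu> \<sigma> \<gamma> \<theta> l p \<longleftrightarrow> (\<exists>c. c \<noteq> 0 \<and> (\<forall>x>0. p x = c * u x))"
proof
  assume "cev_eigenfunction \<mu> \<sigma> \<gamma> \<theta> l p"
  then have p: "p \<in> cev_Dmax \<mu> \<sigma> \<gamma>" "AE x in leb_pos. L p x = l * p x" and nz: "\<not> (AE x in leb_pos. p x = 0)"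
    by (auto simp: cev_eigenfunction_def op_eigenfunction_def cev_domain_iff AE_M_iff)
  obtain d where d: "\<And>x. x > 0 \<Longrightarrow> p x = d * u x" using eigenfunction_multiple[OF p] by blast
  have "d \<noteq> 0" using nz AE_leb_pos_I[of "\<lambda>x. p x = 0"] d by auto
  then show "\<exists>c. c \<noteq> 0 \<and> (\<forall>x>0. p x = c * u x)" using d by blast
next
  assume "\<exists>c. c \<noteq> 0 \<and> (\<forall>x>0. p x = c * u x)"
  then obtain c where c: "c \<noteq> 0" "\<And>x. x > 0 \<Longrightarrow> p x = c * u x" by blast
  have "p \<in> cev_domain \<mu> \<sigma> \<gamma> \<theta>" using multiple_domain_iff[OF c(2)] \<theta> by simp
  moreover have "AE x in leb_pos. L p x = l * p x" by (rule multiple_Dmax(2)[OF c(2)])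
  moreover have "\<not> (AE x in leb_pos. p x = 0)"
  proof
    assume ae: "AE x in leb_pos. p x = 0"
    have "continuous_on {0<..} p" by (rule cont_of_deriv[OF multiple_deriv[OF c(2)]])
    with ae have "p 1 = 0" using AE_zero_iff by auto
    then show False using c upos[of 1] by simp
  qed
  ultimately show "cev_eigenfunction \<mu> \<sigma> \<gamma> \<theta> l p"
    by (simp add: cev_eigenfunction_def op_eigenfunction_def AE_M_iff)
qed

text \<open>The only candidates are the multiples \<open>d * u\<close>, whose boundary value
  \<open>d * i0\<close> vanishes for \<open>d = 0\<close> alone.\<close>

lemma not_cev_eigenfunction_infinity: "\<not> cev_eigenfunction_infinity \<mu> \<sigma> \<gamma> l p"
proof
  assume "cev_eigenfunction_infinity \<mu> \<sigma> \<gamma> l p"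
  then have p: "p \<in> cev_Dmax \<mu> \<sigma> \<gamma>" "AE x in leb_pos. L p x = l * p x" and nz: "\<not> (AE x in leb_pos. p x = 0)"
    and bd: "(cev_bdry_inf \<gamma> p \<longlongrightarrow> 0) (at_right 0)"
    by (auto simp: cev_eigenfunction_infinity_def op_eigenfunction_def cev_domain_infinity_def AE_M_iff)
  obtain d where d: "\<And>x. x > 0 \<Longrightarrow> p x = d * u x" using eigenfunction_multiple[OF p] by blast
  have "d * i0 = 0"
    using tendsto_unique[OF trivial_limit_at_right_real multiple_bdry(2)[OF d] bd] by simp
  then have "d = 0" using u_binf(2) by simp
  then show False using nz AE_leb_pos_I[of "\<lambda>x. p x = 0"] d by auto
qed

text \<open>If the condition holds, \<open>u\<close> lies in the kernel of \<open>L - l\<close> and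
  uniqueness fails. Otherwise \<open>resolvent_solution\<close> provides existence and the bound,
  and no nonzero multiple of \<open>u\<close> is in the domain, so solutions are unique.\<close>

lemma cev_spectrum_iff: "l \<in> cev_spectrum \<mu> \<sigma> \<gamma> \<theta> \<longleftrightarrow> b0 - scaled_param \<theta> * i0 = 0"
proof
  assume \<theta>: "b0 - scaled_param \<theta> * i0 = 0"
  show "l \<in> cev_spectrum \<mu> \<sigma> \<gamma> \<theta>"
    unfolding cev_spectrum_def op_spectrum_def
  proof
    assume l: "l \<in> op_resolvent_set M (cev_domain \<mu> \<sigma> \<gamma> \<theta>) L"
    have zero: "(\<lambda>x. 0) \<in> L2_set_of M" by (simp add: L2_iff)
    have "\<forall>f\<in>L2_set_of M. \<exists>p\<in>cev_domain \<mu> \<sigma> \<gamma> \<theta>. (AE x in M. L p x - l * p x = f x) \<and>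
        (\<forall>q\<in>cev_domain \<mu> \<sigma> \<gamma> \<theta>. (AE x in M. L q x - l * q x = f x) \<longrightarrow> (AE x in M. q x = p x))"
      using l unfolding op_resolvent_set_def mem_Collect_eq by (rule conjunct1)
    from bspec[OF this zero] obtain p where
      p: "\<And>q. q \<in> cev_domain \<mu> \<sigma> \<gamma> \<theta> \<Longrightarrow> AE x in M. L q x - l * q x = 0 \<Longrightarrow> AE x in M. q x = p x"
      by meson
    \<comment> \<open>All multiples of \<open>u\<close> solve the homogeneous problem; uniqueness
      would identify the multiples by \<open>0\<close> and by \<open>1\<close>.\<close>
    have m: "AE x in leb_pos. d * u x = p x" for d
    proof -
      have "(\<lambda>x. d * u x) \<in> cev_domain \<mu> \<sigma> \<gamma> \<theta>" using multiple_domain_iff[of "\<lambda>x. d * u x" d] \<theta> by simp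
      moreover have "AE x in leb_pos. L (\<lambda>x. d * u x) x = l * (d * u x)" by (rule multiple_Dmax(2)[of _ d]) simp
      then have "AE x in M. L (\<lambda>x. d * u x) x - l * (d * u x) = 0" unfolding AE_M_iff by eventually_elim simp
      ultimately show ?thesis using p[of "\<lambda>x. d * u x"] by (simp add: AE_M_iff)
    qed
    have "AE x in leb_pos. u x = 0" using m[of 0] m[of 1] by eventually_elim simp
    then have "u 1 = 0" using AE_zero_iff[OF u_cont(1)] by simp
    then show False using upos[of 1] by simp
  qed
next
  assume l: "l \<in> cev_spectrum \<mu> \<sigma> \<gamma> \<theta>"
  show "b0 - scaled_param \<theta> * i0 = 0"
  proof (rule ccontr)
    assume \<theta>: "b0 - scaled_param \<theta> * i0 \<noteq> 0"
    obtain K where K: "\<And>f. f \<in> L2_set_of M \<Longrightarrow> \<exists>p. p \<in> cev_Dmax \<mu> \<sigma> \<gamma> \<and>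
       ((\<lambda>x. cev_bdry_fin \<gamma> p x - scaled_param \<theta> * cev_bdry_inf \<gamma> p x) \<longlongrightarrow> 0) (at_right 0) \<and>
       (AE x in leb_pos. L p x - l * p x = f x) \<and>
       (LINT x|leb_pos. W x * (p x)\<^sup>2) \<le> K * (LINT x|leb_pos. W x * (f x)\<^sup>2)"
      using resolvent_solution[OF \<theta>] by blast
    then have ex: "\<exists>p\<in>cev_domain \<mu> \<sigma> \<gamma> \<theta>. (AE x in leb_pos. L p x - l * p x = f x) \<and>
       (LINT x|leb_pos. W x * (p x)\<^sup>2) \<le> K * (LINT x|leb_pos. W x * (f x)\<^sup>2)" if "f \<in> L2_set_of M" for f
      using that unfolding cev_domain_iff Bex_def by (simp add: conj_assoc)
    have uniq: "AE x in leb_pos. q x = p x"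
      if p: "p \<in> cev_domain \<mu> \<sigma> \<gamma> \<theta>" "AE x in leb_pos. L p x - l * p x = f x"
        and q: "q \<in> cev_domain \<mu> \<sigma> \<gamma> \<theta>" "AE x in leb_pos. L q x - l * q x = f x" for p q f
    proof -
      have D: "p \<in> cev_Dmax \<mu> \<sigma> \<gamma>" "q \<in> cev_Dmax \<mu> \<sigma> \<gamma>" using p q by (auto simp: cev_domain_iff)
      have "AE x in leb_pos. L (\<lambda>x. q x - p x) x = l * (q x - p x)"
        using Dmax_diff(2)[OF D(2,1)] p(2) q(2) by eventually_elim (simp add: algebra_simps)
      then obtain d where d: "\<And>x. x > 0 \<Longrightarrow> q x - p x = d * u x"
        using eigenfunction_multiple[OF Dmax_diff(1)[OF D(2,1)]] by blast
      have "(\<lambda>x. q x - p x) \<in> cev_domain \<mu> \<sigma> \<gamma> \<theta> \<longleftrightarrow> d * (b0 - scaled_param \<theta> * i0) = 0"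
        by (rule multiple_domain_iff) (rule d)
      then have "d * (b0 - scaled_param \<theta> * i0) = 0"
        using cev_domain_diff[OF q(1) p(1)] by blast
      then have "d = 0" using \<theta> by simp
      then show ?thesis using d by (intro AE_leb_pos_I) auto
    qed
    have "l \<in> op_resolvent_set M (cev_domain \<mu> \<sigma> \<gamma> \<theta>) L"
      unfolding op_resolvent_set_def mem_Collect_eq AE_M_iff
    proof (intro conjI ballI)
      fix f assume "f \<in> L2_set_of M"
      then obtain p where p: "p \<in> cev_domain \<mu> \<sigma> \<gamma> \<theta>" "AE x in leb_pos. L p x - l * p x = f x" using ex by blast
      then show "\<exists>p\<in>cev_domain \<mu> \<sigma> \<gamma> \<theta>. (AE x in leb_pos. L p x - l * p x = f x) \<and>
          (\<forall>q\<in>cev_domain \<mu> \<sigma> \<gamma> \<theta>. (AE x in leb_pos. L q x - l * q x = f x) \<longrightarrow> (AE x in leb_pos. q x = p x))"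
        using uniq[OF p] by blast
    next
      show "\<exists>C. \<forall>p\<in>cev_domain \<mu> \<sigma> \<gamma> \<theta>. L2_norm_of M p \<le> C * L2_norm_of M (\<lambda>x. L p x - l * p x)"
      proof (intro exI[of _ "sqrt K"] ballI)
        fix p assume p: "p \<in> cev_domain \<mu> \<sigma> \<gamma> \<theta>"
        then have D: "p \<in> cev_Dmax \<mu> \<sigma> \<gamma>" by (simp add: cev_domain_iff)
        define f where "f x = L p x - l * p x" for x
        have "(\<lambda>x. 1 * L p x + (- l) * p x) \<in> L2_set_of M" by (rule L2_add[OF DmaxD(6,5)[OF D]])
        then have f: "f \<in> L2_set_of M" by (simp add: f_def[abs_def])
        obtain q where q: "q \<in> cev_domain \<mu> \<sigma> \<gamma> \<theta>" "AE x in leb_pos. L q x - l * q x = f x"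
          "(LINT x|leb_pos. W x * (q x)\<^sup>2) \<le> K * (LINT x|leb_pos. W x * (f x)\<^sup>2)"
          using ex[OF f] by blast
        \<comment> \<open>The estimate is known for the constructed solution \<open>q\<close>;
          uniqueness identifies it with \<open>p\<close>, so the bound covers the entire
          domain.\<close>
        have qp: "AE x in leb_pos. q x = p x"
          by (rule uniq[OF p _ q(1,2)]) (simp add: f_def)
        have m: "p \<in> borel_measurable leb_pos" "q \<in> borel_measurable leb_pos" "f \<in> borel_measurable leb_pos"
          using DmaxD(5)[OF D] q(1) DmaxD(5)[of q] f by (auto simp: L2_iff cev_domain_iff)
        have "(LINT x|leb_pos. W x * (q x)\<^sup>2) = (LINT x|leb_pos. W x * (p x)\<^sup>2)"
          by (rule integral_cong_AE) (use m W_measurable qp in \<open>auto elim: eventually_mono\<close>)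
        then have "L2_norm_of M p \<le> sqrt (K * (LINT x|leb_pos. W x * (f x)\<^sup>2))"
          unfolding L2_norm_eq[OF m(1)] using q(3) by (intro real_sqrt_le_mono) simp
        also have "\<dots> = sqrt K * L2_norm_of M f" unfolding L2_norm_eq[OF m(3)] by (rule real_sqrt_mult)
        finally show "L2_norm_of M p \<le> sqrt K * L2_norm_of M (\<lambda>x. L p x - l * p x)" by (simp add: f_def[abs_def])
      qed
    qed
    then show False using l by (simp add: cev_spectrum_def op_spectrum_def)
  qed
qed

end

subsection \<open>The decaying solution\<close>

context cev
begin

lemma cev_p_eq:
  "cev_p \<mu> \<sigma> \<gamma> \<Lambda> c x = c * (n * (2 - \<gamma>) * x powr (1 - \<gamma>) * tricomi \<Lambda> (1 + 1 / (2 - \<gamma>)) (n * x powr (2 - \<gamma>)))"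
  by (simp add: cev_p_def n_def)

text \<open>\<open>Y\<close> satisfies \<open>x * Y' = (2 - \<gamma>) * Y\<close>, so derivatives in
  \<open>x\<close> stay within powers of \<open>x\<close> times functions of \<open>Y\<close>. In
  the quasi-derivative the powers \<open>x powr \<gamma>\<close> and
  \<open>x powr (- \<gamma>)\<close> cancel, leaving a constant times \<open>W * A\<close>.\<close>

lemma kummer_to_sturm_liouville:
  assumes U: "\<And>y. y > 0 \<Longrightarrow> (U has_real_derivative U' y) (at y)" "\<And>y. y > 0 \<Longrightarrow> (U' has_real_derivative U'' y) (at y)"
    and ode: "\<And>y. y > 0 \<Longrightarrow> y * U'' y + (1 + 1 / (2 - \<gamma>) - y) * U' y - \<Lambda> * U y = 0"
    and l: "l = \<mu> * (2 - \<gamma>) * (\<Lambda> - 1)"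
  defines "Y \<equiv> \<lambda>x. n * x powr (2 - \<gamma>)"
  shows "sol l (\<lambda>x. n * (2 - \<gamma>) * x powr (1 - \<gamma>) * U (Y x))
    (\<lambda>x. n * (2 - \<gamma>) * x powr (- \<gamma>) * ((1 - \<gamma>) * U (Y x) + (2 - \<gamma>) * Y x * U' (Y x)))"
  unfolding sol_def
proof (intro allI impI conjI)
  fix x :: real assume x: "x > 0"
  \<comment> \<open>With \<open>\<gamma>\<close> expressed through \<open>e\<close>, the concluding
    identity is polynomial in \<open>e\<close>, \<open>y\<close>, \<open>\<Lambda>\<close>,
    \<open>\<phi>\<close> and \<open>\<psi>\<close>.\<close>
  define e where "e = 2 - \<gamma>"
  define C where "C = n * e"
  have e: "e > 0" "1 - \<gamma> = e - 1" "\<gamma> = 2 - e" using gam by (auto simp: e_def)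
  have Yp: "Y t > 0" if "t > 0" for t using that n_pos by (simp add: Y_def)
  have Yd: "(Y has_real_derivative e * Y t / t) (at t)" if "t > 0" for t
  proof -
    have "(Y has_real_derivative n * ((2 - \<gamma>) * t powr (2 - \<gamma> - 1))) (at t)"
      unfolding Y_def using that by (auto intro!: derivative_eq_intros)
    moreover have "n * ((2 - \<gamma>) * t powr (2 - \<gamma> - 1)) = e * Y t / t"
      unfolding powr_diff[of t "2 - \<gamma>" 1] using that by (simp add: Y_def e_def)
    ultimately show ?thesis by simp
  qed
  have UY: "((\<lambda>x. U (Y x)) has_real_derivative U' (Y x) * (e * Y x / x)) (at x)"
    by (rule DERIV_chain2[OF U(1)[OF Yp[OF x]] Yd[OF x]])
  have U'Y: "((\<lambda>x. U' (Y x)) has_real_derivative U'' (Y x) * (e * Y x / x)) (at x)"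
    by (rule DERIV_chain2[OF U(2)[OF Yp[OF x]] Yd[OF x]])
  have pw: "((\<lambda>x. x powr (1 - \<gamma>)) has_real_derivative (1 - \<gamma>) * x powr (- \<gamma>)) (at x)"
    using x by (auto intro!: derivative_eq_intros)
  have px: "x powr (1 - \<gamma>) = x * x powr (- \<gamma>)" using x by (simp add: powr_diff powr_minus divide_inverse)
  have d0: "((\<lambda>x. C * (x powr (1 - \<gamma>) * U (Y x))) has_real_derivative
     C * ((1 - \<gamma>) * x powr (- \<gamma>) * U (Y x) + U' (Y x) * (e * Y x / x) * x powr (1 - \<gamma>))) (at x)"
    by (intro DERIV_cmult DERIV_mult pw UY)
  have e1: "U' (Y x) * (e * Y x / x) * x powr (1 - \<gamma>) = U' (Y x) * (e * Y x) * x powr (- \<gamma>)"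
    unfolding px using x by simp
  have e2: "C * ((1 - \<gamma>) * x powr (- \<gamma>) * U (Y x) + U' (Y x) * (e * Y x / x) * x powr (1 - \<gamma>)) =
     n * (2 - \<gamma>) * x powr (- \<gamma>) * ((1 - \<gamma>) * U (Y x) + (2 - \<gamma>) * Y x * U' (Y x))"
    unfolding e1 by (simp add: C_def e_def algebra_simps)
  have e3: "(\<lambda>x. C * (x powr (1 - \<gamma>) * U (Y x))) = (\<lambda>x. n * (2 - \<gamma>) * x powr (1 - \<gamma>) * U (Y x))"
    by (simp add: C_def e_def mult.assoc)
  show "((\<lambda>x. n * (2 - \<gamma>) * x powr (1 - \<gamma>) * U (Y x)) has_real_derivative
     n * (2 - \<gamma>) * x powr (- \<gamma>) * ((1 - \<gamma>) * U (Y x) + (2 - \<gamma>) * Y x * U' (Y x))) (at x)"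
    using d0 unfolding e2 e3 .
  define A where "A x = (1 - \<gamma>) * U (Y x) + e * (Y x * U' (Y x))" for x
  have Ad: "(A has_real_derivative (1 - \<gamma>) * (U' (Y x) * (e * Y x / x)) +
      e * (e * Y x / x * U' (Y x) + U'' (Y x) * (e * Y x / x) * Y x)) (at x)"
    unfolding A_def by (intro DERIV_add DERIV_cmult DERIV_mult UY U'Y Yd x)
  have d: "((\<lambda>x. C * k * (W x * A x)) has_real_derivative C * k * (W x * (\<gamma> / x - n * (2 - \<gamma>) * x powr (1 - \<gamma>)) * A x +
      ((1 - \<gamma>) * (U' (Y x) * (e * Y x / x)) + e * (e * Y x / x * U' (Y x) + U'' (Y x) * (e * Y x / x) * Y x)) * W x)) (at x)"
    by (intro DERIV_cmult DERIV_mult W_deriv Ad x)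
  have eq: "C * k * (W x * (\<gamma> / x - n * (2 - \<gamma>) * x powr (1 - \<gamma>)) * A x +
      ((1 - \<gamma>) * (U' (Y x) * (e * Y x / x)) + e * (e * Y x / x * U' (Y x) + U'' (Y x) * (e * Y x / x) * Y x)) * W x)
      = (l * W x - Q0 x) * (n * (2 - \<gamma>) * x powr (1 - \<gamma>) * U (Y x))"
  proof -
    define y where "y = Y x"
    define \<phi> where "\<phi> = U y"
    define \<psi> where "\<psi> = U' y"
    define z where "z = y * U'' y"
    \<comment> \<open>Kummer's equation multiplied by \<open>e\<close>, which clears the denominator
      of \<open>1 + 1 / e\<close>; it eliminates the second derivative.\<close>
    have z: "e * z = e * \<Lambda> * \<phi> - (e + 1 - e * y) * \<psi>"
    proof -
      have "z = \<Lambda> * \<phi> - (1 + 1 / e - y) * \<psi>"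
        using ode[OF Yp[OF x]] by (simp add: z_def y_def \<phi>_def \<psi>_def e_def)
      then show ?thesis using e(1) by (simp add: field_simps)
    qed
    have nx: "n * x powr (1 - \<gamma>) = y / x"
      using x powr_diff[of x "2 - \<gamma>" 1] by (simp add: y_def Y_def)
    have g2: "x powr (\<gamma> - 2) * x powr (1 - \<gamma>) = 1 / x"
      using x by (simp add: powr_minus_divide flip: powr_add)
    \<comment> \<open>\<open>Q0\<close> contains \<open>- \<mu> W\<close>, so the spectral parameter
      occurs as \<open>l + \<mu>\<close>. The relation between \<open>l\<close> and
      \<open>\<Lambda>\<close> enters here.\<close>
    have lmu: "l + \<mu> = k * n * e * (e * \<Lambda> - e + 1)"
    proof -
      have "l + \<mu> = (k * n * (2 - \<gamma>)) * ((2 - \<gamma>) * (\<Lambda> - 1) + 1)"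
        unfolding mu_eq l by (simp add: algebra_simps)
      also have "\<dots> = k * n * e * (e * \<Lambda> - e + 1)" unfolding e_def[symmetric] by (simp add: algebra_simps)
      finally show ?thesis .
    qed
    have "C * k * (W x * (\<gamma> / x - n * (2 - \<gamma>) * x powr (1 - \<gamma>)) * A x +
      ((1 - \<gamma>) * (U' (Y x) * (e * Y x / x)) + e * (e * Y x / x * U' (Y x) + U'' (Y x) * (e * Y x / x) * Y x)) * W x)
      = C * k * W x / x * ((\<gamma> - e * y) * ((1 - \<gamma>) * \<phi> + e * y * \<psi>) + e * y * ((1 - \<gamma> + e) * \<psi> + e * z))"
    proof -
      have "n * (2 - \<gamma>) * x powr (1 - \<gamma>) = e * (y / x)" unfolding nx[symmetric] by (simp add: e_def)
      then show ?thesis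
        unfolding A_def y_def[symmetric] \<phi>_def[symmetric] \<psi>_def[symmetric]
        using x by (simp add: z_def field_simps)
    qed
    also have "(\<gamma> - e * y) * ((1 - \<gamma>) * \<phi> + e * y * \<psi>) + e * y * ((1 - \<gamma> + e) * \<psi> + e * z)
       = (e * y * (e * \<Lambda> - e + 1) + \<gamma> * (1 - \<gamma>)) * \<phi>"
      unfolding z unfolding e(2) unfolding e(3) by (simp add: algebra_simps)
    also have "C * k * W x / x * ((e * y * (e * \<Lambda> - e + 1) + \<gamma> * (1 - \<gamma>)) * \<phi>) =
       W x * C * \<phi> * (k * e * (e * \<Lambda> - e + 1) * (y / x) - k * \<gamma> * (\<gamma> - 1) * (1 / x))"
      using x by (simp add: field_simps)
    also have "\<dots> = W x * C * \<phi> * ((l + \<mu>) * x powr (1 - \<gamma>) - k * \<gamma> * (\<gamma> - 1) * (x powr (\<gamma> - 2) * x powr (1 - \<gamma>)))"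
      unfolding g2 lmu nx[symmetric] by (simp add: mult_ac)
    also have "\<dots> = (l * W x - Q0 x) * (n * (2 - \<gamma>) * x powr (1 - \<gamma>) * U (Y x))"
      by (simp add: Q0_eq C_def e_def \<phi>_def y_def algebra_simps)
    finally show ?thesis .
  qed
  have "((\<lambda>x. C * k * (W x * A x)) has_real_derivative (l * W x - Q0 x) * (n * (2 - \<gamma>) * x powr (1 - \<gamma>) * U (Y x))) (at x)"
    using d unfolding eq .
  then show "((\<lambda>t. Q2 t * (n * (2 - \<gamma>) * t powr (- \<gamma>) * ((1 - \<gamma>) * U (Y t) + (2 - \<gamma>) * Y t * U' (Y t)))) has_real_derivative
      (l * W x - Q0 x) * (n * (2 - \<gamma>) * x powr (1 - \<gamma>) * U (Y x))) (at x)"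
  proof (rule has_field_derivative_transform_within_open)
    show "C * k * (W t * A t) = Q2 t * (n * (2 - \<gamma>) * t powr (- \<gamma>) * ((1 - \<gamma>) * U (Y t) + (2 - \<gamma>) * Y t * U' (Y t)))"
      if "t \<in> {0<..}" for t
    proof -
      have "Q2 t * (n * (2 - \<gamma>) * t powr (- \<gamma>) * ((1 - \<gamma>) * U (Y t) + (2 - \<gamma>) * Y t * U' (Y t))) =
        (t powr \<gamma> * t powr (- \<gamma>)) * (C * k * (W t * A t))"
        by (simp add: Q2_eq A_def C_def e_def mult_ac)
      also have "t powr \<gamma> * t powr (- \<gamma>) = 1" using that by (simp add: powr_minus)
      finally show ?thesis by simp
    qed
  qed (use x in auto)
qed

text \<open>Substituting \<open>y = n x powr (2 - \<gamma>)\<close> turns the two boundary forms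
  into multiples of \<open>y powr (1 + a) * U'\<close> and \<open>a U + y U'\<close>, the
  combinations whose limits \<open>tricomi_exponents\<close> provides. They are the boundary values
  with which \<open>cev_sol\<close> is instantiated.\<close>

lemma cev_p_facts:
  assumes \<Lambda>: "\<Lambda> > 1" and l: "l = \<mu> * (2 - \<gamma>) * (\<Lambda> - 1)"
  defines "a \<equiv> 1 / (2 - \<gamma>)"
  obtains u' Cu \<alpha> K2 where
    "cev_sol \<mu> \<sigma> \<gamma> l (cev_p \<mu> \<sigma> \<gamma> \<Lambda> 1) u' Cu ((2 - \<gamma>) * (\<Lambda> - 1) + 1) \<alpha>
      (n * (2 - \<gamma>) * a * (Gamma (- a) * rGamma (\<Lambda> - a)))
      (- (n * (2 - \<gamma>)\<^sup>2 * n powr (- a) * (Gamma (1 + a) * rGamma \<Lambda>)))"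
    "K2 > 0" "cev_p \<mu> \<sigma> \<gamma> \<Lambda> 1 \<sim>[at_top] (\<lambda>x. K2 * x powr ((2 - \<gamma>) * (1 - \<Lambda>) - 1))"
proof -
  have a: "0 < a" "a < 1" "(2 - \<gamma>) * a = 1" using gam by (auto simp: a_def field_simps)
  define U where "U = tricomi \<Lambda> (1 + a)"
  obtain U' U'' where U:
    "\<And>y. y > 0 \<Longrightarrow> (U has_real_derivative U' y) (at y)"
    "\<And>y. y > 0 \<Longrightarrow> (U' has_real_derivative U'' y) (at y)"
    "\<And>y. y > 0 \<Longrightarrow> y * U'' y + (1 + a - y) * U' y - \<Lambda> * U y = 0"
    "\<And>y. y > 0 \<Longrightarrow> U y > 0" "\<And>y. y > 0 \<Longrightarrow> U' y < 0"
    "U \<sim>[at_top] (\<lambda>y. y powr (- \<Lambda>))"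
    "((\<lambda>y. y powr (1 + a) * U' y) \<longlongrightarrow> - (Gamma (1 + a) * rGamma \<Lambda>)) (at_right 0)"
    "((\<lambda>y. a * U y + y * U' y) \<longlongrightarrow> a * (Gamma (- a) * rGamma (\<Lambda> - a))) (at_right 0)"
    by (rule tricomi_exponents[OF a(1,2) \<Lambda>, folded U_def], rule that)
  define G where "G = Gamma (1 + a) * rGamma \<Lambda>"
  have G: "G > 0" using a \<Lambda> by (auto simp: G_def rGamma_inverse_Gamma intro!: mult_pos_pos Gamma_real_pos)
  define Y where "Y x = n * x powr (2 - \<gamma>)" for x
  define C where "C = n * (2 - \<gamma>)"
  have C: "C > 0" using n_pos gam by (simp add: C_def)
  have Yp: "Y x > 0" if "x > 0" for x using that n_pos by (simp add: Y_def)
  define u where "u x = C * x powr (1 - \<gamma>) * U (Y x)" for x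
  have u: "cev_p \<mu> \<sigma> \<gamma> \<Lambda> 1 = u"
    by (auto simp: cev_p_eq u_def U_def a_def C_def Y_def)
  define u' where "u' x = C * x powr (- \<gamma>) * ((1 - \<gamma>) * U (Y x) + (2 - \<gamma>) * Y x * U' (Y x))" for x
  have usol: "sol l u u'"
    unfolding u_def[abs_def] u'_def[abs_def] Y_def C_def
    by (rule kummer_to_sturm_liouville[OF U(1,2) U(3)[unfolded a_def] l])
  have upos: "u x > 0" if "x > 0" for x using U(4)[OF Yp[OF that]] C that by (simp add: u_def)
  have px: "x powr (1 - \<gamma>) = x * x powr (- \<gamma>)" if "x > 0" for x using that by (simp add: powr_diff powr_minus divide_inverse)
  \<comment> \<open>\<open>U\<close> is decreasing, so only the factor
    \<open>x powr (1 - \<gamma>)\<close> can make \<open>u\<close> grow.\<close>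
  have ulog: "x * u' x \<le> (1 - \<gamma>) * u x" if x: "x > 0" for x
  proof -
    have "(2 - \<gamma>) * Y x * U' (Y x) \<le> 0"
      using U(5)[OF Yp[OF x]] Yp[OF x] gam by (intro mult_nonneg_nonpos) auto
    then have "C * x powr (1 - \<gamma>) * ((2 - \<gamma>) * Y x * U' (Y x)) \<le> 0"
      using C by (intro mult_nonneg_nonpos[of "C * x powr (1 - \<gamma>)"]) auto
    moreover have "x * u' x = (1 - \<gamma>) * u x + C * x powr (1 - \<gamma>) * ((2 - \<gamma>) * Y x * U' (Y x))"
      unfolding u'_def u_def px[OF x] by (simp add: algebra_simps)
    ultimately show ?thesis by simp
  qed
  have Ytop: "filterlim Y at_top at_top"
    unfolding Y_def using n_pos gam by real_asymp
  have Y0: "filterlim Y (at_right 0) (at_right 0)"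
    unfolding Y_def using n_pos gam by real_asymp
  \<comment> \<open>The decay exponent: \<open>y powr (- \<Lambda>)\<close> times
    \<open>x powr (1 - \<gamma>)\<close> is of order \<open>x powr (- \<rho>)\<close>, and
    \<open>\<Lambda> > 1\<close> makes \<open>\<rho> > 1\<close>.\<close>
  define \<rho> where "\<rho> = (2 - \<gamma>) * (\<Lambda> - 1) + 1"
  define K2 where "K2 = C * n powr (- \<Lambda>)"
  have K2: "K2 > 0" using C n_pos by (simp add: K2_def)
  have asy: "u \<sim>[at_top] (\<lambda>x. K2 * x powr (- \<rho>))"
  proof -
    have "(\<lambda>x. U (Y x)) \<sim>[at_top] (\<lambda>x. (Y x) powr (- \<Lambda>))"
      by (rule asymp_equiv_compose'[OF U(6) Ytop])
    then have "u \<sim>[at_top] (\<lambda>x. C * x powr (1 - \<gamma>) * (Y x) powr (- \<Lambda>))"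
      unfolding u_def[abs_def] by (intro asymp_equiv_mult asymp_equiv_refl)
    also have "\<dots> \<sim>[at_top] (\<lambda>x. K2 * x powr (- \<rho>))"
    proof (rule asymp_equiv_refl_ev, rule eventually_mono[OF eventually_gt_at_top[of 0]])
      fix x :: real assume x: "x > 0"
      have "(Y x) powr (- \<Lambda>) = n powr (- \<Lambda>) * x powr ((2 - \<gamma>) * (- \<Lambda>))"
        using x n_pos by (simp add: Y_def powr_mult powr_powr)
      then have "C * x powr (1 - \<gamma>) * (Y x) powr (- \<Lambda>) = K2 * x powr ((1 - \<gamma>) + (2 - \<gamma>) * (- \<Lambda>))"
        unfolding powr_add K2_def by simp
      also have "(1 - \<gamma>) + (2 - \<gamma>) * (- \<Lambda>) = - \<rho>" by (simp add: \<rho>_def algebra_simps)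
      finally show "C * x powr (1 - \<gamma>) * (Y x) powr (- \<Lambda>) = K2 * x powr (- \<rho>)" .
    qed
    finally show ?thesis .
  qed
  \<comment> \<open>The asymptotic equivalence becomes a bound that is valid from
    \<open>x = 1\<close> on.\<close>
  define f where "f = (\<lambda>x. u x / (K2 * x powr (- \<rho>)))"
  have "\<forall>\<^sub>F x in at_top. u x \<noteq> 0 \<or> K2 * x powr (- \<rho>) \<noteq> 0"
    by (rule eventually_mono[OF eventually_gt_at_top[of 0]]) (use K2 in simp)
  then have "(f \<longlongrightarrow> 1) at_top" unfolding f_def by (rule asymp_equivD_strong[OF asy])
  moreover have "continuous_on {0<..} f"
    unfolding f_def using K2 by (intro continuous_intros sol_cont(1)[OF usol]) auto
  moreover have "f x > 0" if "x > 0" for x using upos[OF that] K2 that by (simp add: f_def)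
  ultimately obtain c0 Cb where "c0 > 0" "Cb > 0" and Cb: "\<And>x. x \<ge> 1 \<Longrightarrow> c0 \<le> f x \<and> f x \<le> Cb"
    using continuous_pos_limit_bounds[of f 1 1] by auto
  have uinf: "u x \<le> Cb * K2 * x powr (- \<rho>)" if x: "x \<ge> 1" for x
    using Cb[OF x] K2 x by (simp add: f_def pos_divide_le_eq mult.assoc)
  \<comment> \<open>The form annihilates the prefactor \<open>x powr (1 - \<gamma>)\<close>, so only
    the term with \<open>U'\<close> survives; the extra \<open>x\<close> equals
    \<open>n powr (- a) * Y powr a\<close>.\<close>
  have bin: "cev_bdry_inf \<gamma> u x = - (- (C * (2 - \<gamma>) * n powr (- a)) * (Y x powr (1 + a) * U' (Y x)))" if x: "x > 0" for x
  proof -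
    have "Y x powr a = n powr a * x" using x n_pos a by (simp add: Y_def powr_mult powr_powr)
    then have xY: "x = n powr (- a) * Y x powr a" using n_pos by (simp add: powr_minus)
    have "cev_bdry_inf \<gamma> u x = x powr \<gamma> * (x * u' x + (\<gamma> - 1) * u x)"
      using DERIV_imp_deriv[OF solD(1)[OF usol x]] by (simp add: cev_bdry_inf_def)
    also have "\<dots> = (x powr \<gamma> * x powr (- \<gamma>)) * (C * (2 - \<gamma>) * x * Y x * U' (Y x))"
      unfolding u'_def u_def px[OF x] by (simp add: algebra_simps)
    also have "x powr \<gamma> * x powr (- \<gamma>) = 1" using x by (simp add: powr_minus)
    also have "1 * (C * (2 - \<gamma>) * x * Y x * U' (Y x)) = C * (2 - \<gamma>) * (n powr (- a) * Y x powr a) * Y x * U' (Y x)"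
      using xY by simp
    also have "\<dots> = C * (2 - \<gamma>) * n powr (- a) * (Y x powr (1 + a) * U' (Y x))"
      using Yp[OF x] by (simp add: powr_add mult_ac)
    finally show ?thesis by simp
  qed
  \<comment> \<open>The coefficients \<open>\<gamma>\<close> and \<open>1 - \<gamma>\<close> of
    \<open>U\<close> add up to \<open>1\<close>, and \<open>(2 - \<gamma>) * a = 1\<close>
    normalises the term with \<open>U'\<close>.\<close>
  have bif: "cev_bdry_fin \<gamma> u x = C * (a * U (Y x) + Y x * U' (Y x))" if x: "x > 0" for x
  proof -
    have "cev_bdry_fin \<gamma> u x = a * (\<gamma> * x powr (\<gamma> - 1) * u x + x powr \<gamma> * u' x)"
      using DERIV_imp_deriv[OF solD(1)[OF usol x]] by (simp add: cev_bdry_fin_def a_def distrib_left)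
    also have "\<gamma> * x powr (\<gamma> - 1) * u x = (x powr \<gamma> * x powr (- \<gamma>)) * (\<gamma> * C * U (Y x))"
      unfolding u_def px[OF x] using x by (simp add: powr_diff)
    also have "x powr \<gamma> * u' x = (x powr \<gamma> * x powr (- \<gamma>)) * (C * ((1 - \<gamma>) * U (Y x) + (2 - \<gamma>) * Y x * U' (Y x)))"
      unfolding u'_def by simp
    also have "x powr \<gamma> * x powr (- \<gamma>) = 1" using x by (simp add: powr_minus)
    also have "a * (1 * (\<gamma> * C * U (Y x)) + 1 * (C * ((1 - \<gamma>) * U (Y x) + (2 - \<gamma>) * Y x * U' (Y x)))) =
       C * (a * U (Y x) + ((2 - \<gamma>) * a) * (Y x * U' (Y x)))" by (simp add: algebra_simps)
    finally show ?thesis unfolding a(3) by simp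
  qed
  have lim_inf: "((\<lambda>x. cev_bdry_inf \<gamma> u x) \<longlongrightarrow> - (n * (2 - \<gamma>)\<^sup>2 * n powr (- a) * (Gamma (1 + a) * rGamma \<Lambda>))) (at_right 0)"
  proof -
    have "((\<lambda>x. - (- (C * (2 - \<gamma>) * n powr (- a)) * (Y x powr (1 + a) * U' (Y x)))) \<longlongrightarrow>
        - (- (C * (2 - \<gamma>) * n powr (- a)) * (- (Gamma (1 + a) * rGamma \<Lambda>)))) (at_right 0)"
      by (intro tendsto_intros filterlim_compose[OF U(7) Y0])
    then have "((\<lambda>x. cev_bdry_inf \<gamma> u x) \<longlongrightarrow> - (- (C * (2 - \<gamma>) * n powr (- a)) * (- (Gamma (1 + a) * rGamma \<Lambda>)))) (at_right 0)"
      by (rule Lim_transform_eventually) (rule eventually_mono[OF eventually_at_right_less], simp add: bin)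
    then show ?thesis by (simp add: C_def power2_eq_square mult_ac)
  qed
  have lim_fin: "((\<lambda>x. cev_bdry_fin \<gamma> u x) \<longlongrightarrow> n * (2 - \<gamma>) * a * (Gamma (- a) * rGamma (\<Lambda> - a))) (at_right 0)"
  proof -
    have "((\<lambda>x. C * (a * U (Y x) + Y x * U' (Y x))) \<longlongrightarrow> C * (a * (Gamma (- a) * rGamma (\<Lambda> - a)))) (at_right 0)"
      by (intro tendsto_mult tendsto_const filterlim_compose[OF U(8) Y0])
    then have "((\<lambda>x. cev_bdry_fin \<gamma> u x) \<longlongrightarrow> C * (a * (Gamma (- a) * rGamma (\<Lambda> - a)))) (at_right 0)"
      by (rule Lim_transform_eventually) (rule eventually_mono[OF eventually_at_right_less], simp add: bif)
    then show ?thesis by (simp add: C_def mult_ac)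
  qed
  define \<alpha> where "\<alpha> = C * n powr (- a) * (G / a)"
  have \<alpha>: "\<alpha> > 0" using C n_pos G a by (simp add: \<alpha>_def)
  have lim_zero: "((\<lambda>x. x powr \<gamma> * u x) \<longlongrightarrow> \<alpha>) (at_right 0)"
  proof -
    \<comment> \<open>\<open>y powr a * U\<close> is recovered from the two known limits. The
      regular one is multiplied by \<open>y powr a\<close>, which tends to \<open>0\<close>, so only
      the singular coefficient is left.\<close>
    have "((\<lambda>y. (y powr a * (a * U y + y * U' y) - y powr (1 + a) * U' y) / a) \<longlongrightarrow>
       (0 powr a * (a * (Gamma (- a) * rGamma (\<Lambda> - a))) - - (Gamma (1 + a) * rGamma \<Lambda>)) / a) (at_right 0)"
      using a by (intro tendsto_intros U(7,8)) (auto simp: eventually_at_right_field intro!: exI[of _ 1])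
    then have "((\<lambda>y. (y powr a * (a * U y + y * U' y) - y powr (1 + a) * U' y) / a) \<longlongrightarrow> G / a) (at_right 0)"
      using a by (simp add: G_def)
    then have "((\<lambda>y. y powr a * U y) \<longlongrightarrow> G / a) (at_right 0)"
    proof (rule Lim_transform_eventually)
      show "\<forall>\<^sub>F y in at_right 0. (y powr a * (a * U y + y * U' y) - y powr (1 + a) * U' y) / a = y powr a * U y"
        by (rule eventually_mono[OF eventually_at_right_less]) (use a in \<open>simp add: powr_add field_simps\<close>)
    qed
    then have "((\<lambda>x. C * n powr (- a) * (Y x powr a * U (Y x))) \<longlongrightarrow> \<alpha>) (at_right 0)"
      unfolding \<alpha>_def by (intro tendsto_mult tendsto_const filterlim_compose[OF _ Y0])
    then show ?thesis
    proof (rule Lim_transform_eventually)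
      show "\<forall>\<^sub>F x in at_right 0. C * n powr (- a) * (Y x powr a * U (Y x)) = x powr \<gamma> * u x"
      proof (rule eventually_mono[OF eventually_at_right_less])
        fix x :: real assume x: "x > 0"
        have "Y x powr a = n powr a * x" using x n_pos a by (simp add: Y_def powr_mult powr_powr)
        moreover have "n powr (- a) * n powr a = 1" using n_pos by (simp add: powr_minus)
        ultimately have "C * n powr (- a) * (Y x powr a * U (Y x)) = C * x * U (Y x)"
          by (metis (no_types, lifting) mult.assoc mult.left_commute mult_1)
        moreover have "x powr \<gamma> * u x = (x powr \<gamma> * x powr (- \<gamma>)) * (C * x * U (Y x))"
          unfolding u_def px[OF x] by simp
        moreover have "x powr \<gamma> * x powr (- \<gamma>) = 1" using x by (simp add: powr_minus)
        ultimately show "C * n powr (- a) * (Y x powr a * U (Y x)) = x powr \<gamma> * u x" by simp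
      qed
    qed
  qed
  have \<rho>: "\<rho> > 1" using \<Lambda> gam by (simp add: \<rho>_def)
  have "n * (2 - \<gamma>)\<^sup>2 * n powr (- a) * G > 0" using n_pos gam G by (intro mult_pos_pos) auto
  then have nz: "- (n * (2 - \<gamma>)\<^sup>2 * n powr (- a) * (Gamma (1 + a) * rGamma \<Lambda>)) \<noteq> 0"
    unfolding G_def by (metis less_irrefl neg_equal_0_iff_equal)
  have "cev_sol \<mu> \<sigma> \<gamma> l u u' (Cb * K2) \<rho> \<alpha>
      (n * (2 - \<gamma>) * a * (Gamma (- a) * rGamma (\<Lambda> - a)))
      (- (n * (2 - \<gamma>)\<^sup>2 * n powr (- a) * (Gamma (1 + a) * rGamma \<Lambda>)))"
    by (intro cev_sol.intro cev_axioms cev_sol_axioms.intro usol upos ulog uinf \<rho> lim_zero \<alpha> lim_fin lim_inf nz)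
  moreover have "- \<rho> = (2 - \<gamma>) * (1 - \<Lambda>) - 1" by (simp add: \<rho>_def algebra_simps)
  ultimately show thesis using that[unfolded u, of u' "Cb * K2" \<alpha> K2] K2 asy unfolding \<rho>_def by simp
qed

end

theorem mainTheorem4:
  fixes \<mu> \<sigma> \<gamma> a :: real
  assumes "\<mu> > 0" and "\<sigma> > 0" and "0 < \<gamma>" and "\<gamma> < 1" and "a = 1 / (2 - \<gamma>)"
  shows
    "(\<forall>l>0. \<exists>!\<theta>. l \<in> cev_spectrum \<mu> \<sigma> \<gamma> \<theta>)
     \<and> (\<forall>l \<Lambda>. \<Lambda> > 1 \<and> l = \<mu> * (2 - \<gamma>) * (\<Lambda> - 1) \<longrightarrow>
          (\<exists>!\<theta>. Gamma (- a) * rGamma (\<Lambda> - a) + \<theta> * (Gamma (1 + a) * rGamma \<Lambda>) = 0)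
          \<and> (\<forall>\<theta>. l \<in> cev_spectrum \<mu> \<sigma> \<gamma> \<theta> \<longleftrightarrow>
                Gamma (- a) * rGamma (\<Lambda> - a) + \<theta> * (Gamma (1 + a) * rGamma \<Lambda>) = 0)
          \<and> (\<forall>\<theta>. l \<in> cev_spectrum \<mu> \<sigma> \<gamma> \<theta> \<longrightarrow>
                (\<forall>p. cev_eigenfunction \<mu> \<sigma> \<gamma> \<theta> l p \<longleftrightarrow>
                     (\<exists>c. c \<noteq> 0 \<and> (\<forall>x>0. p x = cev_p \<mu> \<sigma> \<gamma> \<Lambda> c x))))
          \<and> (\<forall>c>0.
                (\<forall>x>0. cev_p \<mu> \<sigma> \<gamma> \<Lambda> c x \<ge> 0)
                \<and> integrable (lebesgue_on {0<..}) (cev_p \<mu> \<sigma> \<gamma> \<Lambda> c)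
                \<and> (\<exists>K1>0. \<exists>K2>0.
                      cev_p \<mu> \<sigma> \<gamma> \<Lambda> c \<sim>[at_right 0] (\<lambda>x. K1 * x powr (- \<gamma>))
                      \<and> cev_p \<mu> \<sigma> \<gamma> \<Lambda> c \<sim>[at_top]
                           (\<lambda>x. K2 * x powr ((2 - \<gamma>) * (1 - \<Lambda>) - 1)))))
     \<and> \<not> (\<exists>l p. cev_eigenfunction_infinity \<mu> \<sigma> \<gamma> l p \<and> integrable (lebesgue_on {0<..}) p)"
proof -
  interpret cev \<mu> \<sigma> \<gamma> by standard (use assms in auto)
  have a: "0 < a" "a < 1" "(2 - \<gamma>) * a = 1"
    unfolding assms(5) using assms(3,4) by (auto simp: field_simps)
  let ?eq = "\<lambda>\<Lambda> \<theta>. Gamma (- a) * rGamma (\<Lambda> - a) + \<theta> * (Gamma (1 + a) * rGamma \<Lambda>) = 0"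
  have ex1: "\<exists>!\<theta>. ?eq \<Lambda> \<theta>" if "\<Lambda> > 1" for \<Lambda>
  proof -
    have "Gamma (1 + a) * rGamma \<Lambda> > 0"
      using a that by (auto simp: rGamma_inverse_Gamma intro!: mult_pos_pos Gamma_real_pos)
    moreover have "\<exists>!\<theta>. X + \<theta> * Y = 0" if "Y > 0" for X Y :: real
    proof (rule ex1I[of _ "- X / Y"])
      fix \<theta> assume "X + \<theta> * Y = 0"
      then have "\<theta> * Y = - X" by linarith
      then have "\<theta> * Y / Y = - X / Y" by (rule arg_cong)
      then show "\<theta> = - X / Y" using that by simp
    qed (use that in simp)
    ultimately show ?thesis by blast
  qed
  have main: "(l \<in> cev_spectrum \<mu> \<sigma> \<gamma> \<theta> \<longleftrightarrow> ?eq \<Lambda> \<theta>) \<and>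
      (l \<in> cev_spectrum \<mu> \<sigma> \<gamma> \<theta> \<longrightarrow> (cev_eigenfunction \<mu> \<sigma> \<gamma> \<theta> l p \<longleftrightarrow> (\<exists>c. c \<noteq> 0 \<and> (\<forall>x>0. p x = cev_p \<mu> \<sigma> \<gamma> \<Lambda> c x)))) \<and>
      (c > 0 \<longrightarrow> (\<forall>x>0. cev_p \<mu> \<sigma> \<gamma> \<Lambda> c x \<ge> 0)
                \<and> integrable (lebesgue_on {0<..}) (cev_p \<mu> \<sigma> \<gamma> \<Lambda> c)
                \<and> (\<exists>K1>0. \<exists>K2>0.
                      cev_p \<mu> \<sigma> \<gamma> \<Lambda> c \<sim>[at_right 0] (\<lambda>x. K1 * x powr (- \<gamma>))
                      \<and> cev_p \<mu> \<sigma> \<gamma> \<Lambda> c \<sim>[at_top]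
                           (\<lambda>x. K2 * x powr ((2 - \<gamma>) * (1 - \<Lambda>) - 1)))) \<and>
      \<not> cev_eigenfunction_infinity \<mu> \<sigma> \<gamma> l p"
    if \<Lambda>: "\<Lambda> > 1" and l: "l = \<mu> * (2 - \<gamma>) * (\<Lambda> - 1)" for l \<Lambda> \<theta> p c
  proof -
    define b0 where "b0 = n * (2 - \<gamma>) * a * (Gamma (- a) * rGamma (\<Lambda> - a))"
    define i0 where "i0 = - (n * (2 - \<gamma>)\<^sup>2 * n powr (- a) * (Gamma (1 + a) * rGamma \<Lambda>))"
    define u where "u = cev_p \<mu> \<sigma> \<gamma> \<Lambda> 1"
    obtain u' Cu \<alpha> K2 where S: "cev_sol \<mu> \<sigma> \<gamma> l u u' Cu ((2 - \<gamma>) * (\<Lambda> - 1) + 1) \<alpha> b0 i0"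
      and K2: "K2 > 0" "u \<sim>[at_top] (\<lambda>x. K2 * x powr ((2 - \<gamma>) * (1 - \<Lambda>) - 1))"
      by (rule cev_p_facts[OF \<Lambda> l, folded assms(5), folded u_def b0_def i0_def], rule that)
    interpret cev_sol \<mu> \<sigma> \<gamma> l u u' Cu "(2 - \<gamma>) * (\<Lambda> - 1) + 1" \<alpha> b0 i0 by (rule S)
    have cu: "cev_p \<mu> \<sigma> \<gamma> \<Lambda> c x = c * u x" for c x by (simp add: u_def cev_p_eq)
    \<comment> \<open>The powers of \<open>n\<close> and of \<open>2 - \<gamma>\<close> in
      \<open>i0\<close> and in the scaling cancel, leaving \<open>n\<close> as a common
      factor.\<close>
    have "b0 - scaled_param \<theta> * i0 = n * ((2 - \<gamma>) * a) * (Gamma (- a) * rGamma (\<Lambda> - a)) +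
        \<theta> * (n powr a * n powr (- a)) * n * ((2 - \<gamma>)\<^sup>2 / (2 - \<gamma>)\<^sup>2) * (Gamma (1 + a) * rGamma \<Lambda>)"
      by (simp add: b0_def i0_def scaled_param_def assms(5))
    also have "(2 - \<gamma>)\<^sup>2 / (2 - \<gamma>)\<^sup>2 = 1" using gam by simp
    also have "n powr a * n powr (- a) = 1" using n_pos by (simp add: powr_minus)
    finally have "b0 - scaled_param \<theta> * i0 = n * (Gamma (- a) * rGamma (\<Lambda> - a) + \<theta> * (Gamma (1 + a) * rGamma \<Lambda>))"
      unfolding a(3) by (simp add: algebra_simps)
    then have bi: "b0 - scaled_param \<theta> * i0 = 0 \<longleftrightarrow> ?eq \<Lambda> \<theta>" using n_pos by simp
    have cp: "(\<forall>x>0. cev_p \<mu> \<sigma> \<gamma> \<Lambda> c x \<ge> 0)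
                \<and> integrable (lebesgue_on {0<..}) (cev_p \<mu> \<sigma> \<gamma> \<Lambda> c)
                \<and> (\<exists>K1>0. \<exists>K2>0.
                      cev_p \<mu> \<sigma> \<gamma> \<Lambda> c \<sim>[at_right 0] (\<lambda>x. K1 * x powr (- \<gamma>))
                      \<and> cev_p \<mu> \<sigma> \<gamma> \<Lambda> c \<sim>[at_top]
                           (\<lambda>x. K2 * x powr ((2 - \<gamma>) * (1 - \<Lambda>) - 1)))" if c: "c > 0"
    proof (intro conjI)
      show "\<forall>x>0. cev_p \<mu> \<sigma> \<gamma> \<Lambda> c x \<ge> 0" using upos c by (simp add: cu less_imp_le)
      have "integrable leb_pos (\<lambda>x. c * u x)" using u_integrable by simp
      then show "integrable (lebesgue_on {0<..}) (cev_p \<mu> \<sigma> \<gamma> \<Lambda> c)" by (simp add: cu[abs_def])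
      have "cev_p \<mu> \<sigma> \<gamma> \<Lambda> c \<sim>[at_right 0] (\<lambda>x. (c * \<alpha>) * x powr (- \<gamma>))"
      proof (rule asymp_equivI')
        have "((\<lambda>x. x powr \<gamma> * u x / \<alpha>) \<longlongrightarrow> \<alpha> / \<alpha>) (at_right 0)"
          using u_zero by (intro tendsto_divide) auto
        then have "((\<lambda>x. x powr \<gamma> * u x / \<alpha>) \<longlongrightarrow> 1) (at_right 0)" using u_zero(2) by simp
        then show "((\<lambda>x. cev_p \<mu> \<sigma> \<gamma> \<Lambda> c x / ((c * \<alpha>) * x powr (- \<gamma>))) \<longlongrightarrow> 1) (at_right 0)"
          by (rule Lim_transform_eventually)
             (rule eventually_mono[OF eventually_at_right_less], use c in \<open>simp add: cu powr_minus field_simps\<close>)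
      qed
      moreover have "cev_p \<mu> \<sigma> \<gamma> \<Lambda> c \<sim>[at_top] (\<lambda>x. (c * K2) * x powr ((2 - \<gamma>) * (1 - \<Lambda>) - 1))"
        using asymp_equiv_mult[OF asymp_equiv_refl[of "\<lambda>_. c"] K2(2)] by (simp add: cu[abs_def] mult.assoc)
      moreover have "c * \<alpha> > 0" "c * K2 > 0" using c K2(1) u_zero(2) by auto
      ultimately show "\<exists>K1>0. \<exists>K2>0.
                      cev_p \<mu> \<sigma> \<gamma> \<Lambda> c \<sim>[at_right 0] (\<lambda>x. K1 * x powr (- \<gamma>))
                      \<and> cev_p \<mu> \<sigma> \<gamma> \<Lambda> c \<sim>[at_top]
                           (\<lambda>x. K2 * x powr ((2 - \<gamma>) * (1 - \<Lambda>) - 1))" by blast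
    qed
    have ev: "cev_eigenfunction \<mu> \<sigma> \<gamma> \<theta> l p \<longleftrightarrow> (\<exists>c. c \<noteq> 0 \<and> (\<forall>x>0. p x = cev_p \<mu> \<sigma> \<gamma> \<Lambda> c x))"
      if "l \<in> cev_spectrum \<mu> \<sigma> \<gamma> \<theta>"
      unfolding cu using that cev_spectrum_iff cev_eigenfunction_iff by blast
    show ?thesis
      by (intro conjI impI trans[OF cev_spectrum_iff bi] ev cp not_cev_eigenfunction_infinity)
  qed
  have first: "\<exists>!\<theta>. l \<in> cev_spectrum \<mu> \<sigma> \<gamma> \<theta>" if "l > 0" for l
  proof -
    \<comment> \<open>Inverts the relation between \<open>l\<close> and \<open>\<Lambda>\<close>;
      positivity of \<open>l\<close> becomes \<open>\<Lambda> > 1\<close>.\<close>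
    define \<Lambda> where "\<Lambda> = 1 + l / (\<mu> * (2 - \<gamma>))"
    have "\<Lambda> > 1" using that mu gam by (simp add: \<Lambda>_def)
    moreover have "l = \<mu> * (2 - \<gamma>) * (\<Lambda> - 1)" using mu gam by (simp add: \<Lambda>_def)
    ultimately show ?thesis using main[of \<Lambda> l] ex1[of \<Lambda>] by blast
  qed
  have last: "\<not> (cev_eigenfunction_infinity \<mu> \<sigma> \<gamma> l p \<and> integrable (lebesgue_on {0<..}) p)" for l p
  proof
    assume *: "cev_eigenfunction_infinity \<mu> \<sigma> \<gamma> l p \<and> integrable (lebesgue_on {0<..}) p"
    show False
    \<comment> \<open>For \<open>l > 0\<close> every square-integrable solution is a multiple of
      \<open>u\<close> and violates the boundary condition; for \<open>l \<le> 0\<close>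
      integrability alone forces the solution to vanish.\<close>
    proof (cases "l > 0")
      case True
      define \<Lambda> where "\<Lambda> = 1 + l / (\<mu> * (2 - \<gamma>))"
      have "\<Lambda> > 1" using True mu gam by (simp add: \<Lambda>_def)
      moreover have "l = \<mu> * (2 - \<gamma>) * (\<Lambda> - 1)" using mu gam by (simp add: \<Lambda>_def)
      ultimately show False using main[of \<Lambda> l] * by blast
    next
      case False
      have p: "p \<in> cev_Dmax \<mu> \<sigma> \<gamma>" "AE x in leb_pos. L p x = l * p x" and nz: "\<not> (AE x in leb_pos. p x = 0)"
        using * by (auto simp: cev_eigenfunction_infinity_def op_eigenfunction_def cev_domain_infinity_def AE_M_iff)
      have "p x = 0" if "x > 0" for x
        using integrable_sol_zero[OF eigenfunction_sol[OF p]] * False that by simp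
      then show False using nz AE_leb_pos_I[of "\<lambda>x. p x = 0"] by blast
    qed
  qed
  show ?thesis
  proof (rule conjI[OF _ conjI])
    show "\<forall>l>0. \<exists>!\<theta>. l \<in> cev_spectrum \<mu> \<sigma> \<gamma> \<theta>" using first by blast
    show "\<not> (\<exists>l p. cev_eigenfunction_infinity \<mu> \<sigma> \<gamma> l p \<and> integrable (lebesgue_on {0<..}) p)"
      using last by blast
    show "\<forall>l \<Lambda>. \<Lambda> > 1 \<and> l = \<mu> * (2 - \<gamma>) * (\<Lambda> - 1) \<longrightarrow>
          (\<exists>!\<theta>. ?eq \<Lambda> \<theta>)
          \<and> (\<forall>\<theta>. l \<in> cev_spectrum \<mu> \<sigma> \<gamma> \<theta> \<longleftrightarrow> ?eq \<Lambda> \<theta>)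
          \<and> (\<forall>\<theta>. l \<in> cev_spectrum \<mu> \<sigma> \<gamma> \<theta> \<longrightarrow>
                (\<forall>p. cev_eigenfunction \<mu> \<sigma> \<gamma> \<theta> l p \<longleftrightarrow>
                     (\<exists>c. c \<noteq> 0 \<and> (\<forall>x>0. p x = cev_p \<mu> \<sigma> \<gamma> \<Lambda> c x))))
          \<and> (\<forall>c>0.
                (\<forall>x>0. cev_p \<mu> \<sigma> \<gamma> \<Lambda> c x \<ge> 0)
                \<and> integrable (lebesgue_on {0<..}) (cev_p \<mu> \<sigma> \<gamma> \<Lambda> c)
                \<and> (\<exists>K1>0. \<exists>K2>0.
                      cev_p \<mu> \<sigma> \<gamma> \<Lambda> c \<sim>[at_right 0] (\<lambda>x. K1 * x powr (- \<gamma>))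
                      \<and> cev_p \<mu> \<sigma> \<gamma> \<Lambda> c \<sim>[at_top]
                           (\<lambda>x. K2 * x powr ((2 - \<gamma>) * (1 - \<Lambda>) - 1))))"
    proof (rule allI, rule allI, rule impI, elim conjE, rule conjI[OF ex1 conjI[OF _ conjI]])
      fix l \<Lambda> assume h: "\<Lambda> > 1" "l = \<mu> * (2 - \<gamma>) * (\<Lambda> - 1)"
      show "\<Lambda> > 1" by (rule h)
      show "\<forall>\<theta>. l \<in> cev_spectrum \<mu> \<sigma> \<gamma> \<theta> \<longleftrightarrow> ?eq \<Lambda> \<theta>"
        by (rule allI, rule main[OF h, THEN conjunct1])
      show "\<forall>\<theta>. l \<in> cev_spectrum \<mu> \<sigma> \<gamma> \<theta> \<longrightarrow>
                (\<forall>p. cev_eigenfunction \<mu> \<sigma> \<gamma> \<theta> l p \<longleftrightarrow>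
                     (\<exists>c. c \<noteq> 0 \<and> (\<forall>x>0. p x = cev_p \<mu> \<sigma> \<gamma> \<Lambda> c x)))"
        by (rule allI, rule impI, rule allI, rule main[OF h, THEN conjunct2, THEN conjunct1, rule_format])
      show "\<forall>c>0. (\<forall>x>0. cev_p \<mu> \<sigma> \<gamma> \<Lambda> c x \<ge> 0)
                \<and> integrable (lebesgue_on {0<..}) (cev_p \<mu> \<sigma> \<gamma> \<Lambda> c)
                \<and> (\<exists>K1>0. \<exists>K2>0.
                      cev_p \<mu> \<sigma> \<gamma> \<Lambda> c \<sim>[at_right 0] (\<lambda>x. K1 * x powr (- \<gamma>))
                      \<and> cev_p \<mu> \<sigma> \<gamma> \<Lambda> c \<sim>[at_top]
                           (\<lambda>x. K2 * x powr ((2 - \<gamma>) * (1 - \<Lambda>) - 1)))"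
        by (rule allI, rule main[OF h, THEN conjunct2, THEN conjunct2, THEN conjunct1])
    qed
  qed
qed

end
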